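(* Let $p$ be a prime, $q=p^m$. Let $X, Y, Z \subset \mathbb{F}_q$ with $|X| \geq |Y| \geq |Z|$ and suppose that for all proper subfields $G$ of $\mathbb{F}_q$ and all elements $c \in \mathbb{F}_q$, we have $$|X \cap cG| \ll |G|^{1/2}.$$ For any complex valued weights $(\alpha_x)_{x\in X}$, $(\beta_y)_{y\in Y}$ and $(\gamma_z)_{z\in Z}$, with $$\max_{x\in X}|\alpha_x| \leq 1,\quad \max_{y\in Y}|\beta_y| \leq 1,\quad \max_{z\in Z}|\gamma_z| \leq 1,$$ we have $$\bigg|\sum_{x\in X}\sum_{y\in Y} \sum_{z \in Z}\alpha_{x}\beta_{y}\gamma_{z}\psi(xyz)\bigg| \ll q^{9/32 + o(1)} |X|^{95/128} |Y|^{3/4}|Z|^{15/16} + q^{17/58 + o(1)} |X|^{43/58} |Y|^{87/116}|Z|^{53/58} + q^{35/128 + o(1)} |X|^{97/128} |Y|^{3/4}|Z|^{15/16}.$$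
   Context: $\mathbb{F}_q$ is the finite field with $q=p^m$ elements. Let $Tr(x)=\sum_{i=0}^{m-1}x^{p^i}$ (the trace to $\mathbb{F}_p$), $e_p(x)=\exp(2\pi i x/p)$ and $\psi(x)=e_p(Tr(x))$. For $c\in\mathbb{F}_q$, $cG=\{cg:g\in G\}$. $U \ll V$ means that there is an absolute constant $C>0$ with $U\leq CV$. When such notation appears in a hypothesis, it is understood with some fixed implied constant (uniform over all $G$ and $c$), and the implied constants in the conclusion may depend on it, but not on $q$, the sets or the weights. The symbol $o(1)$ denotes a quantity tending to $0$ as $q\to\infty$, uniformly in the sets and weights.
   Formalization: Z is required not to contain 0; with 0 allowed the bound is false (q = p, X = Y = F_p, Z = {0}, all weights 1: the sum is p^2 but every term on the right has exponent below 1.79). F_q is realized as any field whose elements are natural numbers. *)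

theory Defs
  imports Complex_Main "HOL-Computational_Algebra.Primes" "HOL-Algebra.Subrings"
begin

(* For a field R with p^m elements: x + x^p + ... + x^(p^(m-1)). *)
definition field_trace :: "('a, 'b) ring_scheme \<Rightarrow> nat \<Rightarrow> nat \<Rightarrow> 'a \<Rightarrow> 'a" where
  "field_trace R p m x = (\<Oplus>\<^bsub>R\<^esub>i\<in>{..<m}. x [^]\<^bsub>R\<^esub> (p ^ i))"

(* The least residue of an element of the prime subfield. In characteristic p the elements k * 1
   with k < p are distinct and make up the prime subfield, so the description is
   well-defined there; the trace takes its values in the prime subfield. *)
definition prime_field_residue :: "('a, 'b) ring_scheme \<Rightarrow> nat \<Rightarrow> 'a \<Rightarrow> nat" where
  "prime_field_residue R p t = (THE k. k < p \<and> [k] \<cdot>\<^bsub>R\<^esub> \<one>\<^bsub>R\<^esub> = t)"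

definition e_mod :: "nat \<Rightarrow> nat \<Rightarrow> complex" where
  "e_mod p k = exp (2 * of_real pi * \<i> * of_nat k / of_nat p)"

definition add_character :: "('a, 'b) ring_scheme \<Rightarrow> nat \<Rightarrow> nat \<Rightarrow> 'a \<Rightarrow> complex" where
  "add_character R p m x = e_mod p (prime_field_residue R p (field_trace R p m x))"

definition trilinear_sum ::
  "('a, 'b) ring_scheme \<Rightarrow> nat \<Rightarrow> nat \<Rightarrow> 'a set \<Rightarrow> 'a set \<Rightarrow> 'a set \<Rightarrow>
   ('a \<Rightarrow> complex) \<Rightarrow> ('a \<Rightarrow> complex) \<Rightarrow> ('a \<Rightarrow> complex) \<Rightarrow> complex" where
  "trilinear_sum R p m Xs Ys Zs \<alpha> \<beta> \<gamma> =
     (\<Sum>x\<in>Xs. \<Sum>y\<in>Ys. \<Sum>z\<in>Zs.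
        \<alpha> x * \<beta> y * \<gamma> z * add_character R p m (x \<otimes>\<^bsub>R\<^esub> y \<otimes>\<^bsub>R\<^esub> z))"

(* |Xs \<inter> c G| <= K |G|^(1/2) for all proper subfields G of R and all c in R
   (c = 0 included, with 0 G = {0}). *)
definition small_on_subfield_multiples :: "('a, 'b) ring_scheme \<Rightarrow> real \<Rightarrow> 'a set \<Rightarrow> bool" where
  "small_on_subfield_multiples R K Xs \<longleftrightarrow>
     (\<forall>G c. subfield G R \<longrightarrow> G \<noteq> carrier R \<longrightarrow> c \<in> carrier R \<longrightarrow>
        real (card (Xs \<inter> (c <#\<^bsub>R\<^esub> G))) \<le> K * real (card G) powr (1/2))"

end

theory Submission
  imports Defs "HOL-Library.Set_Algebras" "HOL-Computational_Algebra.Polynomial" "HOL-Real_Asymp.Real_Asymp"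
begin

text \<open>
  Write q for the order of the field and n = |X|, y = |Y|, z = |Z|.  Two Fourier estimates control the
  sum T.  Summing over x inside, Hoelder in y and orthogonality give
    |T|^4 \<le> q y^3 z^4 E(X)     (lemma trisum_le_additive_energy)
  with the additive energy E(X); grouping the product x z, Cauchy-Schwarz gives
    |T|^4 \<le> q^2 y^2 z^3 M(X)   (lemma trisum_le_mult_energy)
  with the multiplicative energy M(X).  Each energy alone may be as large as n^3, but by the sum-product
  phenomenon not both on one structured piece.  So X is cut up greedily (trisum_decomposition_bound):
  while the rest of X has additive energy at least n^3/D, the Balog-Szemeredi-Gowers theorem
  (balog_szemeredi_gowers) yields a piece V of it with few differences, V has small multiplicative energy
  (mult_energy_bound), and the second estimate bounds its share by |V| H, where
  H^4 = q y^3 z^4 / (n D).  The rest that finally remains falls under the first estimate, which bounds it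
  by n H.  The pieces are disjoint, so their shares add up to at most n H as well.

  The subfield hypothesis enters through mult_energy_bound.  If V has few differences but large
  multiplicative energy, then for a suitable a0 in V and for many b in V (the sets B1 and B2) the dilate
  b V meets a0 V in many points.  By Ruzsa's triangle inequality a sum of a few of these dilates is then
  not much larger than V + V - V - V.  Let R be the set of all quotients (a - b)/(c - d) with a, b in B2
  and c, d in B1.  A number outside R makes (x, y) \<mapsto> x + \<zeta> y injective on B2 \<times> B1; for \<zeta> = \<xi> - 1,
  \<zeta> = \<xi> b/a0 and \<zeta> = \<xi> a0/b with \<xi> in R the image also lies in a sum of a few dilates, which would be
  too small.  Hence R is closed under these operations, and it contains a subfield G with B1 and B2
  inside a0 G.  Some \<xi> in G has B2 + \<xi> B1 about as large as |B1| |B2| and |G| allow; as \<xi> is in R, a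
  multiple of this set lies in a sum of four dilates, which is small.  Since |B1| and |B2| are at most a constant times |G|^(1/2)
  unless G is everything, this bounds |V|.

  Up to constants and logarithms the result is: a contradiction arises as soon as
  D^32 (q/z^2)^4 < min(n, q/n) and D^29 (q/z^2)^5 < n.  Taking D at this limit gives the three terms of
  the theorem; the logarithms, which come from dyadic pigeonholing, are absorbed by q^o(1).

  The combinatorics is carried out in the type classes of abelian groups and commutative rings.  To reach
  it, every field whose carrier is a set of natural numbers is embedded in a single commutative ring,
  the product of all such fields.  There it is a subset with its own unit element, which differs from the
  unit of the ring.
\<close>

section \<open>The Ruzsa triangle inequality and the lemma of Petridis\<close>

text \<open>
  Fix for each s in U + T a representation s = u + t.  Then (s, w) is recovered from the pair
  (u - w, w + t), whose sum is s.
\<close>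

lemma ruzsa_triangle:
  fixes U W T :: "'a::ab_group_add set"
  assumes fin: "finite U" "finite W" "finite T"
  shows "card (U + T) * card W \<le> card (U + uminus ` W) * card (W + T)"
proof -
  have "\<forall>s\<in>U + T. \<exists>u\<in>U. s - u \<in> T"
    by (force simp: set_plus_def)
  then obtain u where u: "\<And>s. s \<in> U + T \<Longrightarrow> u s \<in> U \<and> s - u s \<in> T"
    by metis
  define f where "f = (\<lambda>(s, w). (u s - w, w + (s - u s)))"
  have "inj_on f ((U + T) \<times> W)"
  proof (rule inj_onI, clarsimp simp: f_def)
    fix s w s' w'
    assume *: "u s - w = u s' - w'" "w + (s - u s) = w' + (s' - u s')"
    then have "(u s - w) + (w + (s - u s)) = (u s' - w') + (w' + (s' - u s'))"
      by simp
    then have "s = s'"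
      by simp
    with * show "s = s' \<and> w = w'"
      by simp
  qed
  moreover have "f ` ((U + T) \<times> W) \<subseteq> (U + uminus ` W) \<times> (W + T)"
  proof (clarsimp simp: f_def)
    fix s w assume "s \<in> U + T" "w \<in> W"
    with u[of s] have "u s \<in> U" "- w \<in> uminus ` W" "s - u s \<in> T" by auto
    then have "u s + - w \<in> U + uminus ` W" "w + (s - u s) \<in> W + T"
      using \<open>w \<in> W\<close> by (blast intro: set_plus_intro)+
    then show "u s - w \<in> U + uminus ` W \<and> w + (s - u s) \<in> W + T" by simp
  qed
  moreover have "finite ((U + uminus ` W) \<times> (W + T))"
    using fin by (simp add: finite_set_plus)
  ultimately have "card ((U + T) \<times> W) \<le> card ((U + uminus ` W) \<times> (W + T))"
    by (metis card_inj_on_le)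
  then show ?thesis
    by (simp add: card_cartesian_product)
qed

text \<open>
  The subset Y of X minimising |Y + B|/|Y| has the stated property for every C, by induction on C: when a
  new element c is added, the part of Y + B + c that is already covered contains Z + B + c for the set Z
  of all x with x + B + c covered, and |Z + B| is bounded from below by minimality.
\<close>

lemma petridis:
  fixes X B :: "'a::ab_group_add set"
  assumes "finite X" "X \<noteq> {}" "finite B"
  obtains Y where "Y \<subseteq> X" "Y \<noteq> {}" "card (Y + B) * card X \<le> card (X + B) * card Y"
    "\<And>C. finite C \<Longrightarrow> card (Y + B + C) * card Y \<le> card (Y + B) * card (Y + C)"
proof -
  define f where "f Z = real (card (Z + B)) / real (card Z)" for Z
  have "finite {Z. Z \<subseteq> X \<and> Z \<noteq> {}}" using assms by simp
  moreover have "{Z. Z \<subseteq> X \<and> Z \<noteq> {}} \<noteq> {}" using assms by auto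
  ultimately obtain Y where "is_arg_min f (\<lambda>Z. Z \<in> {Z. Z \<subseteq> X \<and> Z \<noteq> {}}) Y"
    using ex_is_arg_min_if_finite by blast
  then have Y: "Y \<subseteq> X" "Y \<noteq> {}" and min: "\<And>Z. Z \<subseteq> X \<Longrightarrow> Z \<noteq> {} \<Longrightarrow> f Y \<le> f Z"
    by (auto simp: is_arg_min_linorder)
  have finY: "finite Y" using Y assms finite_subset by blast
  have mult: "card (Y + B) * card Z \<le> card (Z + B) * card Y" if "Z \<subseteq> X" for Z
  proof (cases "Z = {}")
    case False
    have "card Y > 0" "card Z > 0"
      using that False assms(1) Y finY finite_subset[OF that] by (auto simp: card_gt_0_iff)
    then have "real (card (Y + B)) * real (card Z) \<le> real (card (Z + B)) * real (card Y)"
      using min[OF that False] unfolding f_def by (simp add: field_simps)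
    then show ?thesis by (metis of_nat_le_iff of_nat_mult)
  qed simp
  have "card (Y + B + C) * card Y \<le> card (Y + B) * card (Y + C)" if "finite C" for C
    using that
  proof (induction C)
    case empty
    have "Y + B + {} = {}" "Y + {} = {}" by (auto simp: set_plus_def)
    then show ?case by simp
  next
    case (insert c C)
    define Z where "Z = {x \<in> Y. \<forall>b\<in>B. x + b + c \<in> Y + B + C}"
    have ZY: "Z \<subseteq> Y" by (auto simp: Z_def)
    then have finZ: "finite Z" using finY finite_subset by blast
    \<comment> \<open>Z collects the x whose translate x + B + c brings nothing new\<close>
    have "Y + B + insert c C \<subseteq> (Y + B + C) \<union> (\<lambda>v. v + c) ` ((Y + B) - (Z + B))"
    proof
      fix v assume "v \<in> Y + B + insert c C"
      then obtain w d where wd: "w \<in> Y + B" "d \<in> insert c C" "v = w + d"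
        unfolding set_plus_def[of _ "insert c C"] by blast
      show "v \<in> (Y + B + C) \<union> (\<lambda>v. v + c) ` ((Y + B) - (Z + B))"
      proof (cases "d = c \<and> w \<notin> Z + B")
        case True
        then show ?thesis using wd by auto
      next
        case False
        then consider "d \<in> C" | "d = c" "w \<in> Z + B" using wd by auto
        then show ?thesis
        proof cases
          case 1
          then show ?thesis using wd by auto
        next
          case 2
          then show ?thesis using wd by (auto simp: Z_def elim!: set_plus_elim)
        qed
      qed
    qed
    then have "card (Y + B + insert c C) \<le> card ((Y + B + C) \<union> (\<lambda>v. v + c) ` ((Y + B) - (Z + B)))"
      using finY assms insert.hyps by (intro card_mono) (auto simp: finite_set_plus)
    also have "\<dots> \<le> card (Y + B + C) + card ((\<lambda>v. v + c) ` ((Y + B) - (Z + B)))"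
      by (rule card_Un_le)
    also have "card ((\<lambda>v. v + c) ` ((Y + B) - (Z + B))) \<le> card ((Y + B) - (Z + B))"
      using finY assms by (intro card_image_le) (auto simp: finite_set_plus)
    also have "card ((Y + B) - (Z + B)) = card (Y + B) - card (Z + B)"
      using finZ assms ZY by (intro card_Diff_subset) (auto simp: finite_set_plus set_plus_mono2)
    finally have 1: "card (Y + B + insert c C) \<le> card (Y + B + C) + (card (Y + B) - card (Z + B))"
      by simp
    have le: "card (Z + B) \<le> card (Y + B)"
      using finY assms ZY by (intro card_mono) (auto simp: finite_set_plus set_plus_mono2)
    have disj: "(Y + C) \<inter> (\<lambda>x. x + c) ` (Y - Z) = {}"
    proof -
      have "x \<in> Z" if xY: "x \<in> Y" "x + c \<in> Y + C" for x
      proof -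
        obtain y d where yd: "y \<in> Y" "d \<in> C" "x + c = y + d" using xY(2) unfolding set_plus_def by blast
        have "x + b + c \<in> Y + B + C" if "b \<in> B" for b
        proof -
          have "x + b + c = (y + b) + d" using yd(3) by (simp add: algebra_simps)
          then show ?thesis using yd that by (metis set_plus_intro)
        qed
        then show ?thesis using xY(1) by (auto simp: Z_def)
      qed
      then show ?thesis by auto
    qed
    have "card (Y + C) + card (Y - Z) = card (Y + C) + card ((\<lambda>x. x + c) ` (Y - Z))"
      by (subst card_image) (auto intro: inj_onI)
    also have "\<dots> = card ((Y + C) \<union> (\<lambda>x. x + c) ` (Y - Z))"
      using finY insert.hyps disj by (intro card_Un_disjoint[symmetric]) (auto simp: finite_set_plus)
    also have "\<dots> \<le> card (Y + insert c C)"
      using finY insert.hyps by (intro card_mono) (auto simp: finite_set_plus intro!: set_plus_intro elim!: set_plus_elim)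
    finally have 2: "card (Y + C) + card Y \<le> card (Y + insert c C) + card Z"
      using card_Diff_subset[OF finZ ZY] card_mono[OF finY ZY] by simp
    have 3: "card (Y + B) * card Z \<le> card (Z + B) * card Y"
      using mult[of Z] ZY Y by auto
    have "card (Y + B + insert c C) * card Y + card (Z + B) * card Y \<le> card (Y + B + C) * card Y + card (Y + B) * card Y"
      using 1 le by (metis (no_types, lifting) add_mult_distrib le_add_diff_inverse2 mult_le_mono1 add.assoc add_le_mono1)
    also have "\<dots> \<le> card (Y + B) * (card (Y + C) + card Y)"
      using insert.IH by (simp add: add_mult_distrib2)
    also have "\<dots> \<le> card (Y + B) * (card (Y + insert c C) + card Z)"
      using 2 by (rule mult_le_mono2)
    finally show ?case using 3 by (simp add: add_mult_distrib2)
  qed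
  then show thesis using that Y mult[of X] by blast
qed

section \<open>Paths in dense bipartite graphs\<close>

lemma sum_square_le_card_times_sum_squares:
  fixes f :: "'a \<Rightarrow> real"
  shows "(\<Sum>i\<in>I. f i)\<^sup>2 \<le> real (card I) * (\<Sum>i\<in>I. (f i)\<^sup>2)"
proof -
  have "0 \<le> (\<Sum>i\<in>I. \<Sum>j\<in>I. (f i - f j)\<^sup>2)" by (intro sum_nonneg) simp
  also have "\<dots> = (\<Sum>i\<in>I. \<Sum>j\<in>I. (f i)\<^sup>2 + (f j)\<^sup>2 - 2 * (f i * f j))"
    by (simp add: power2_diff algebra_simps)
  also have "\<dots> = 2 * (real (card I) * (\<Sum>i\<in>I. (f i)\<^sup>2)) - 2 * (\<Sum>i\<in>I. \<Sum>j\<in>I. f i * f j)"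
    by (simp add: sum.distrib sum_subtractf sum_distrib_left)
  also have "(\<Sum>i\<in>I. \<Sum>j\<in>I. f i * f j) = (\<Sum>i\<in>I. f i)\<^sup>2"
    by (simp add: power2_eq_square sum_product)
  finally show ?thesis by simp
qed

lemma exists_ge_average:
  fixes f :: "'a \<Rightarrow> real"
  assumes "finite I" "0 < c" "0 < n" "real (card I) \<le> n" "c * n \<le> (\<Sum>i\<in>I. f i)"
  shows "\<exists>i\<in>I. c \<le> f i"
proof (rule ccontr)
  assume neg: "\<not> ?thesis"
  have "0 < c * n" using assms by simp
  then have "I \<noteq> {}" using assms(5) by force
  then have "(\<Sum>i\<in>I. f i) < (\<Sum>i\<in>I. c)"
    using neg assms(1) by (intro sum_strict_mono) auto
  also have "\<dots> \<le> c * n" using assms by simp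
  finally show False using assms by simp
qed

lemma card_filter_bound:
  fixes f :: "'a \<Rightarrow> real"
  assumes "finite I" "\<And>i. i \<in> I \<Longrightarrow> 0 \<le> f i" "(\<Sum>i\<in>I. f i) \<le> s" 
  shows "real (card {i \<in> I. t < f i}) * t \<le> s"
proof -
  have "real (card {i \<in> I. t < f i}) * t = (\<Sum>i\<in>{i \<in> I. t < f i}. t)" by simp
  also have "\<dots> \<le> (\<Sum>i\<in>{i \<in> I. t < f i}. f i)" by (intro sum_mono) auto
  also have "\<dots> \<le> (\<Sum>i\<in>I. f i)" using assms by (intro sum_mono2) auto
  finally show ?thesis using assms by simp
qed

text \<open>
  The combinatorial core of the Balog-Szemeredi-Gowers theorem, with two degrees of regularity at once.
  For a vertex b0 chosen by averaging, the neighbourhood A0 is large and few pairs in it have few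
  common neighbours.  Discarding the vertices of A0 that occur in many such bad pairs leaves A'.  Paths
  of length four join a and a' through any c in A0 that forms no bad pair with either, so half of
  A0 is enough, and the threshold \<delta>^2 n for the number of common neighbours suffices.  For paths
  of length three, c must also be adjacent to b, so a proportion \<delta> of A0 must be avoided by the bad pairs;
  this forces the weaker threshold \<delta>^3 n.  Keeping the two thresholds apart gives the exponent 5 of
  \<delta> in both counts.
\<close>

lemma dense_graph_paths:
  fixes A :: "'a set" and B :: "'b set" and G :: "('a \<times> 'b) set" and n \<delta> :: real
  assumes fin: "finite A" "finite B" and cardn: "real (card A) \<le> n" "real (card B) \<le> n" "0 < n"
    and G: "G \<subseteq> A \<times> B" "\<delta> * n\<^sup>2 \<le> real (card G)" "0 < \<delta>"
  obtains A' B' where "A' \<subseteq> A" "B' \<subseteq> B" "\<delta> * n / 6 \<le> real (card A')" "\<delta> * n / 4 \<le> real (card B')"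
    "\<And>a a'. a \<in> A' \<Longrightarrow> a' \<in> A' \<Longrightarrow>
       \<delta>^5 * n^3 / 393216 \<le> real (card {(c, b, b'). (a, b) \<in> G \<and> (c, b) \<in> G \<and> (c, b') \<in> G \<and> (a', b') \<in> G})"
    "\<And>a b. a \<in> A' \<Longrightarrow> b \<in> B' \<Longrightarrow>
       \<delta>^5 * n\<^sup>2 / 24576 \<le> real (card {(c, b'). (a, b') \<in> G \<and> (c, b') \<in> G \<and> (c, b) \<in> G})"
proof -
  define E where "E a b = (of_bool ((a, b) \<in> G) :: real)" for a b
  define deg where "deg a = (\<Sum>b\<in>B. E a b)" for a
  define codeg where "codeg a a' = (\<Sum>b\<in>B. E a b * E a' b)" for a a'
  have cardG: "real (card G) = (\<Sum>a\<in>A. deg a)"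
  proof -
    have "(\<Sum>a\<in>A. deg a) = (\<Sum>x\<in>A \<times> B. of_bool (x \<in> G))"
      by (simp add: deg_def E_def sum.cartesian_product split_def)
    also have "\<dots> = real (card ((A \<times> B) \<inter> {x. x \<in> G}))"
      using fin by (subst sum_of_bool_eq) auto
    also have "(A \<times> B) \<inter> {x. x \<in> G} = G" using G by auto
    finally show ?thesis by simp
  qed
  define A1 where "A1 = {a \<in> A. \<delta> * n / 2 \<le> deg a}"
  have A1: "A1 \<subseteq> A" "finite A1" "real (card A1) \<le> n"
    using fin cardn card_mono[OF fin(1), of A1] by (auto simp: A1_def)
  define N where "N b = {a \<in> A1. (a, b) \<in> G}" for b
  have finN: "finite (N b)" for b using A1 by (simp add: N_def)
  have cardN: "real (card (N b)) = (\<Sum>a\<in>A1. E a b)" for b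
    unfolding E_def N_def using A1 by (subst sum_of_bool_eq) (auto simp: Int_def)
  have sumN: "\<delta> * n\<^sup>2 / 2 \<le> (\<Sum>b\<in>B. real (card (N b)))"
  proof -
    have "(\<Sum>a\<in>A - A1. deg a) \<le> (\<Sum>a\<in>A - A1. \<delta> * n / 2)"
      by (intro sum_mono) (auto simp: A1_def)
    also have "\<dots> = real (card (A - A1)) * (\<delta> * n / 2)" by simp
    also have "\<dots> \<le> n * (\<delta> * n / 2)"
      using cardn card_mono[OF fin(1), of "A - A1"] G by (intro mult_right_mono) auto
    finally have "(\<Sum>a\<in>A - A1. deg a) \<le> \<delta> * n\<^sup>2 / 2" by (simp add: power2_eq_square field_simps)
    moreover have "(\<Sum>a\<in>A. deg a) = (\<Sum>a\<in>A - A1. deg a) + (\<Sum>a\<in>A1. deg a)"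
      using A1 fin by (intro sum.subset_diff) auto
    moreover have "(\<Sum>b\<in>B. real (card (N b))) = (\<Sum>a\<in>A1. deg a)"
      unfolding cardN deg_def by (rule sum.swap)
    ultimately show ?thesis using cardG G by simp
  qed
  have sumN2: "\<delta>\<^sup>2 * n^3 / 4 \<le> (\<Sum>b\<in>B. (real (card (N b)))\<^sup>2)"
  proof -
    have "(\<delta> * n\<^sup>2 / 2)\<^sup>2 \<le> (\<Sum>b\<in>B. real (card (N b)))\<^sup>2"
      using sumN G cardn by (intro power_mono) auto
    also have "\<dots> \<le> real (card B) * (\<Sum>b\<in>B. (real (card (N b)))\<^sup>2)"
      by (rule sum_square_le_card_times_sum_squares)
    also have "\<dots> \<le> n * (\<Sum>b\<in>B. (real (card (N b)))\<^sup>2)"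
      using cardn by (intro mult_right_mono sum_nonneg) auto
    finally have "n * (\<delta>\<^sup>2 * n^3 / 4) \<le> n * (\<Sum>b\<in>B. (real (card (N b)))\<^sup>2)"
      by (simp add: power2_eq_square power3_eq_cube mult_ac)
    then show ?thesis using cardn by simp
  qed
  define bad where "bad \<theta> b = (\<Sum>a\<in>A1. \<Sum>a'\<in>A1. of_bool (codeg a a' < \<theta> * n) * (E a b * E a' b))" for \<theta> b
  have sum_bad: "(\<Sum>b\<in>B. bad \<theta> b) \<le> \<theta> * n^3" if "0 \<le> \<theta>" for \<theta>
  proof -
    have "(\<Sum>b\<in>B. bad \<theta> b) = (\<Sum>a\<in>A1. \<Sum>b\<in>B. \<Sum>a'\<in>A1. of_bool (codeg a a' < \<theta> * n) * (E a b * E a' b))"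
      unfolding bad_def by (rule sum.swap)
    also have "\<dots> = (\<Sum>a\<in>A1. \<Sum>a'\<in>A1. \<Sum>b\<in>B. of_bool (codeg a a' < \<theta> * n) * (E a b * E a' b))"
      by (intro sum.cong refl sum.swap)
    also have "\<dots> = (\<Sum>a\<in>A1. \<Sum>a'\<in>A1. of_bool (codeg a a' < \<theta> * n) * codeg a a')"
      by (simp only: codeg_def sum_distrib_left)
    also have "\<dots> \<le> (\<Sum>a\<in>A1. \<Sum>a'\<in>A1. \<theta> * n)"
      using that cardn by (intro sum_mono) (auto simp: of_bool_def)
    also have "\<dots> = real (card A1) * real (card A1) * (\<theta> * n)" by simp
    also have "\<dots> \<le> n * n * (\<theta> * n)"
      using A1 that cardn by (intro mult_right_mono mult_mono) auto
    finally show ?thesis by (simp add: power3_eq_cube mult_ac)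
  qed
  define \<theta>1 where "\<theta>1 = \<delta>\<^sup>2 / 256"
  define \<theta>2 where "\<theta>2 = \<delta>^3 / 1024"
  have \<theta>: "0 < \<theta>1" "0 < \<theta>2" using G by (auto simp: \<theta>1_def \<theta>2_def)
  \<comment> \<open>weights 16 and 64/\<delta> make the neighbourhood of b0 good for both thresholds simultaneously\<close>
  have "\<exists>b\<in>B. \<delta>\<^sup>2 * n\<^sup>2 / 8 \<le> (real (card (N b)))\<^sup>2 - 16 * bad \<theta>1 b - 64 / \<delta> * bad \<theta>2 b"
  proof (rule exists_ge_average)
    have "16 * (\<Sum>b\<in>B. bad \<theta>1 b) \<le> \<delta>\<^sup>2 * n^3 / 16"
      using sum_bad[of \<theta>1] \<theta> by (simp add: \<theta>1_def)
    moreover have "64 / \<delta> * (\<Sum>b\<in>B. bad \<theta>2 b) \<le> 64 / \<delta> * (\<theta>2 * n^3)"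
      using sum_bad[of \<theta>2] \<theta> G by (intro mult_left_mono) auto
    moreover have "64 / \<delta> * (\<theta>2 * n^3) = \<delta>\<^sup>2 * n^3 / 16"
      using G by (simp add: \<theta>2_def power2_eq_square power3_eq_cube)
    moreover have "(\<Sum>b\<in>B. (real (card (N b)))\<^sup>2 - 16 * bad \<theta>1 b - 64 / \<delta> * bad \<theta>2 b)
        = (\<Sum>b\<in>B. (real (card (N b)))\<^sup>2) - 16 * (\<Sum>b\<in>B. bad \<theta>1 b) - 64 / \<delta> * (\<Sum>b\<in>B. bad \<theta>2 b)"
      by (simp only: sum_subtractf sum_distrib_left)
    moreover have "\<delta>\<^sup>2 * n\<^sup>2 / 8 * n = \<delta>\<^sup>2 * n^3 / 8"
      by (simp add: power2_eq_square power3_eq_cube)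
    ultimately show "\<delta>\<^sup>2 * n\<^sup>2 / 8 * n \<le> (\<Sum>b\<in>B. (real (card (N b)))\<^sup>2 - 16 * bad \<theta>1 b - 64 / \<delta> * bad \<theta>2 b)"
      using sumN2 by linarith
  qed (use fin cardn G in auto)
  then obtain b0 where b0: "b0 \<in> B"
    and ge: "\<delta>\<^sup>2 * n\<^sup>2 / 8 \<le> (real (card (N b0)))\<^sup>2 - 16 * bad \<theta>1 b0 - 64 / \<delta> * bad \<theta>2 b0" by blast
  define A0 where "A0 = N b0"
  define k where "k = real (card A0)"
  have bad_nonneg: "0 \<le> bad \<theta> b" for \<theta> b
    unfolding bad_def by (intro sum_nonneg) (auto simp: E_def)
  have k0: "0 \<le> k" by (simp add: k_def)
  have b1: "0 \<le> 64 / \<delta> * bad \<theta>2 b0" using bad_nonneg G by simp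
  have "(\<delta> * n / 3)\<^sup>2 \<le> \<delta>\<^sup>2 * n\<^sup>2 / 8" by (simp add: power_divide power_mult_distrib)
  also have "\<dots> \<le> k\<^sup>2" using ge b1 bad_nonneg[of \<theta>1 b0] by (simp add: k_def A0_def)
  finally have kn: "\<delta> * n / 3 \<le> k" using k0 by (rule power2_le_imp_le)
  have kpos: "0 < k" using kn G cardn by (smt (verit) divide_pos_pos mult_pos_pos)
  have bad1: "bad \<theta>1 b0 \<le> k\<^sup>2 / 16"
  proof -
    have "0 \<le> \<delta>\<^sup>2 * n\<^sup>2 / 8" by simp
    then show ?thesis using ge b1 unfolding k_def A0_def by linarith
  qed
  have bad2: "bad \<theta>2 b0 \<le> \<delta> * k\<^sup>2 / 64"
  proof -
    have "0 \<le> \<delta>\<^sup>2 * n\<^sup>2 / 8" by simp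
    then have "64 / \<delta> * bad \<theta>2 b0 \<le> k\<^sup>2" using ge bad_nonneg[of \<theta>1 b0] unfolding k_def A0_def by linarith
    then show ?thesis using G by (simp add: field_simps)
  qed
  define bd where "bd \<theta> a = real (card {c \<in> A0. codeg a c < \<theta> * n})" for \<theta> a
  have bd_nonneg: "0 \<le> bd \<theta> a" for \<theta> a by (simp add: bd_def)
  have finA0: "finite A0" by (simp add: A0_def finN)
  have sum_bd: "(\<Sum>a\<in>A0. bd \<theta> a) = bad \<theta> b0" for \<theta>
  proof -
    have "bad \<theta> b0 = (\<Sum>a\<in>A1. \<Sum>a'\<in>A1. of_bool (codeg a a' < \<theta> * n \<and> a' \<in> A0) * of_bool (a \<in> A0))"
      unfolding bad_def by (intro sum.cong refl) (auto simp: A0_def N_def E_def)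
    also have "\<dots> = (\<Sum>a\<in>A1. (\<Sum>a'\<in>A1. of_bool (codeg a a' < \<theta> * n \<and> a' \<in> A0)) * of_bool (a \<in> A0))"
      by (simp only: sum_distrib_right)
    also have "\<dots> = (\<Sum>a\<in>A1. bd \<theta> a * of_bool (a \<in> A0))"
    proof (intro sum.cong refl arg_cong2[where f = "(*)"])
      fix a assume "a \<in> A1"
      have "(\<Sum>a'\<in>A1. of_bool (codeg a a' < \<theta> * n \<and> a' \<in> A0)) 
          = real (card (A1 \<inter> {a'. codeg a a' < \<theta> * n \<and> a' \<in> A0}))"
        using A1 by (subst sum_of_bool_eq) auto
      also have "A1 \<inter> {a'. codeg a a' < \<theta> * n \<and> a' \<in> A0} = {c \<in> A0. codeg a c < \<theta> * n}"
        by (auto simp: A0_def N_def)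
      finally show "(\<Sum>a'\<in>A1. of_bool (codeg a a' < \<theta> * n \<and> a' \<in> A0)) = bd \<theta> a"
        by (simp add: bd_def)
    qed
    also have "\<dots> = (\<Sum>a\<in>A0. bd \<theta> a)"
      using A1 by (intro sum.mono_neutral_cong_right) (auto simp: A0_def N_def)
    finally show ?thesis by simp
  qed
  define A' where "A' = {a \<in> A0. bd \<theta>1 a \<le> k / 4 \<and> bd \<theta>2 a \<le> \<delta> * k / 16}"
  have A'A: "A' \<subseteq> A0" "A0 \<subseteq> A1" by (auto simp: A'_def A0_def N_def)
  have cardA': "\<delta> * n / 6 \<le> real (card A')"
  proof -
    have "real (card {a \<in> A0. k / 4 < bd \<theta>1 a}) * (k / 4) \<le> k\<^sup>2 / 16"
      using bad1 by (intro card_filter_bound finA0) (simp_all only: sum_bd bd_nonneg)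
    then have "real (card {a \<in> A0. k / 4 < bd \<theta>1 a}) * (k / 4) \<le> (k / 4) * (k / 4)"
      by (simp add: power2_eq_square)
    then have 1: "real (card {a \<in> A0. k / 4 < bd \<theta>1 a}) \<le> k / 4"
      using kpos by simp
    have "real (card {a \<in> A0. \<delta> * k / 16 < bd \<theta>2 a}) * (\<delta> * k / 16) \<le> \<delta> * k\<^sup>2 / 64"
      using bad2 by (intro card_filter_bound finA0) (simp_all only: sum_bd bd_nonneg)
    then have "real (card {a \<in> A0. \<delta> * k / 16 < bd \<theta>2 a}) * (\<delta> * k / 16) \<le> (k / 4) * (\<delta> * k / 16)"
      by (simp add: power2_eq_square mult_ac)
    then have 2: "real (card {a \<in> A0. \<delta> * k / 16 < bd \<theta>2 a}) \<le> k / 4"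
      using kpos G by simp
    have "A0 \<subseteq> A' \<union> ({a \<in> A0. k / 4 < bd \<theta>1 a} \<union> {a \<in> A0. \<delta> * k / 16 < bd \<theta>2 a})"
      by (auto simp: A'_def)
    then have "card A0 \<le> card (A' \<union> ({a \<in> A0. k / 4 < bd \<theta>1 a} \<union> {a \<in> A0. \<delta> * k / 16 < bd \<theta>2 a}))"
      using finA0 A'A finite_subset by (intro card_mono) auto
    also have "\<dots> \<le> card A' + (card {a \<in> A0. k / 4 < bd \<theta>1 a} + card {a \<in> A0. \<delta> * k / 16 < bd \<theta>2 a})"
      by (meson card_Un_le add_left_mono le_trans)
    finally have "k \<le> real (card A') + (k / 4 + k / 4)" using 1 2 by (simp add: k_def)
    then show ?thesis using kn by simp
  qed
  define B' where "B' = {b \<in> B. \<delta> * k / 4 \<le> real (card (N b \<inter> A0))}"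
  have card_codeg: "codeg a c = real (card {b. (a, b) \<in> G \<and> (c, b) \<in> G})" for a c
  proof -
    have "codeg a c = (\<Sum>b\<in>B. of_bool ((a, b) \<in> G \<and> (c, b) \<in> G))"
      unfolding codeg_def E_def by (intro sum.cong) auto
    also have "\<dots> = real (card (B \<inter> {b. (a, b) \<in> G \<and> (c, b) \<in> G}))"
      using fin by (subst sum_of_bool_eq) auto
    also have "B \<inter> {b. (a, b) \<in> G \<and> (c, b) \<in> G} = {b. (a, b) \<in> G \<and> (c, b) \<in> G}" using G by auto
    finally show ?thesis .
  qed
  have fin_nb: "finite {b. (a, b) \<in> G \<and> (c, b) \<in> G}" for a c
    using fin G by (auto intro: finite_subset[of _ B])
  have cardB': "\<delta> * n / 4 \<le> real (card B')"
  proof -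
    have NA0: "real (card (N b \<inter> A0)) = (\<Sum>a\<in>A0. E a b)" for b
    proof -
      have "N b \<inter> A0 = A0 \<inter> {a. (a, b) \<in> G}" by (auto simp: A0_def N_def)
      then show ?thesis using finA0 by (simp add: E_def sum_of_bool_eq)
    qed
    have le_k: "real (card (N b \<inter> A0)) \<le> k" for b
      unfolding k_def by (simp add: card_mono finA0)
    have "k * (\<delta> * n / 2) = (\<Sum>a\<in>A0. \<delta> * n / 2)" by (simp add: k_def)
    also have "\<dots> \<le> (\<Sum>a\<in>A0. deg a)" using A'A by (intro sum_mono) (auto simp: A1_def)
    also have "\<dots> = (\<Sum>b\<in>B. real (card (N b \<inter> A0)))"
      unfolding NA0 deg_def by (rule sum.swap)
    also have "\<dots> = (\<Sum>b\<in>B'. real (card (N b \<inter> A0))) + (\<Sum>b\<in>B - B'. real (card (N b \<inter> A0)))"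
      using fin by (subst add.commute) (intro sum.subset_diff, auto simp: B'_def)
    also have "(\<Sum>b\<in>B'. real (card (N b \<inter> A0))) \<le> (\<Sum>b\<in>B'. k)" by (intro sum_mono le_k)
    also have "(\<Sum>b\<in>B - B'. real (card (N b \<inter> A0))) \<le> (\<Sum>b\<in>B - B'. \<delta> * k / 4)"
      by (intro sum_mono) (auto simp: B'_def)
    also have "(\<Sum>b\<in>B - B'. \<delta> * k / 4) = real (card (B - B')) * (\<delta> * k / 4)" by simp
    also have "\<dots> \<le> n * (\<delta> * k / 4)"
      using cardn card_mono[OF fin(2), of "B - B'"] G kpos by (intro mult_right_mono) auto
    finally have "k * (\<delta> * n / 4) \<le> k * real (card B')" by (simp add: algebra_simps)
    then show ?thesis using kpos by simp
  qed
  show thesis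
  proof (rule that[OF _ _ cardA' cardB'])
    show "A' \<subseteq> A" "B' \<subseteq> B" using A'A A1 by (auto simp: B'_def)
  next
    fix a a' assume aa: "a \<in> A'" "a' \<in> A'"
    define D where "D = {c \<in> A0. \<theta>1 * n \<le> codeg a c \<and> \<theta>1 * n \<le> codeg a' c}"
    have finD: "finite D" using finA0 by (simp add: D_def)
    have "card A0 \<le> card (D \<union> ({c \<in> A0. codeg a c < \<theta>1 * n} \<union> {c \<in> A0. codeg a' c < \<theta>1 * n}))"
      using finA0 finD by (intro card_mono) (auto simp: D_def)
    also have "\<dots> \<le> card D + (card {c \<in> A0. codeg a c < \<theta>1 * n} + card {c \<in> A0. codeg a' c < \<theta>1 * n})"
      by (meson card_Un_le add_left_mono le_trans)
    finally have "k \<le> real (card D) + (bd \<theta>1 a + bd \<theta>1 a')" by (simp add: k_def bd_def)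
    then have D: "k / 2 \<le> real (card D)" using aa by (simp add: A'_def)
    let ?S = "SIGMA c:D. {b. (a, b) \<in> G \<and> (c, b) \<in> G} \<times> {b. (a', b) \<in> G \<and> (c, b) \<in> G}"
    let ?P = "{(c, b, b'). (a, b) \<in> G \<and> (c, b) \<in> G \<and> (c, b') \<in> G \<and> (a', b') \<in> G}"
    have "finite ?P"
      using fin G by (intro finite_subset[of ?P "A \<times> B \<times> B"]) auto
    moreover have "?S \<subseteq> ?P" by auto
    ultimately have "real (card ?S) \<le> real (card ?P)" by (simp add: card_mono)
    moreover have "real (card ?S) = (\<Sum>c\<in>D. codeg a c * codeg a' c)"
      using finD fin_nb by (subst card_SigmaI) (auto simp: card_cartesian_product card_codeg)
    moreover have "(\<Sum>c\<in>D. (\<theta>1 * n) * (\<theta>1 * n)) \<le> (\<Sum>c\<in>D. codeg a c * codeg a' c)"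
      using \<theta> cardn by (intro sum_mono mult_mono) (auto simp: D_def card_codeg)
    moreover have "(k / 2) * ((\<theta>1 * n) * (\<theta>1 * n)) \<le> (\<Sum>c\<in>D. (\<theta>1 * n) * (\<theta>1 * n))"
      unfolding sum_constant using D by (intro mult_right_mono) auto
    moreover have "(\<delta> * n / 6) * ((\<theta>1 * n) * (\<theta>1 * n)) \<le> (k / 2) * ((\<theta>1 * n) * (\<theta>1 * n))"
      using kn by (intro mult_right_mono) auto
    moreover have "(\<delta> * n / 6) * ((\<theta>1 * n) * (\<theta>1 * n)) = \<delta>^5 * n^3 / 393216"
      by (simp add: \<theta>1_def power_numeral_reduce)
    ultimately show "\<delta>^5 * n^3 / 393216 \<le> real (card ?P)" by linarith
  next
    fix a b assume ab: "a \<in> A'" "b \<in> B'"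
    define D where "D = {c \<in> N b \<inter> A0. \<theta>2 * n \<le> codeg a c}"
    have finD: "finite D" using finA0 by (simp add: D_def)
    have "card (N b \<inter> A0) \<le> card (D \<union> {c \<in> A0. codeg a c < \<theta>2 * n})"
      using finA0 finD by (intro card_mono) (auto simp: D_def)
    also have "\<dots> \<le> card D + card {c \<in> A0. codeg a c < \<theta>2 * n}" by (rule card_Un_le)
    finally have "real (card (N b \<inter> A0)) \<le> real (card D) + bd \<theta>2 a" by (simp add: bd_def)
    then have "\<delta> * k / 8 \<le> \<delta> * k / 16 + real (card D) - \<delta> * k / 16"
      using ab kpos G mult_pos_pos[of \<delta> k] by (simp add: A'_def B'_def)
    then have D: "\<delta> * k / 8 \<le> real (card D)" by simp
    let ?S = "SIGMA c:D. {b'. (a, b') \<in> G \<and> (c, b') \<in> G}"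
    let ?P = "{(c, b'). (a, b') \<in> G \<and> (c, b') \<in> G \<and> (c, b) \<in> G}"
    have "finite ?P"
      using fin G by (intro finite_subset[of ?P "A \<times> B"]) auto
    moreover have "?S \<subseteq> ?P" by (auto simp: D_def N_def)
    ultimately have "real (card ?S) \<le> real (card ?P)" by (simp add: card_mono)
    moreover have "real (card ?S) = (\<Sum>c\<in>D. codeg a c)"
      using finD fin_nb by (subst card_SigmaI) (auto simp: card_codeg)
    moreover have "(\<Sum>c\<in>D. \<theta>2 * n) \<le> (\<Sum>c\<in>D. codeg a c)"
      by (intro sum_mono) (auto simp: D_def)
    moreover have "(\<delta> * k / 8) * (\<theta>2 * n) \<le> (\<Sum>c\<in>D. \<theta>2 * n)"
      unfolding sum_constant using D \<theta> cardn by (intro mult_right_mono) auto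
    moreover have "(\<delta> * (\<delta> * n / 3) / 8) * (\<theta>2 * n) \<le> (\<delta> * k / 8) * (\<theta>2 * n)"
      using kn \<theta> cardn G by (intro mult_right_mono divide_right_mono mult_left_mono) auto
    moreover have "(\<delta> * (\<delta> * n / 3) / 8) * (\<theta>2 * n) = \<delta>^5 * n\<^sup>2 / 24576"
      by (simp add: \<theta>2_def power_numeral_reduce)
    ultimately show "\<delta>^5 * n\<^sup>2 / 24576 \<le> real (card ?P)" by linarith
  qed
qed

section \<open>The Balog-Szemeredi-Gowers theorem\<close>

lemma uminus_image_set_plus:
  fixes A B :: "'a::ab_group_add set"
  shows "uminus ` (A + B) = uminus ` A + uminus ` B"
proof (intro equalityI subsetI)
  fix x assume "x \<in> uminus ` (A + B)"
  then obtain a b where "a \<in> A" "b \<in> B" "x = - a + - b"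
    by (auto elim!: set_plus_elim)
  then show "x \<in> uminus ` A + uminus ` B" by blast
next
  fix x assume "x \<in> uminus ` A + uminus ` B"
  then obtain a b where "a \<in> A" "b \<in> B" "x = - a + - b"
    by (auto elim!: set_plus_elim)
  then show "x \<in> uminus ` (A + B)"
    by (intro image_eqI[of _ _ "a + b"]) auto
qed

text \<open>
  The additive energy is defined through sums; the number of solutions of a + b = c + d is the same as
  for differences.
\<close>

definition sum_reps :: "'a::ab_group_add set \<Rightarrow> 'a \<Rightarrow> nat" where
  "sum_reps A s = card {(a, b). a \<in> A \<and> b \<in> A \<and> a + b = s}"

definition additive_energy :: "'a::ab_group_add set \<Rightarrow> nat" where
  "additive_energy A = (\<Sum>s\<in>A + A. (sum_reps A s)\<^sup>2)"

lemma sum_reps_le_card: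
  assumes "finite A"
  shows "sum_reps A s \<le> card A"
proof -
  have "{(a, b). a \<in> A \<and> b \<in> A \<and> a + b = s} \<subseteq> (\<lambda>a. (a, s - a)) ` A"
  proof clarify
    fix a b assume "a \<in> A"
    then show "(a, b) \<in> (\<lambda>x. (x, a + b - x)) ` A" by (intro image_eqI[of _ _ a]) auto
  qed
  then show ?thesis
    unfolding sum_reps_def using assms by (meson card_image_le card_mono finite_imageI le_trans)
qed

lemma sum_reps_pos:
  assumes "finite A" "s \<in> A + A"
  shows "0 < sum_reps A s"
proof -
  have "finite {(a, b). a \<in> A \<and> b \<in> A \<and> a + b = s}"
    using assms by (rule_tac finite_subset[of _ "A \<times> A"]) auto
  moreover have "{(a, b). a \<in> A \<and> b \<in> A \<and> a + b = s} \<noteq> {}"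
    using assms(2) unfolding set_plus_def by blast
  ultimately show ?thesis by (simp add: sum_reps_def card_gt_0_iff)
qed

lemma card_sums_in:
  assumes "finite A" "P \<subseteq> A + A"
  shows "card {(a, b). a \<in> A \<and> b \<in> A \<and> a + b \<in> P} = (\<Sum>s\<in>P. sum_reps A s)"
proof -
  have finP: "finite P" using assms by (meson finite_set_plus finite_subset)
  have "{(a, b). a \<in> A \<and> b \<in> A \<and> a + b \<in> P} = (\<Union>s\<in>P. {(a, b). a \<in> A \<and> b \<in> A \<and> a + b = s})"
    by auto
  also have "card \<dots> = (\<Sum>s\<in>P. card {(a, b). a \<in> A \<and> b \<in> A \<and> a + b = s})"
  proof (rule card_UN_disjoint[OF finP])
    show "\<forall>s\<in>P. finite {(a, b). a \<in> A \<and> b \<in> A \<and> a + b = s}"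
      using assms by (clarify, rule_tac finite_subset[of _ "A \<times> A"]) auto
  qed auto
  finally show ?thesis by (simp add: sum_reps_def)
qed

lemma sum_le_sum_cover:
  fixes f :: "'a \<Rightarrow> real"
  assumes "finite I" "\<And>i. i \<in> I \<Longrightarrow> finite (P i)" "\<And>x. 0 \<le> f x" "S \<subseteq> (\<Union>i\<in>I. P i)"
  shows "sum f S \<le> (\<Sum>i\<in>I. sum f (P i))"
proof -
  have "sum f (\<Union>i\<in>I. P i) \<le> (\<Sum>i\<in>I. sum f (P i))"
    using assms(1,2)
  proof (induction I)
    case (insert a I)
    have "sum f (P a \<union> (\<Union>i\<in>I. P i)) + sum f (P a \<inter> (\<Union>i\<in>I. P i)) = sum f (P a) + sum f (\<Union>i\<in>I. P i)"
      using insert by (intro sum.union_inter) auto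
    moreover have "0 \<le> sum f (P a \<inter> (\<Union>i\<in>I. P i))" using assms(3) by (intro sum_nonneg)
    moreover have "sum f (\<Union>i\<in>I. P i) \<le> (\<Sum>i\<in>I. sum f (P i))" using insert by simp
    ultimately show ?case using insert by simp
  qed simp
  moreover have "sum f S \<le> sum f (\<Union>i\<in>I. P i)"
    using assms by (intro sum_mono2) auto
  ultimately show ?thesis by linarith
qed


lemma dyadic_index:
  assumes "0 < (k::nat)" "k \<le> 2 ^ l"
  obtains i where "i \<le> l" "2 ^ i \<le> k" "k < 2 ^ (i + 1)"
proof -
  obtain i where i: "2 ^ i \<le> k" "k < 2 ^ (i + 1)"
    using ex_power_ivl1[of 2 k] assms by auto
  have "(2::nat) ^ i \<le> 2 ^ l" using i assms by linarith
  then have "i \<le> l" by (simp add: power_increasing_iff)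
  then show thesis using that i by blast
qed

text \<open>
  Here n is an upper bound for |A|, \<delta> is the density of the graph of pairs whose sum is popular and n/\<tau> is
  the popularity.  Both parameters are kept, since the extreme cases \<delta> = \<tau>/\<Delta> with \<tau> = 1 and with \<tau> = \<Delta> are
  of different nature and the bounds for V + V - V - V and for V - V are balanced only at the end.  Paths
  of length four write each difference in V - V as an alternating sum of four popular sums in many ways.
  Paths of length three do the same for V + B with a second set B; Petridis' lemma applied to B and
  Ruzsa's triangle inequality with a subset of B then bound V + V - V - V with the power \<tau>^12;
  the bound for V - V alone would give \<tau>^16.
\<close>

lemma balog_szemeredi_gowers:
  fixes A :: "'a::ab_group_add set" and n \<Delta> :: real
  assumes fin: "finite A" and n: "real (card A) \<le> n" "0 < n" "n \<le> 2 ^ l"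
    and energy: "n^3 \<le> \<Delta> * real (additive_energy A)" and \<Delta>: "0 < \<Delta>"
  obtains V \<delta> \<tau> where "V \<subseteq> A" "0 < \<delta>" "\<delta> \<le> 1" "1 \<le> \<tau>" "\<tau> \<le> 2 * (real l + 1) * \<Delta> * \<delta>"
    "\<delta> * n / 6 \<le> real (card V)"
    "real (card (V + uminus ` V)) \<le> 2^19 * \<tau>^4 / \<delta> * n"
    "real (card (V + V + uminus ` (V + V))) \<le> 2^65 * \<tau>^12 / \<delta>^11 * n"
proof -
  define P where "P i = {s \<in> A + A. 2 ^ i \<le> sum_reps A s \<and> sum_reps A s < 2 ^ (i + 1)}" for i :: nat
  have finAA: "finite (A + A)" using fin by (simp add: finite_set_plus)
  have finP: "finite (P i)" for i using finAA by (simp add: P_def)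
  have cover: "A + A \<subseteq> (\<Union>i\<in>{..l}. P i)"
  proof
    fix s assume s: "s \<in> A + A"
    have "sum_reps A s \<le> 2 ^ l"
      using sum_reps_le_card[OF fin, of s] n by (meson of_nat_le_iff of_nat_le_numeral_power_cancel_iff order_trans)
    then obtain i where "i \<le> l" "2 ^ i \<le> sum_reps A s" "sum_reps A s < 2 ^ (i + 1)"
      using dyadic_index sum_reps_pos[OF fin s] by blast
    then show "s \<in> (\<Union>i\<in>{..l}. P i)" using s by (auto simp: P_def)
  qed
  define f where "f s = (real (sum_reps A s))\<^sup>2" for s
  have "real (additive_energy A) = (\<Sum>s\<in>A + A. f s)"
    by (simp add: additive_energy_def f_def)
  also have "\<dots> \<le> (\<Sum>i\<le>l. \<Sum>s\<in>P i. f s)"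
    using cover finP by (intro sum_le_sum_cover) (auto simp: f_def)
  finally have "\<Delta> * real (additive_energy A) \<le> \<Delta> * (\<Sum>i\<le>l. \<Sum>s\<in>P i. f s)"
    using \<Delta> by (intro mult_left_mono) auto
  from order_trans[OF energy this] have "n^3 / \<Delta> \<le> (\<Sum>i\<le>l. \<Sum>s\<in>P i. f s)"
    using \<Delta> by (simp add: field_simps)
  then have "n^3 / \<Delta> / real (l + 1) * real (l + 1) \<le> (\<Sum>i\<le>l. \<Sum>s\<in>P i. f s)" by simp
  moreover have "0 < n^3 / \<Delta> / real (l + 1)" using n \<Delta> by simp
  ultimately obtain i where i: "n^3 / \<Delta> / real (l + 1) \<le> (\<Sum>s\<in>P i. f s)"
    using exists_ge_average[of "{..l}" "n^3 / \<Delta> / real (l + 1)" "real (l + 1)" "\<lambda>i. \<Sum>s\<in>P i. f s"] by auto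
  define T where "T = (2::real) ^ i"
  have T: "0 < T" by (simp add: T_def)
  define G where "G = {(a, b). a \<in> A \<and> b \<in> A \<and> a + b \<in> P i}"
  have cardG: "real (card G) = (\<Sum>s\<in>P i. real (sum_reps A s))"
    unfolding G_def using card_sums_in[OF fin, of "P i"] by (simp add: P_def)
  define \<delta> where "\<delta> = real (card G) / n\<^sup>2"
  define \<tau> where "\<tau> = n / T"
  have GA: "G \<subseteq> A \<times> A" by (auto simp: G_def)
  have cG: "real (card G) = \<delta> * n\<^sup>2" using n by (simp add: \<delta>_def)
  have "(\<Sum>s\<in>P i. f s) \<le> (\<Sum>s\<in>P i. 2 * T * real (sum_reps A s))"
  proof (rule sum_mono)
    fix s assume "s \<in> P i"
    then have "sum_reps A s \<le> 2 ^ (i + 1)" by (simp add: P_def)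
    then have "real (sum_reps A s) \<le> real (2 ^ (i + 1))" by (simp only: of_nat_le_iff)
    then have "real (sum_reps A s) \<le> 2 * T" unfolding T_def by simp
    then show "f s \<le> 2 * T * real (sum_reps A s)"
      unfolding f_def power2_eq_square by (intro mult_right_mono) auto
  qed
  also have "\<dots> = 2 * T * real (card G)" by (simp add: cardG sum_distrib_left)
  finally have fG: "(\<Sum>s\<in>P i. f s) \<le> 2 * T * (\<delta> * n\<^sup>2)" by (simp add: cG)
  have pos: "0 < n^3 / \<Delta> / real (l + 1)" using n \<Delta> by simp
  then have "0 < 2 * T * (\<delta> * n\<^sup>2)" using i fG by linarith
  then have \<delta>0: "0 < \<delta>" using T n by (simp add: zero_less_mult_iff)
  have \<delta>1: "\<delta> \<le> 1"
  proof -
    have "real (card G) \<le> real (card (A \<times> A))"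
      using GA fin by (intro of_nat_mono card_mono) auto
    also have "\<dots> \<le> n\<^sup>2" using n by (simp add: card_cartesian_product power2_eq_square mult_mono)
    finally show ?thesis using n by (simp add: \<delta>_def)
  qed
  have "P i \<noteq> {}" using pos i by force
  then obtain s where "s \<in> P i" by blast
  then have "2 ^ i \<le> sum_reps A s" by (simp add: P_def)
  then have "2 ^ i \<le> card A" using sum_reps_le_card[OF fin] le_trans by blast
  then have "real (2 ^ i) \<le> real (card A)" by (simp only: of_nat_le_iff)
  then have "T \<le> n" using n(1) unfolding T_def of_nat_power of_nat_numeral by linarith
  then have \<tau>1: "1 \<le> \<tau>" using T by (simp add: \<tau>_def)
  have \<tau>\<delta>: "\<tau> \<le> 2 * (real l + 1) * \<Delta> * \<delta>"
  proof -
    have "n^3 / \<Delta> / real (l + 1) \<le> 2 * T * (\<delta> * n\<^sup>2)" using i fG by linarith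
    then have "n^3 \<le> 2 * T * (\<delta> * n\<^sup>2) * \<Delta> * (real l + 1)"
      using \<Delta> by (simp add: divide_le_eq mult.commute mult.left_commute add.commute)
    then have "n\<^sup>2 * n \<le> n\<^sup>2 * (2 * T * \<delta> * \<Delta> * (real l + 1))"
      by (simp add: power2_eq_square power3_eq_cube mult_ac)
    then have "n \<le> 2 * T * \<delta> * \<Delta> * (real l + 1)" using n by simp
    then show ?thesis using T by (simp add: \<tau>_def divide_le_eq mult_ac)
  qed
  have cardP: "real (card (P i)) \<le> \<delta> * \<tau> * n"
  proof -
    have "real (card (P i)) * T = (\<Sum>s\<in>P i. T)" by simp
    also have "\<dots> \<le> real (card G)"
      unfolding cardG
    proof (rule sum_mono)
      fix s assume "s \<in> P i"
      then have "2 ^ i \<le> sum_reps A s" by (simp add: P_def)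
      then have "real (2 ^ i) \<le> real (sum_reps A s)" by (simp only: of_nat_le_iff)
      then show "T \<le> real (sum_reps A s)" unfolding T_def of_nat_power of_nat_numeral .
    qed
    finally have "real (card (P i)) * T \<le> \<delta> * n\<^sup>2" by (simp add: cG)
    then show ?thesis using T by (simp add: \<tau>_def field_simps power2_eq_square)
  qed
  obtain V B where VB: "V \<subseteq> A" "B \<subseteq> A" "\<delta> * n / 6 \<le> real (card V)" "\<delta> * n / 4 \<le> real (card B)"
    and path4: "\<And>a a'. a \<in> V \<Longrightarrow> a' \<in> V \<Longrightarrow>
       \<delta>^5 * n^3 / 393216 \<le> real (card {(c, b, b'). (a, b) \<in> G \<and> (c, b) \<in> G \<and> (c, b') \<in> G \<and> (a', b') \<in> G})"
    and path3: "\<And>a b. a \<in> V \<Longrightarrow> b \<in> B \<Longrightarrow>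
       \<delta>^5 * n\<^sup>2 / 24576 \<le> real (card {(c, b'). (a, b') \<in> G \<and> (c, b') \<in> G \<and> (c, b) \<in> G})"
    using dense_graph_paths[OF fin fin n(1) n(1) n(2) GA _ \<delta>0] cG by auto
  have finV: "finite V" "finite B" using VB fin finite_subset by blast+
  \<comment> \<open>(a + b) - (c + b) + (c + b') - (a' + b') = a - a' along a path of length four\<close>
  have diff: "real (card (V + uminus ` V)) \<le> 2^19 * \<tau>^4 / \<delta> * n"
  proof -
    have "\<forall>d\<in>V + uminus ` V. \<exists>a\<in>V. a - d \<in> V"
      by (force elim!: set_plus_elim)
    then obtain u where u: "\<And>d. d \<in> V + uminus ` V \<Longrightarrow> u d \<in> V \<and> u d - d \<in> V" by metis
    let ?S = "\<lambda>d. {(c, b, b'). (u d, b) \<in> G \<and> (c, b) \<in> G \<and> (c, b') \<in> G \<and> (u d - d, b') \<in> G}"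
    have finS: "finite (?S d)" for d
      using fin GA by (intro finite_subset[of "?S d" "A \<times> A \<times> A"]) auto
    have finD: "finite (V + uminus ` V)" using finV by (simp add: finite_set_plus)
    define h where "h = (\<lambda>(d, c, b, b'). (u d + b, c + b, c + b', (u d - d) + b'))"
    have inj: "inj_on h (Sigma (V + uminus ` V) ?S)"
    proof (rule inj_onI, clarsimp simp: h_def)
      fix d c b b' d' c' e e'
      assume eq: "u d + b = u d' + e" "c + b = c' + e" "c + b' = c' + e'" "u d - d + b' = u d' - d' + e'"
      have "d = (u d + b) - (c + b) + (c + b') - (u d - d + b')" by simp
      also have "\<dots> = (u d' + e) - (c' + e) + (c' + e') - (u d' - d' + e')" by (simp only: eq)
      also have "\<dots> = d'" by simp
      finally have "d = d'" .
      with eq show "d = d' \<and> c = c' \<and> b = e \<and> b' = e'" by simp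
    qed
    have sub: "h ` (Sigma (V + uminus ` V) ?S) \<subseteq> P i \<times> P i \<times> P i \<times> P i"
      by (auto simp: h_def G_def)
    have "real (card (V + uminus ` V)) * (\<delta>^5 * n^3 / 393216) = (\<Sum>d\<in>V + uminus ` V. \<delta>^5 * n^3 / 393216)"
      by simp
    also have "\<dots> \<le> (\<Sum>d\<in>V + uminus ` V. real (card (?S d)))"
      using u by (intro sum_mono path4) auto
    also have "\<dots> = real (card (Sigma (V + uminus ` V) ?S))"
      using finD finS by (subst card_SigmaI) auto
    also have "\<dots> \<le> real (card (P i \<times> P i \<times> P i \<times> P i))"
      using finP by (intro of_nat_mono card_inj_on_le[OF inj sub]) auto
    also have "\<dots> = real (card (P i)) ^ 4" by (simp add: card_cartesian_product power_numeral_reduce)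
    also have "\<dots> \<le> (\<delta> * \<tau> * n) ^ 4" by (intro power_mono cardP) auto
    finally have "real (card (V + uminus ` V)) * (\<delta>^5 * n^3) \<le> 393216 * (\<delta> * \<tau> * n) ^ 4" by simp
    also have "\<dots> = (393216 * \<tau>^4 / \<delta> * n) * (\<delta>^5 * n^3)"
      using \<delta>0 by (simp add: power_mult_distrib) (simp add: power_numeral_reduce)
    finally have "real (card (V + uminus ` V)) \<le> 393216 * \<tau>^4 / \<delta> * n"
      by (rule mult_right_le_imp_le) (use \<delta>0 n in simp)
    also have "\<dots> \<le> 2^19 * \<tau>^4 / \<delta> * n"
      using \<delta>0 n \<tau>1 by (intro mult_right_mono divide_right_mono) auto
    finally show ?thesis .
  qed
  \<comment> \<open>(a + b') - (c + b') + (c + b) = a + b along a path of length three\<close>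
  have sumVB: "real (card (B + V)) \<le> 24576 * \<tau>^3 / \<delta>\<^sup>2 * n"
  proof -
    have "\<forall>d\<in>B + V. \<exists>a\<in>V. d - a \<in> B"
      by (force elim!: set_plus_elim)
    then obtain u where u: "\<And>d. d \<in> B + V \<Longrightarrow> u d \<in> V \<and> d - u d \<in> B" by metis
    let ?S = "\<lambda>d. {(c, b'). (u d, b') \<in> G \<and> (c, b') \<in> G \<and> (c, d - u d) \<in> G}"
    have finS: "finite (?S d)" for d
      using fin GA by (intro finite_subset[of "?S d" "A \<times> A"]) auto
    have finD: "finite (B + V)" using finV by (simp add: finite_set_plus)
    define h where "h = (\<lambda>(d, c, b). (u d + b, c + b, c + (d - u d)))"
    have inj: "inj_on h (Sigma (B + V) ?S)"
    proof (rule inj_onI, clarsimp simp: h_def)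
      fix d c b d' c' e
      assume eq: "u d + b = u d' + e" "c + b = c' + e" "c + (d - u d) = c' + (d' - u d')"
      have "d = (u d + b) - (c + b) + (c + (d - u d))" by simp
      also have "\<dots> = (u d' + e) - (c' + e) + (c' + (d' - u d'))" by (simp only: eq)
      also have "\<dots> = d'" by simp
      finally have "d = d'" .
      with eq show "d = d' \<and> c = c' \<and> b = e" by simp
    qed
    have sub: "h ` (Sigma (B + V) ?S) \<subseteq> P i \<times> P i \<times> P i"
      by (auto simp: h_def G_def)
    have "real (card (B + V)) * (\<delta>^5 * n\<^sup>2 / 24576) = (\<Sum>d\<in>B + V. \<delta>^5 * n\<^sup>2 / 24576)"
      by simp
    also have "\<dots> \<le> (\<Sum>d\<in>B + V. real (card (?S d)))"
      using u by (intro sum_mono path3) auto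
    also have "\<dots> = real (card (Sigma (B + V) ?S))"
      using finD finS by (subst card_SigmaI) auto
    also have "\<dots> \<le> real (card (P i \<times> P i \<times> P i))"
      using finP by (intro of_nat_mono card_inj_on_le[OF inj sub]) auto
    also have "\<dots> = real (card (P i)) ^ 3" by (simp add: card_cartesian_product power3_eq_cube)
    also have "\<dots> \<le> (\<delta> * \<tau> * n) ^ 3" by (intro power_mono cardP) auto
    finally have "real (card (B + V)) * (\<delta>^5 * n\<^sup>2) \<le> 24576 * (\<delta> * \<tau> * n) ^ 3" by simp
    also have "\<dots> = (24576 * \<tau>^3 / \<delta>\<^sup>2 * n) * (\<delta>^5 * n\<^sup>2)"
      using \<delta>0 by (simp add: power_mult_distrib) (simp add: power_numeral_reduce)
    finally show ?thesis by (rule mult_right_le_imp_le) (use \<delta>0 n in simp)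
  qed
  have four: "real (card (V + V + uminus ` (V + V))) \<le> 2^65 * \<tau>^12 / \<delta>^11 * n"
  proof -
    have "0 < \<delta> * n / 4" using \<delta>0 n by simp
    then have "0 < real (card B)" using VB by linarith
    then have "B \<noteq> {}" and cB: "0 < real (card B)" by auto
    obtain Y where Y: "Y \<subseteq> B" "Y \<noteq> {}" "card (Y + V) * card B \<le> card (B + V) * card Y"
      and pet: "\<And>C. finite C \<Longrightarrow> card (Y + V + C) * card Y \<le> card (Y + V) * card (Y + C)"
      using petridis[OF finV(2) \<open>B \<noteq> {}\<close> finV(1)] by blast
    have finY: "finite Y" using Y finV finite_subset by blast
    define y where "y = real (card Y)"
    have y: "0 < y" "y \<le> real (card B)" using Y finY finV by (auto simp: y_def card_gt_0_iff card_mono)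
    define x where "x = real (card (B + V))"
    define s where "s = real (card (Y + V))"
    define w where "w = real (card (V + V + Y))"
    have s: "s * real (card B) \<le> x * y"
      using Y(3) unfolding s_def x_def y_def by (metis of_nat_le_iff of_nat_mult)
    have w: "w * y \<le> s * s"
    proof -
      have "V + V + Y = Y + V + V" by (simp add: add_ac)
      then show ?thesis using pet[OF finV(1)] unfolding s_def w_def y_def
        by (metis of_nat_le_iff of_nat_mult)
    qed
    have tri: "real (card (V + V + uminus ` (V + V))) * y \<le> w * w"
    proof -
      have "card (V + V + uminus ` (V + V)) * card (uminus ` Y) \<le>
          card (V + V + uminus ` uminus ` Y) * card (uminus ` Y + uminus ` (V + V))"
        using finV finY by (intro ruzsa_triangle) (auto simp: finite_set_plus)
      moreover have "uminus ` uminus ` Y = Y" by (simp add: image_image)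
      moreover have "uminus ` Y + uminus ` (V + V) = uminus ` (V + V + Y)"
        by (simp add: uminus_image_set_plus add_ac)
      moreover have "card (uminus ` X) = card X" for X :: "'a set" by (simp add: card_image)
      ultimately show ?thesis unfolding w_def y_def
        by (metis of_nat_le_iff of_nat_mult)
    qed
    define F where "F = real (card (V + V + uminus ` (V + V)))"
    define b where "b = real (card B)"
    have nn: "0 \<le> s" "0 \<le> w" "0 \<le> F" "0 \<le> x" by (auto simp: s_def w_def F_def x_def)
    have "F * y^3 \<le> (w * y)\<^sup>2"
      using mult_right_mono[OF tri, of "y\<^sup>2"] by (simp add: F_def power2_eq_square power3_eq_cube mult_ac)
    also have "\<dots> \<le> (s * s)\<^sup>2" using w nn y by (intro power_mono) auto
    finally have "F * y^3 \<le> s^4" by (simp add: power_numeral_reduce)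
    then have "F * y^3 * b^4 \<le> s^4 * b^4" by (intro mult_right_mono) auto
    also have "\<dots> = (s * b)^4" by (simp add: power_mult_distrib)
    also have "\<dots> \<le> (x * y)^4" using s nn by (intro power_mono) (auto simp: b_def)
    also have "\<dots> = x^4 * y * y^3" by (simp add: power_mult_distrib power_numeral_reduce)
    finally have "(F * b^4) * y^3 \<le> (x^4 * y) * y^3" by (simp add: mult_ac)
    then have "F * b^4 \<le> x^4 * y" using y by simp
    also have "\<dots> \<le> x^4 * b" using y by (intro mult_left_mono) (auto simp: b_def)
    finally have "(F * b^3) * b \<le> x^4 * b" by (simp add: power_numeral_reduce mult_ac)
    then have Fb: "F * b^3 \<le> x^4" using cB by (simp add: b_def)
    have "F * (\<delta> * n / 4)^3 \<le> F * b^3"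
      using VB nn \<delta>0 n by (intro mult_left_mono power_mono) (auto simp: b_def)
    also have "\<dots> \<le> x^4" by (rule Fb)
    also have "\<dots> \<le> (24576 * \<tau>^3 / \<delta>\<^sup>2 * n)^4"
      using sumVB by (intro power_mono) (auto simp: x_def)
    also have "\<dots> = (24576^4 * 64 * \<tau>^12 / \<delta>^11 * n) * (\<delta> * n / 4)^3"
    proof -
      have e: "1 / \<delta>^8 = \<delta>^3 / \<delta>^11" "n^4 = n * n^3"
        using \<delta>0 by (simp_all add: divide_simps flip: power_add power_Suc)
      have "(24576 * \<tau>^3 / \<delta>\<^sup>2 * n)^4 = 24576^4 * \<tau>^12 * (1 / \<delta>^8) * n^4"
        by (simp add: power_mult_distrib power_divide flip: power_mult)
      also have "\<dots> = (24576^4 * 64 * \<tau>^12 / \<delta>^11 * n) * (\<delta>^3 * n^3 / 64)"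
        unfolding e by simp
      also have "(\<delta>^3 * n^3 / 64) = (\<delta> * n / 4)^3" by (simp add: power_mult_distrib power_divide)
      finally show ?thesis .
    qed
    finally have "F \<le> 24576^4 * 64 * \<tau>^12 / \<delta>^11 * n"
      by (rule mult_right_le_imp_le) (use \<delta>0 n in simp)
    also have "\<dots> \<le> 2^65 * \<tau>^12 / \<delta>^11 * n"
      using \<delta>0 n \<tau>1 by (intro mult_right_mono divide_right_mono) auto
    finally show ?thesis by (simp add: F_def)
  qed
  show thesis
    by (rule that[OF VB(1) \<delta>0 \<delta>1 \<tau>1 \<tau>\<delta> VB(3) diff four])
qed

section \<open>Multiplicative energy in a finite field\<close>

text \<open>
  Let d1 and d2 be the two bounds for the degrees.  The pair of subsets maximising
  (edges) - d1 |C1| - d2 |C2| loses at most half of the edges, and by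
  maximality removing a vertex cannot pay off, so its degree is at least d1 or d2.
\<close>

lemma regular_bipartite_subgraph:
  fixes Q :: "'a \<Rightarrow> 'b \<Rightarrow> bool"
  assumes fin: "finite B1" "finite B2"
    and e: "e = real (card {(c, x). c \<in> B1 \<and> x \<in> B2 \<and> Q c x})" "0 < e"
  obtains C1 C2 where "C1 \<subseteq> B1" "C2 \<subseteq> B2"
    "e / 2 \<le> real (card {(c, x). c \<in> C1 \<and> x \<in> C2 \<and> Q c x})"
    "\<And>c. c \<in> C1 \<Longrightarrow> e / (4 * real (card B1)) \<le> real (card {x \<in> C2. Q c x})"
    "\<And>x. x \<in> C2 \<Longrightarrow> e / (4 * real (card B2)) \<le> real (card {c \<in> C1. Q c x})"
proof -
  define E where "E X Y = real (card {(c, x). c \<in> X \<and> x \<in> Y \<and> Q c x})" for X Y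
  define d1 where "d1 = e / (4 * real (card B1))"
  define d2 where "d2 = e / (4 * real (card B2))"
  define f where "f = (\<lambda>(X, Y). E X Y - real (card X) * d1 - real (card Y) * d2)"
  have "finite (Pow B1 \<times> Pow B2)" "Pow B1 \<times> Pow B2 \<noteq> {}" using fin by auto
  then obtain p where p: "is_arg_min (\<lambda>p. - f p) (\<lambda>p. p \<in> Pow B1 \<times> Pow B2) p"
    using ex_is_arg_min_if_finite by blast
  obtain C1 C2 where p_eq: "p = (C1, C2)" by (cases p)
  have C: "C1 \<subseteq> B1" "C2 \<subseteq> B2" and max: "\<And>X Y. X \<subseteq> B1 \<Longrightarrow> Y \<subseteq> B2 \<Longrightarrow> f (X, Y) \<le> f (C1, C2)"
    using p unfolding is_arg_min_linorder p_eq by auto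
  have finC: "finite C1" "finite C2" using C fin finite_subset by blast+
  have finP: "finite {(c, x). c \<in> C1 \<and> x \<in> C2 \<and> Q c x}"
    using finC by (intro finite_subset[of "{(c, x). c \<in> C1 \<and> x \<in> C2 \<and> Q c x}" "C1 \<times> C2"]) auto
  have "B1 \<noteq> {}" "B2 \<noteq> {}" using e by auto
  then have "real (card B1) * d1 = e / 4" "real (card B2) * d2 = e / 4" "0 \<le> d1" "0 \<le> d2"
    using fin e(2) by (auto simp: d1_def d2_def)
  then have "e / 2 = f (B1, B2)" using e(1) by (simp add: f_def E_def)
  also have "\<dots> \<le> f (C1, C2)" by (intro max) auto
  also have "\<dots> \<le> E C1 C2" using mult_nonneg_nonneg[OF of_nat_0_le_iff \<open>0 \<le> d1\<close>, of "card C1"]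
      mult_nonneg_nonneg[OF of_nat_0_le_iff \<open>0 \<le> d2\<close>, of "card C2"] unfolding f_def prod.case by linarith
  finally have half: "e / 2 \<le> real (card {(c, x). c \<in> C1 \<and> x \<in> C2 \<and> Q c x})" by (simp add: E_def)
  have deg1: "d1 \<le> real (card {x \<in> C2. Q c x})" if c: "c \<in> C1" for c
  proof -
    have "{(a, x). a \<in> C1 \<and> x \<in> C2 \<and> Q a x} =
        {(a, x). a \<in> C1 - {c} \<and> x \<in> C2 \<and> Q a x} \<union> Pair c ` {x \<in> C2. Q c x}"
      using c by auto
    also have "card \<dots> = card {(a, x). a \<in> C1 - {c} \<and> x \<in> C2 \<and> Q a x} + card (Pair c ` {x \<in> C2. Q c x})"
      using finC that by (intro card_Un_disjoint finite_subset[OF _ finP]) auto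
    also have "card (Pair c ` {x \<in> C2. Q c x}) = card {x \<in> C2. Q c x}"
      by (intro card_image inj_onI) auto
    finally have "E C1 C2 = E (C1 - {c}) C2 + real (card {x \<in> C2. Q c x})" by (simp add: E_def)
    moreover have cc: "real (card C1) = real (card (C1 - {c})) + 1"
      using card_Suc_Diff1[OF finC(1) c] by linarith
    moreover have "f (C1 - {c}, C2) \<le> f (C1, C2)" using C by (intro max) auto
    ultimately show ?thesis by (simp add: f_def cc algebra_simps)
  qed
  have deg2: "d2 \<le> real (card {c \<in> C1. Q c x})" if x: "x \<in> C2" for x
  proof -
    have "{(a, y). a \<in> C1 \<and> y \<in> C2 \<and> Q a y} =
        {(a, y). a \<in> C1 \<and> y \<in> C2 - {x} \<and> Q a y} \<union> (\<lambda>c. (c, x)) ` {c \<in> C1. Q c x}"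
      using x by auto
    also have "card \<dots> = card {(a, y). a \<in> C1 \<and> y \<in> C2 - {x} \<and> Q a y} + card ((\<lambda>c. (c, x)) ` {c \<in> C1. Q c x})"
      using finC that by (intro card_Un_disjoint finite_subset[OF _ finP]) auto
    also have "card ((\<lambda>c. (c, x)) ` {c \<in> C1. Q c x}) = card {c \<in> C1. Q c x}"
      by (intro card_image inj_onI) auto
    finally have "E C1 C2 = E C1 (C2 - {x}) + real (card {c \<in> C1. Q c x})" by (simp add: E_def)
    moreover have cc: "real (card C2) = real (card (C2 - {x})) + 1"
      using card_Suc_Diff1[OF finC(2) x] by linarith
    moreover have "f (C1, C2 - {x}) \<le> f (C1, C2)" using C by (intro max) auto
    ultimately show ?thesis by (simp add: f_def cc algebra_simps)
  qed
  show thesis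
    using that[OF C half] deg1 deg2 unfolding d1_def d2_def by blast
qed

definition mult_energy :: "'a::comm_ring_1 set \<Rightarrow> nat" where
  "mult_energy A = card {(a, c, x, z). a \<in> A \<and> c \<in> A \<and> x \<in> A \<and> z \<in> A \<and> c * x = a * z}"

text \<open>
  A finite field as a subset of a commutative ring.  The unit e of the field is an idempotent of the
  ring and is allowed to differ from 1.
\<close>

locale finite_field_set =
  fixes S :: "'a::comm_ring_1 set" and e :: 'a
  assumes finite_S: "finite S" and zero_S: "0 \<in> S" and one_S: "e \<in> S"
    and add_S: "x \<in> S \<Longrightarrow> y \<in> S \<Longrightarrow> x + y \<in> S"
    and mult_S: "x \<in> S \<Longrightarrow> y \<in> S \<Longrightarrow> x * y \<in> S"
    and uminus_S: "x \<in> S \<Longrightarrow> - x \<in> S"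
    and one_mult: "x \<in> S \<Longrightarrow> e * x = x"
    and one_nonzero: "e \<noteq> 0"
    and inverse_S: "x \<in> S \<Longrightarrow> x \<noteq> 0 \<Longrightarrow> \<exists>y\<in>S. x * y = e"
begin

lemma diff_S: "x \<in> S \<Longrightarrow> y \<in> S \<Longrightarrow> x - y \<in> S"
  using add_S[of x "- y"] uminus_S by simp

lemma mult_cancel:
  assumes "a \<in> S" "a \<noteq> 0" "x \<in> S" "y \<in> S" "a * x = a * y"
  shows "x = y"
proof -
  obtain b where b: "b \<in> S" "a * b = e" using inverse_S assms by blast
  have "x = e * x" by (simp add: one_mult assms)
  also have "\<dots> = b * (a * x)" by (simp add: b(2)[symmetric] mult_ac)
  also have "\<dots> = b * (a * y)" by (simp add: assms)
  also have "\<dots> = e * y" by (simp add: b(2)[symmetric] mult_ac)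
  finally show ?thesis by (simp add: one_mult assms)
qed

lemma mult_nonzero:
  assumes "a \<in> S" "a \<noteq> 0" "x \<in> S" "x \<noteq> 0"
  shows "a * x \<noteq> 0"
  using mult_cancel[of a x 0] assms zero_S by auto

lemma divide_S:
  assumes "a \<in> S" "a \<noteq> 0" "x \<in> S"
  obtains y where "y \<in> S" "a * y = x"
proof -
  obtain b where b: "b \<in> S" "a * b = e" using inverse_S assms by blast
  have "a * (b * x) = x" using b one_mult[OF assms(3)] by (metis mult.assoc)
  then show thesis using that mult_S b assms by blast
qed

lemma inj_on_dilate:
  assumes "a \<in> S" "a \<noteq> 0" "X \<subseteq> S"
  shows "inj_on ((*) a) X"
  using mult_cancel assms by (auto intro!: inj_onI)

lemma card_dilate:
  assumes "a \<in> S" "a \<noteq> 0" "X \<subseteq> S"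
  shows "card ((*) a ` X) = card X"
  using inj_on_dilate[OF assms] by (rule card_image)

definition subfield_set :: "'a set \<Rightarrow> bool" where
  "subfield_set G \<longleftrightarrow> G \<subseteq> S \<and> e \<in> G \<and> (\<forall>x\<in>G. \<forall>y\<in>G. x - y \<in> G \<and> x * y \<in> G) \<and>
     (\<forall>x\<in>G. x \<noteq> 0 \<longrightarrow> (\<exists>y\<in>G. x * y = e))"

text \<open>
  A solution of c x = a z has the two slopes c/a = z/x and x/a = z/c.  The number of points of A \<times> A on the line
  through the origin with slope b/a is the size of b A \<inter> a A.  Pigeonholing over a and over the dyadic sizes
  of both slopes fixes a0 and two sets B1 and B2 of numerators such that the relation "c x lies in a0 A"
  is dense between them.  Since c is related to at most |c A \<inter> a0 A| elements x, the dyadic size t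
  controls the number of numerators from below: |B| t is at least about |A|^2/M.
\<close>

lemma mult_energy_pigeonhole:
  fixes M :: real
  assumes A: "A \<subseteq> S - {0}" "A \<noteq> {}" and l: "card A \<le> 2 ^ l"
    and M: "4 * (real l + 1)\<^sup>2 * real (card A) ^ 3 \<le> M * real (mult_energy A)" "0 < M"
  obtains a0 B1 B2 t1 t2 where "a0 \<in> A" "B1 \<subseteq> A" "B2 \<subseteq> A" "0 < t1" "0 < t2"
    "\<And>b. b \<in> B1 \<Longrightarrow> t1 \<le> real (card {x \<in> A. b * x \<in> (*) a0 ` A})"
    "\<And>b. b \<in> B2 \<Longrightarrow> t2 \<le> real (card {x \<in> A. b * x \<in> (*) a0 ` A})"
    "\<And>b. b \<in> B1 \<Longrightarrow> real (card A) / M \<le> real (card {x \<in> B2. b * x \<in> (*) a0 ` A})"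
    "\<And>b. b \<in> B2 \<Longrightarrow> real (card A) / M \<le> real (card {x \<in> B1. b * x \<in> (*) a0 ` A})"
    "(real (card A))\<^sup>2 \<le> M * t1 * real (card B1)" "(real (card A))\<^sup>2 \<le> M * t2 * real (card B2)"
    "real (card A) \<le> 2 * M * t1" "real (card A) \<le> 2 * M * t2"
proof -
  have AS: "A \<subseteq> S" and finA: "finite A"
    using A finite_subset[OF _ finite_S, of A] by auto
  define n where "n = real (card A)"
  have n: "0 < n" using A finA by (simp add: n_def card_gt_0_iff)
  define D where "D a = (*) a ` A" for a
  define N where "N a b = card {x \<in> A. b * x \<in> D a}" for a b
  define C where "C a i = {b \<in> A. 2 ^ i \<le> N a b \<and> N a b < 2 ^ (i + 1)}" for a and i :: nat
  define P where "P = (\<lambda>(a, i, j). {(c, x). c \<in> C a i \<and> x \<in> C a j \<and> c * x \<in> D a})"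
  let ?E = "{(a, c, x, z). a \<in> A \<and> c \<in> A \<and> x \<in> A \<and> z \<in> A \<and> c * x = a * z}"
  let ?I = "A \<times> {..l} \<times> {..l}"
  have fin_C: "finite (C a i)" for a i using finA by (simp add: C_def)
  have fin_P: "finite (P p)" for p
  proof -
    obtain a i j where "p = (a, i, j)" by (cases p) auto
    then show ?thesis
      using fin_C by (intro finite_subset[of "P p" "C a i \<times> C a j"]) (auto simp: P_def)
  qed
  have "inj_on (\<lambda>(a, c, x, z). (a, c, x)) ?E"
    using mult_cancel A AS by (auto simp: inj_on_def subset_iff)
  then have "mult_energy A = card ((\<lambda>(a, c, x, z). (a, c, x)) ` ?E)"
    unfolding mult_energy_def by (rule card_image[symmetric])
  also have "(\<lambda>(a, c, x, z). (a, c, x)) ` ?E \<subseteq> (\<lambda>((a, i, j), (c, x)). (a, c, x)) ` Sigma ?I P"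
  proof
    fix t assume "t \<in> (\<lambda>(a, c, x, z). (a, c, x)) ` ?E"
    then obtain a c x z where t: "t = (a, c, x)"
      and *: "a \<in> A" "c \<in> A" "x \<in> A" "z \<in> A" "c * x = a * z" by auto
    have N_le: "N a b \<le> 2 ^ l" for b
      using l card_mono[OF finA, of "{x \<in> A. b * x \<in> D a}"] by (auto simp: N_def)
    have "x \<in> {y \<in> A. c * y \<in> D a}" "c \<in> {y \<in> A. x * y \<in> D a}" using * by (auto simp: D_def mult.commute)
    then have "0 < N a c" "0 < N a x" using finA by (auto simp: N_def card_gt_0_iff)
    then obtain i j where "i \<le> l" "2 ^ i \<le> N a c" "N a c < 2 ^ (i + 1)"
      "j \<le> l" "2 ^ j \<le> N a x" "N a x < 2 ^ (j + 1)"
      using dyadic_index N_le by metis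
    then have "((a, i, j), (c, x)) \<in> Sigma ?I P" using * by (auto simp: P_def C_def D_def)
    then show "t \<in> (\<lambda>((a, i, j), (c, x)). (a, c, x)) ` Sigma ?I P"
      by (rule rev_image_eqI) (simp add: t)
  qed
  then have "card ((\<lambda>(a, c, x, z). (a, c, x)) ` ?E) \<le> card ((\<lambda>((a, i, j), (c, x)). (a, c, x)) ` Sigma ?I P)"
    using finA fin_P by (intro card_mono finite_imageI finite_SigmaI) auto
  also have "\<dots> \<le> card (Sigma ?I P)"
    using finA fin_P by (intro card_image_le finite_SigmaI) auto
  also have "\<dots> = (\<Sum>p\<in>?I. card (P p))" using finA fin_P by (intro card_SigmaI) auto
  finally have "real (mult_energy A) \<le> real (\<Sum>p\<in>?I. card (P p))" by (simp only: of_nat_le_iff)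
  then have E_le: "real (mult_energy A) \<le> (\<Sum>p\<in>?I. real (card (P p)))" by simp
  have "\<exists>p\<in>?I. 4 * n\<^sup>2 / M \<le> real (card (P p))"
  proof (rule exists_ge_average)
    have "4 * n\<^sup>2 / M * (n * (real l + 1)\<^sup>2) = 4 * (real l + 1)\<^sup>2 * n ^ 3 / M"
      by (simp add: power2_eq_square power3_eq_cube)
    also have "\<dots> \<le> real (mult_energy A)" using M by (simp add: n_def divide_le_eq mult.commute)
    finally show "4 * n\<^sup>2 / M * (n * (real l + 1)\<^sup>2) \<le> (\<Sum>p\<in>?I. real (card (P p)))" using E_le by linarith
    show "real (card ?I) \<le> n * (real l + 1)\<^sup>2"
      by (simp add: card_cartesian_product n_def power2_eq_square algebra_simps)
  qed (use finA n M in auto)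
  then obtain a0 i j where a0: "a0 \<in> A" and big: "4 * n\<^sup>2 / M \<le> real (card (P (a0, i, j)))"
    by auto
  define m where "m = real (card (P (a0, i, j)))"
  have m1: "4 * n\<^sup>2 / M \<le> m" using big by (simp add: m_def)
  have "0 < 4 * n\<^sup>2 / M" using n M by simp
  then have m: "4 * n\<^sup>2 / M \<le> m" "0 < m" using m1 by linarith+
  have m_eq: "m = real (card {(c, x). c \<in> C a0 i \<and> x \<in> C a0 j \<and> c * x \<in> D a0})"
    by (simp add: m_def P_def)
  obtain B1 B2 where B: "B1 \<subseteq> C a0 i" "B2 \<subseteq> C a0 j"
    and half: "m / 2 \<le> real (card {(c, x). c \<in> B1 \<and> x \<in> B2 \<and> c * x \<in> D a0})"
    and d1: "\<And>c. c \<in> B1 \<Longrightarrow> m / (4 * real (card (C a0 i))) \<le> real (card {x \<in> B2. c * x \<in> D a0})"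
    and d2: "\<And>x. x \<in> B2 \<Longrightarrow> m / (4 * real (card (C a0 j))) \<le> real (card {c \<in> B1. c * x \<in> D a0})"
  proof (rule regular_bipartite_subgraph[OF fin_C fin_C m_eq m(2)], goal_cases)
    case (1 C1 C2)
    show ?case by (rule 1(1)) (use 1(2-) in blast)+
  qed
  have BA: "B1 \<subseteq> A" "B2 \<subseteq> A" using B by (auto simp: C_def)
  have finB: "finite B1" "finite B2" using BA finA finite_subset by blast+
  have low: "n / M \<le> m / (4 * real (card (C a0 k)))" if "C a0 k \<noteq> {}" for k
  proof -
    have c: "0 < real (card (C a0 k))" "real (card (C a0 k)) \<le> n"
      using that fin_C card_mono[OF finA, of "C a0 k"] by (auto simp: card_gt_0_iff n_def C_def)
    have "n / M = 4 * n\<^sup>2 / M / (4 * n)" using n by (simp add: power2_eq_square)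
    also have "\<dots> \<le> m / (4 * n)" using m n by (intro divide_right_mono) auto
    also have "\<dots> \<le> m / (4 * real (card (C a0 k)))" using c m n by (intro divide_left_mono) auto
    finally show ?thesis .
  qed
  have low1: "n / M \<le> real (card {x \<in> B2. b * x \<in> D a0})" if "b \<in> B1" for b
  proof -
    have "C a0 i \<noteq> {}" using that B by auto
    then show ?thesis using low[of i] d1[OF that] by linarith
  qed
  have low2: "n / M \<le> real (card {x \<in> B1. b * x \<in> D a0})" if "b \<in> B2" for b
  proof -
    have "C a0 j \<noteq> {}" using that B by auto
    moreover have "{c \<in> B1. c * b \<in> D a0} = {x \<in> B1. b * x \<in> D a0}" by (auto simp: mult.commute)
    ultimately show ?thesis using low[of j] d2[OF that] by auto
  qed
  have t1: "2 ^ i \<le> real (N a0 b)" "real (N a0 b) \<le> 2 * 2 ^ i" if "b \<in> B1" for b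
  proof -
    have "2 ^ i \<le> N a0 b" "N a0 b \<le> 2 ^ (i + 1)" using that B by (auto simp: C_def)
    then have "real (2 ^ i) \<le> real (N a0 b)" "real (N a0 b) \<le> real (2 ^ (i + 1))" by (simp_all only: of_nat_le_iff)
    then show "2 ^ i \<le> real (N a0 b)" "real (N a0 b) \<le> 2 * 2 ^ i" by simp_all
  qed
  have t2: "2 ^ j \<le> real (N a0 b)" "real (N a0 b) \<le> 2 * 2 ^ j" if "b \<in> B2" for b
  proof -
    have "2 ^ j \<le> N a0 b" "N a0 b \<le> 2 ^ (j + 1)" using that B by (auto simp: C_def)
    then have "real (2 ^ j) \<le> real (N a0 b)" "real (N a0 b) \<le> real (2 ^ (j + 1))" by (simp_all only: of_nat_le_iff)
    then show "2 ^ j \<le> real (N a0 b)" "real (N a0 b) \<le> 2 * 2 ^ j" by simp_all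
  qed
  have sub_N: "card {x \<in> B. b * x \<in> D a0} \<le> N a0 b" if "B \<subseteq> A" for B b
    unfolding N_def using that finA by (intro card_mono) auto
  let ?Q = "{(c, x). c \<in> B1 \<and> x \<in> B2 \<and> c * x \<in> D a0}"
  have Q1: "real (card ?Q) \<le> real (card B1) * (2 * 2 ^ i)"
  proof -
    have "?Q = (SIGMA c:B1. {x \<in> B2. c * x \<in> D a0})" by auto
    then have "real (card ?Q) = (\<Sum>c\<in>B1. real (card {x \<in> B2. c * x \<in> D a0}))"
      using finB by (simp add: card_SigmaI)
    also have "\<dots> \<le> (\<Sum>c\<in>B1. 2 * 2 ^ i)"
    proof (rule sum_mono)
      fix c assume "c \<in> B1"
      then show "real (card {x \<in> B2. c * x \<in> D a0}) \<le> 2 * 2 ^ i"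
        using t1(2)[of c] sub_N[OF BA(2), of c] by linarith
    qed
    finally show ?thesis by simp
  qed
  have Q2: "real (card ?Q) \<le> real (card B2) * (2 * 2 ^ j)"
  proof -
    have "?Q \<subseteq> prod.swap ` (SIGMA x:B2. {c \<in> B1. x * c \<in> D a0})"
    proof clarify
      fix c x assume "c \<in> B1" "x \<in> B2" "c * x \<in> D a0"
      then show "(c, x) \<in> prod.swap ` (SIGMA x:B2. {c \<in> B1. x * c \<in> D a0})"
        by (intro image_eqI[of _ _ "(x, c)"]) (auto simp: mult.commute)
    qed
    moreover have "finite (SIGMA x:B2. {c \<in> B1. x * c \<in> D a0})"
      using finB by (intro finite_SigmaI) auto
    ultimately have "card ?Q \<le> card (SIGMA x:B2. {c \<in> B1. x * c \<in> D a0})"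
      by (rule surj_card_le[rotated])
    then have "real (card ?Q) \<le> real (card (SIGMA x:B2. {c \<in> B1. x * c \<in> D a0}))" by (simp only: of_nat_le_iff)
    also have "\<dots> = (\<Sum>x\<in>B2. real (card {c \<in> B1. x * c \<in> D a0}))"
      using finB by (simp add: card_SigmaI)
    also have "\<dots> \<le> (\<Sum>x\<in>B2. 2 * 2 ^ j)"
    proof (rule sum_mono)
      fix c assume "c \<in> B2"
      then show "real (card {x \<in> B1. c * x \<in> D a0}) \<le> 2 * 2 ^ j"
        using t2(2)[of c] sub_N[OF BA(1), of c] by linarith
    qed
    finally show ?thesis by simp
  qed
  have size: "n\<^sup>2 \<le> M * t * real (card B)" if "real (card ?Q) \<le> real (card B) * (2 * t)" for t and B :: "'a set"
  proof -
    have "2 * n\<^sup>2 / M \<le> m / 2" using m by simp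
    also have "\<dots> \<le> real (card B) * (2 * t)" using half that by linarith
    finally show ?thesis using M by (simp add: divide_le_eq mult_ac)
  qed
  have "0 < real (card ?Q)" using half m by linarith
  then have "?Q \<noteq> {}" by (metis card.empty less_irrefl of_nat_0)
  then obtain b1 b2 where b: "b1 \<in> B1" "b2 \<in> B2" by blast
  have "n / M \<le> 2 * 2 ^ i"
    using low1[OF b(1)] t1(2)[OF b(1)] sub_N[OF BA(2), of b1] by linarith
  moreover have "n / M \<le> 2 * 2 ^ j"
    using low2[OF b(2)] t2(2)[OF b(2)] sub_N[OF BA(1), of b2] by linarith
  ultimately have thr: "n \<le> 2 * M * 2 ^ i" "n \<le> 2 * M * 2 ^ j"
    using M by (simp_all add: divide_le_eq mult_ac)
  show thesis
    by (rule that[of a0 B1 B2 "2 ^ i" "2 ^ j"])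
      (use a0 BA t1 t2 low1 low2 size[OF Q1] size[OF Q2] thr in \<open>auto simp: n_def D_def N_def\<close>)
qed

end

section \<open>Sums of dilates\<close>

lemma card_square_le_image_times_collisions:
  assumes "finite P"
  shows "(card P)\<^sup>2 \<le> card (f ` P) * card {(p, q). p \<in> P \<and> q \<in> P \<and> f p = f q}"
proof -
  define r where "r s = card {p \<in> P. f p = s}" for s
  have P: "card P = (\<Sum>s\<in>f ` P. r s)"
    unfolding r_def using sum.image_gen[OF assms, of "\<lambda>_. 1::nat" f] by simp
  have "{(p, q). p \<in> P \<and> q \<in> P \<and> f p = f q} = (\<Union>s\<in>f ` P. {p \<in> P. f p = s} \<times> {p \<in> P. f p = s})"
    by auto
  also have "card \<dots> = (\<Sum>s\<in>f ` P. card ({p \<in> P. f p = s} \<times> {p \<in> P. f p = s}))"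
    using assms by (intro card_UN_disjoint) auto
  finally have Q: "card {(p, q). p \<in> P \<and> q \<in> P \<and> f p = f q} = (\<Sum>s\<in>f ` P. (r s)\<^sup>2)"
    by (simp add: card_cartesian_product r_def power2_eq_square)
  have "(real (card P))\<^sup>2 \<le> real (card (f ` P)) * real (card {(p, q). p \<in> P \<and> q \<in> P \<and> f p = f q})"
    using sum_square_le_card_times_sum_squares[of "\<lambda>s. real (r s)" "f ` P"] unfolding P Q by simp
  then have "real ((card P)\<^sup>2) \<le> real (card (f ` P) * card {(p, q). p \<in> P \<and> q \<in> P \<and> f p = f q})"
    by simp
  then show ?thesis by (simp only: of_nat_le_iff)
qed

lemma dilate_set_plus:
  fixes c :: "'a::comm_ring_1"
  shows "(*) c ` (A + B) = (*) c ` A + (*) c ` B"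
proof (intro equalityI subsetI)
  fix x assume "x \<in> (*) c ` (A + B)"
  then obtain a b where "a \<in> A" "b \<in> B" "x = c * a + c * b"
    by (auto elim!: set_plus_elim simp: distrib_left)
  then show "x \<in> (*) c ` A + (*) c ` B" by blast
next
  fix x assume "x \<in> (*) c ` A + (*) c ` B"
  then obtain a b where "a \<in> A" "b \<in> B" "x = c * a + c * b"
    by (auto elim!: set_plus_elim)
  then show "x \<in> (*) c ` (A + B)"
    by (intro image_eqI[of _ _ "a + b"]) (auto simp: distrib_left)
qed

context finite_field_set
begin

text \<open>
  By Cauchy-Schwarz it is enough to find \<xi> with few solutions of x + \<xi> y = x' + \<xi> y'.  On average over the
  nonzero \<xi> in G there are few, because a nontrivial solution determines \<xi>.
\<close>

lemma exists_dilate_large_sumset: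
  assumes G: "subfield_set G" and XY: "X \<subseteq> S" "Y \<subseteq> S" "X \<noteq> {}" "Y \<noteq> {}"
  obtains \<xi> where "\<xi> \<in> G" "\<xi> \<noteq> 0"
    "real (card X * card Y) * (real (card G) - 1) \<le>
       real (card (X + (*) \<xi> ` Y)) * ((real (card G) - 1) + real (card X * card Y))"
proof -
  have GS: "G \<subseteq> S" and eG: "e \<in> G" using G by (auto simp: subfield_set_def)
  have fin: "finite X" "finite Y" "finite G" using XY GS finite_S finite_subset by blast+
  define P where "P = X \<times> Y"
  define f where "f \<xi> = (\<lambda>(x, y). x + \<xi> * y)" for \<xi> :: 'a
  define C where "C \<xi> = {(p, q). p \<in> P \<and> q \<in> P \<and> f \<xi> p = f \<xi> q}" for \<xi>
  define H where "H = G - {0}"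
  have finP: "finite P" using fin by (simp add: P_def)
  have finC: "finite (C \<xi>)" for \<xi>
    using finP by (intro finite_subset[of "C \<xi>" "P \<times> P"]) (auto simp: C_def)
  have finH: "finite H" "e \<in> H" using fin eG one_nonzero by (auto simp: H_def)
  have cH: "real (card H) = real (card G) - 1"
  proof -
    have "0 \<in> G" using G eG unfolding subfield_set_def by (metis diff_self)
    then have "Suc (card H) = card G" unfolding H_def using fin by (intro card_Suc_Diff1)
    then show ?thesis by linarith
  qed
  have "Sigma H C \<subseteq> (\<lambda>(\<xi>, p). (\<xi>, p, p)) ` (H \<times> P) \<union> {(\<xi>, p, q). \<xi> \<in> H \<and> (p, q) \<in> C \<xi> \<and> p \<noteq> q}"
    by (auto simp: C_def)
  then have "card (Sigma H C) \<le> card ((\<lambda>(\<xi>, p). (\<xi>, p, p)) ` (H \<times> P) \<union> {(\<xi>, p, q). \<xi> \<in> H \<and> (p, q) \<in> C \<xi> \<and> p \<noteq> q})"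
    using finH finP by (intro card_mono finite_UnI finite_imageI finite_subset[of "{(\<xi>, p, q). \<xi> \<in> H \<and> (p, q) \<in> C \<xi> \<and> p \<noteq> q}" "H \<times> P \<times> P"])
      (auto simp: C_def)
  also have "\<dots> \<le> card ((\<lambda>(\<xi>, p). (\<xi>, p, p)) ` (H \<times> P)) + card {(\<xi>, p, q). \<xi> \<in> H \<and> (p, q) \<in> C \<xi> \<and> p \<noteq> q}"
    by (rule card_Un_le)
  also have "card ((\<lambda>(\<xi>, p). (\<xi>, p, p)) ` (H \<times> P)) \<le> card (H \<times> P)"
    using finH finP by (intro card_image_le) auto
  also have "card {(\<xi>, p, q). \<xi> \<in> H \<and> (p, q) \<in> C \<xi> \<and> p \<noteq> q} \<le> card (P \<times> P)"
  proof (rule card_inj_on_le)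
    show "inj_on snd {(\<xi>, p, q). \<xi> \<in> H \<and> (p, q) \<in> C \<xi> \<and> p \<noteq> q}"
    proof (rule inj_onI)
      fix r r'
      assume r: "r \<in> {(\<xi>, p, q). \<xi> \<in> H \<and> (p, q) \<in> C \<xi> \<and> p \<noteq> q}" "r' \<in> {(\<xi>, p, q). \<xi> \<in> H \<and> (p, q) \<in> C \<xi> \<and> p \<noteq> q}"
        "snd r = snd r'"
      obtain \<xi> x y x' y' where r_eq: "r = (\<xi>, (x, y), (x', y'))" by (metis surj_pair)
      obtain \<xi>' where r'_eq: "r' = (\<xi>', (x, y), (x', y'))" using r(3) r_eq by (metis prod.collapse snd_conv)
      have *: "\<xi> \<in> H" "((x, y), (x', y')) \<in> C \<xi>" "(x, y) \<noteq> (x', y')" "\<xi>' \<in> H" "((x, y), (x', y')) \<in> C \<xi>'"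
        using r unfolding r_eq r'_eq by auto
      then have in_S: "x \<in> S" "y \<in> S" "x' \<in> S" "y' \<in> S" "\<xi> \<in> S" "\<xi>' \<in> S"
        using XY GS by (auto simp: C_def P_def H_def)
      have eq: "x + \<xi> * y = x' + \<xi> * y'" "x + \<xi>' * y = x' + \<xi>' * y'" using * by (auto simp: C_def f_def)
      have "y \<noteq> y'" using eq * by auto
      have "(y - y') * \<zeta> = x' - x" if "x + \<zeta> * y = x' + \<zeta> * y'" for \<zeta>
      proof -
        have "(y - y') * \<zeta> = (x + \<zeta> * y) - x - \<zeta> * y'" by (simp add: algebra_simps)
        also have "\<dots> = (x' + \<zeta> * y') - x - \<zeta> * y'" by (simp only: that)
        finally show ?thesis by simp
      qed
      then have "(y - y') * \<xi> = (y - y') * \<xi>'" using eq by simp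
      then have "\<xi> = \<xi>'"
        using \<open>y \<noteq> y'\<close> mult_cancel[of "y - y'" \<xi> \<xi>'] in_S diff_S by auto
      then show "r = r'" by (simp add: r_eq r'_eq)
    qed
  qed (use finP in \<open>auto simp: C_def\<close>)
  finally have "card (Sigma H C) \<le> card H * card P + card P * card P"
    by (simp add: card_cartesian_product)
  then have "real (card (Sigma H C)) \<le> real (card H * card P + card P * card P)" by (simp only: of_nat_le_iff)
  moreover have "card (Sigma H C) = (\<Sum>\<xi>\<in>H. card (C \<xi>))" using finH finC by (intro card_SigmaI) auto
  ultimately have total: "(\<Sum>\<xi>\<in>H. real (card (C \<xi>))) \<le> real (card H) * real (card P) + real (card P) * real (card P)" by simp
  have "\<exists>\<xi>\<in>H. real (card (C \<xi>)) * real (card H) \<le> real (card H) * real (card P) + real (card P) * real (card P)"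
  proof (rule ccontr)
    assume "\<not> ?thesis"
    then have "(\<Sum>\<xi>\<in>H. real (card H) * real (card P) + real (card P) * real (card P)) < (\<Sum>\<xi>\<in>H. real (card (C \<xi>)) * real (card H))"
      using finH by (intro sum_strict_mono) auto
    also have "\<dots> = (\<Sum>\<xi>\<in>H. real (card (C \<xi>))) * real (card H)" by (simp add: sum_distrib_right)
    also have "\<dots> \<le> (real (card H) * real (card P) + real (card P) * real (card P)) * real (card H)"
      using total by (intro mult_right_mono) auto
    finally show False by (simp add: mult.commute)
  qed
  then obtain \<xi> where \<xi>: "\<xi> \<in> H"
    and le: "real (card (C \<xi>)) * real (card H) \<le> real (card H) * real (card P) + real (card P) * real (card P)" by blast
  have img: "f \<xi> ` P = X + (*) \<xi> ` Y" by (auto simp: f_def P_def image_iff set_plus_def)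
  have "real ((card P)\<^sup>2) \<le> real (card (X + (*) \<xi> ` Y) * card (C \<xi>))"
    using card_square_le_image_times_collisions[OF finP, of "f \<xi>"] unfolding img C_def by (simp only: of_nat_le_iff)
  then have "real (card P) * real (card P) * real (card H) \<le> real (card (X + (*) \<xi> ` Y)) * real (card (C \<xi>)) * real (card H)"
    by (intro mult_right_mono) (auto simp: power2_eq_square)
  also have "\<dots> \<le> real (card (X + (*) \<xi> ` Y)) * (real (card H) * real (card P) + real (card P) * real (card P))"
    unfolding mult.assoc using le by (intro mult_left_mono) auto
  finally have "real (card P) * (real (card P) * real (card H))
      \<le> real (card P) * (real (card (X + (*) \<xi> ` Y)) * (real (card H) + real (card P)))"
    by (simp add: algebra_simps)
  moreover have "0 < real (card P)" using XY fin by (simp add: P_def card_gt_0_iff)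
  ultimately have "real (card P) * real (card H) \<le> real (card (X + (*) \<xi> ` Y)) * (real (card H) + real (card P))"
    by (rule mult_left_le_imp_le)
  then show thesis using that[of \<xi>] \<xi> unfolding cH by (simp add: H_def P_def card_cartesian_product)
qed

text \<open>
  Ruzsa's triangle inequality through W = b A' with W inside a0 A: the dilate b X in a sum can be exchanged for a0 A
  at the cost of a factor |X - A|/t.
\<close>

lemma dilate_triangle:
  assumes A: "A \<subseteq> S - {0}" "a0 \<in> A" "b \<in> A" and t: "t \<le> real (card {x \<in> A. b * x \<in> (*) a0 ` A})"
    and X: "X \<subseteq> S" and T: "finite T"
  shows "real (card ((*) b ` X + T)) * t \<le> real (card (X + uminus ` A)) * real (card ((*) a0 ` A + T))"
proof -
  have AS: "A \<subseteq> S" "b \<in> S" "b \<noteq> 0" using A by auto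
  have fin: "finite A" "finite X" using AS X finite_S finite_subset by blast+
  define W where "W = (*) b ` {x \<in> A. b * x \<in> (*) a0 ` A}"
  have finW: "finite W" using fin by (simp add: W_def)
  have cardW: "card W = card {x \<in> A. b * x \<in> (*) a0 ` A}"
    unfolding W_def using AS by (intro card_dilate) auto
  have "(*) b ` X + uminus ` W \<subseteq> (*) b ` (X + uminus ` A)"
  proof
    fix v assume "v \<in> (*) b ` X + uminus ` W"
    then obtain x w where "x \<in> X" "w \<in> A" "v = b * (x + - w)"
      by (auto simp: W_def algebra_simps elim!: set_plus_elim)
    then show "v \<in> (*) b ` (X + uminus ` A)" by blast
  qed
  then have "card ((*) b ` X + uminus ` W) \<le> card ((*) b ` (X + uminus ` A))"
    using fin by (intro card_mono) (auto simp: finite_set_plus)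
  also have "\<dots> \<le> card (X + uminus ` A)"
    using fin by (intro card_image_le) (auto simp: finite_set_plus)
  finally have 1: "card ((*) b ` X + uminus ` W) \<le> card (X + uminus ` A)" .
  have "W + T \<subseteq> (*) a0 ` A + T" by (intro set_plus_mono2) (auto simp: W_def)
  then have 2: "card (W + T) \<le> card ((*) a0 ` A + T)"
    using fin T by (intro card_mono) (auto simp: finite_set_plus)
  have "card ((*) b ` X + T) * card W \<le> card ((*) b ` X + uminus ` W) * card (W + T)"
    using fin T finW by (intro ruzsa_triangle) auto
  also have "\<dots> \<le> card (X + uminus ` A) * card ((*) a0 ` A + T)" using 1 2 by (rule mult_le_mono)
  finally have "real (card ((*) b ` X + T) * card W) \<le> real (card (X + uminus ` A) * card ((*) a0 ` A + T))"
    by (simp only: of_nat_le_iff)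
  moreover have "real (card ((*) b ` X + T)) * t \<le> real (card ((*) b ` X + T)) * real (card W)"
    using t cardW by (intro mult_left_mono) auto
  ultimately show ?thesis by simp
qed

lemma dilate_triangle_uminus:
  assumes A: "A \<subseteq> S - {0}" "a0 \<in> A" "b \<in> A" and t: "t \<le> real (card {x \<in> A. b * x \<in> (*) a0 ` A})"
    and X: "X \<subseteq> S" and T: "finite T"
  shows "real (card (uminus ` (*) b ` X + T)) * t \<le> real (card (X + uminus ` A)) * real (card (uminus ` (*) a0 ` A + T))"
proof -
  have card_neg: "card (uminus ` Z) = card Z" for Z :: "'a set" by (simp add: card_image)
  have neg_neg: "uminus ` uminus ` Z = Z" for Z :: "'a set" by (simp add: image_image)
  have "card (uminus ` Z + T) = card (Z + uminus ` T)" for Z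
    using card_neg[of "Z + uminus ` T"] by (simp add: uminus_image_set_plus neg_neg)
  then show ?thesis using dilate_triangle[OF A t X, of "uminus ` T"] T by simp
qed

text \<open>
  Three applications of the exchange turn the sum into a dilate of A + A - A - A.  The set X is left
  arbitrary so that the factor |X - A| can be used when it is much smaller than |A - A|.
\<close>

lemma three_dilates:
  assumes A: "A \<subseteq> S - {0}" "a0 \<in> A" "u \<in> A" "v \<in> A" "w \<in> A"
    and tu: "tu \<le> real (card {x \<in> A. u * x \<in> (*) a0 ` A})"
    and tv: "tv \<le> real (card {x \<in> A. v * x \<in> (*) a0 ` A})"
    and tw: "tw \<le> real (card {x \<in> A. w * x \<in> (*) a0 ` A})"
    and pos: "0 < tu" "0 < tv" "0 < tw"
    and sub: "X \<subseteq> A" "Y \<subseteq> A" "Z \<subseteq> A"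
  shows "real (card ((*) u ` X + uminus ` (*) v ` Y + uminus ` (*) w ` Z + (*) a0 ` A)) * (tu * tv * tw)
    \<le> real (card (X + uminus ` A)) * (real (card (A + uminus ` A)))\<^sup>2 * real (card (A + A + uminus ` (A + A)))"
proof -
  have AS: "A \<subseteq> S" using A by auto
  have fin: "finite A" "finite X" "finite Y" "finite Z" 
    using finite_subset[OF AS finite_S] sub by (blast intro: finite_subset)+
  let ?D = "(*) a0 ` A"
  define k where "k = real (card (A + uminus ` A))"
  have kY: "real (card (Y + uminus ` A)) \<le> k" if "Y \<subseteq> A" for Y
    unfolding k_def using that fin by (intro of_nat_mono card_mono set_plus_mono2) (auto simp: finite_set_plus)
  define T0 where "T0 = uminus ` (*) v ` Y + uminus ` (*) w ` Z + ?D"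
  define T1 where "T1 = uminus ` (*) w ` Z + ?D + ?D"
  define T2 where "T2 = ?D + ?D + uminus ` ?D"
  have finT: "finite T0" "finite T1" "finite T2" using fin by (auto simp: T0_def T1_def T2_def finite_set_plus)
  have "real (card ((*) u ` X + T0)) * tu \<le> real (card (X + uminus ` A)) * real (card (?D + T0))"
    using dilate_triangle[OF A(1-3) tu _ finT(1)] sub AS by blast
  moreover have "?D + T0 = uminus ` (*) v ` Y + T1" by (simp add: T0_def T1_def add_ac)
  ultimately have 1: "real (card ((*) u ` X + T0)) * tu \<le> real (card (X + uminus ` A)) * real (card (uminus ` (*) v ` Y + T1))"
    by simp
  have "real (card (uminus ` (*) v ` Y + T1)) * tv \<le> real (card (Y + uminus ` A)) * real (card (uminus ` ?D + T1))"
    using dilate_triangle_uminus[OF A(1,2,4) tv _ finT(2)] sub AS by blast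
  also have "\<dots> \<le> k * real (card (uminus ` ?D + T1))" using kY sub by (intro mult_right_mono) auto
  also have "uminus ` ?D + T1 = uminus ` (*) w ` Z + T2" by (simp add: T1_def T2_def add_ac)
  finally have 2: "real (card (uminus ` (*) v ` Y + T1)) * tv \<le> k * real (card (uminus ` (*) w ` Z + T2))" .
  have "real (card (uminus ` (*) w ` Z + T2)) * tw \<le> real (card (Z + uminus ` A)) * real (card (uminus ` ?D + T2))"
    using dilate_triangle_uminus[OF A(1,2,5) tw _ finT(3)] sub AS by blast
  also have "\<dots> \<le> k * real (card (uminus ` ?D + T2))" using kY sub by (intro mult_right_mono) auto
  also have "uminus ` ?D + T2 = ?D + ?D + uminus ` (?D + ?D)" by (simp add: T2_def uminus_image_set_plus add_ac)
  also have "\<dots> = (*) a0 ` (A + A + uminus ` (A + A))"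
  proof -
    have "(*) a0 ` (P + Q) = (*) a0 ` P + (*) a0 ` Q" for P Q :: "'a set"
      by (rule dilate_set_plus)
    moreover have "(*) a0 ` uminus ` P = uminus ` (*) a0 ` P" for P :: "'a set" by (simp add: image_image)
    ultimately show ?thesis by simp
  qed
  also have "k * real (card \<dots>) \<le> k * real (card (A + A + uminus ` (A + A)))"
    using fin by (intro mult_left_mono of_nat_mono card_image_le) (auto simp: finite_set_plus k_def)
  finally have 3: "real (card (uminus ` (*) w ` Z + T2)) * tw \<le> k * real (card (A + A + uminus ` (A + A)))" .
  define p where "p = real (card (X + uminus ` A))"
  define x1 where "x1 = real (card (uminus ` (*) v ` Y + T1))"
  define x2 where "x2 = real (card (uminus ` (*) w ` Z + T2))"
  have k0: "0 \<le> k" "0 \<le> p" by (auto simp: k_def p_def)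
  have "real (card ((*) u ` X + T0)) * (tu * tv * tw) = (real (card ((*) u ` X + T0)) * tu) * (tv * tw)" by simp
  also have "\<dots> \<le> (p * x1) * (tv * tw)" using 1 pos by (intro mult_right_mono) (auto simp: p_def x1_def)
  also have "\<dots> = p * tw * (x1 * tv)" by simp
  also have "\<dots> \<le> p * tw * (k * x2)" using 2 pos k0 by (intro mult_left_mono) (auto simp: x1_def x2_def)
  also have "\<dots> = p * k * (x2 * tw)" by simp
  also have "\<dots> \<le> p * k * (k * real (card (A + A + uminus ` (A + A))))"
    using 3 k0 by (intro mult_left_mono) (auto simp: x2_def)
  finally show ?thesis by (simp add: T0_def p_def k_def power2_eq_square add_ac mult_ac)
qed

end

section \<open>Few differences force small multiplicative energy\<close>

context finite_field_set
begin

text \<open>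
  Multiplication by a nonzero element is an injection of the finite set G into itself, hence onto e.
\<close>

lemma subring_is_subfield:
  assumes "G \<subseteq> S" "e \<in> G" "\<And>x y. x \<in> G \<Longrightarrow> y \<in> G \<Longrightarrow> x - y \<in> G" "\<And>x y. x \<in> G \<Longrightarrow> y \<in> G \<Longrightarrow> x * y \<in> G"
  shows "subfield_set G"
proof -
  have fin: "finite G" using assms(1) finite_S finite_subset by blast
  have "\<exists>y\<in>G. x * y = e" if "x \<in> G" "x \<noteq> 0" for x
  proof -
    have "(*) x ` G = G"
      using that assms by (intro endo_inj_surj fin inj_on_dilate) auto
    then show ?thesis using assms(2) by (metis imageE)
  qed
  then show ?thesis using assms by (simp add: subfield_set_def)
qed

text \<open>
  Stated with a product, since c - d is invertible with respect to e and not with respect to the 1 of the ring.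
\<close>

definition quotient_set :: "'a set \<Rightarrow> 'a set \<Rightarrow> 'a set" where
  "quotient_set B2 B1 = {\<xi> \<in> S. \<exists>a\<in>B2. \<exists>b\<in>B2. \<exists>c\<in>B1. \<exists>d\<in>B1. c \<noteq> d \<and> \<xi> * (c - d) = a - b}"

lemma card_sum_outside_quotient_set:
  assumes "B1 \<subseteq> S" "B2 \<subseteq> S" "\<zeta> \<in> S" "\<zeta> \<notin> quotient_set B2 B1" "X \<subseteq> B2" "Y \<subseteq> B1"
  shows "card (X + (*) \<zeta> ` Y) = card X * card Y"
proof -
  have "inj_on (\<lambda>(x, y). x + \<zeta> * y) (X \<times> Y)"
  proof (rule inj_onI, clarify)
    fix x y x' y' assume *: "x \<in> X" "y \<in> Y" "x' \<in> X" "y' \<in> Y" and eq: "x + \<zeta> * y = x' + \<zeta> * y'"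
    have "\<zeta> * (y - y') = (x + \<zeta> * y) - x - \<zeta> * y'" by (simp add: algebra_simps)
    also have "\<dots> = (x' + \<zeta> * y') - x - \<zeta> * y'" by (simp only: eq)
    finally have "\<zeta> * (y - y') = x' - x" by simp
    then have "y = y'" using assms * unfolding quotient_set_def by blast
    then show "x = x' \<and> y = y'" using eq by simp
  qed
  moreover have "X + (*) \<zeta> ` Y = (\<lambda>(x, y). x + \<zeta> * y) ` (X \<times> Y)"
    by (auto simp: image_iff set_plus_def)
  ultimately show ?thesis by (simp add: card_image card_cartesian_product)
qed

text \<open>
  Let T be the set of all s with R + s inside R.  It is an additive group, contains e, and is closed
  under multiplication by B, because multiplication by g in B permutes R.  Therefore the multiplier ring
  G of T contains B; it lies in T since e is in T, and T lies in R since 0 is in R.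
\<close>

lemma additive_stabilizer_subfield:
  assumes R: "R \<subseteq> S" "0 \<in> R" and shift: "\<And>r. r \<in> R \<Longrightarrow> r - e \<in> R"
    and B: "B \<subseteq> S" "\<And>g r. g \<in> B \<Longrightarrow> r \<in> R \<Longrightarrow> g * r \<in> R" "\<And>g. g \<in> B \<Longrightarrow> g \<noteq> 0"
  obtains G where "subfield_set G" "B \<subseteq> G" "G \<subseteq> R"
proof -
  have finR: "finite R" using R finite_S finite_subset by blast
  define T where "T = {s \<in> S. \<forall>r\<in>R. r + s \<in> R}"
  define G where "G = {g \<in> S. \<forall>s\<in>T. g * s \<in> T}"
  have T_diff: "s - t \<in> T" if "s \<in> T" "t \<in> T" for s t
  proof -
    have "(\<lambda>r. r + t) ` R = R"
      using that by (intro endo_inj_surj finR) (auto simp: T_def)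
    have "r + (s - t) \<in> R" if "r \<in> R" for r
    proof -
      obtain r' where "r' \<in> R" "r = r' + t" using \<open>r \<in> R\<close> \<open>(\<lambda>r. r + t) ` R = R\<close> by (metis imageE)
      then show ?thesis using \<open>s \<in> T\<close> by (simp add: T_def)
    qed
    then show ?thesis using that diff_S by (simp add: T_def)
  qed
  have "e \<in> T"
  proof -
    have "(\<lambda>r. r - e) ` R = R"
      using shift by (intro endo_inj_surj finR) auto
    have "r + e \<in> R" if "r \<in> R" for r
    proof -
      obtain r' where "r' \<in> R" "r = r' - e" using \<open>r \<in> R\<close> \<open>(\<lambda>r. r - e) ` R = R\<close> by (metis imageE)
      then show ?thesis by simp
    qed
    then show ?thesis using one_S by (simp add: T_def)
  qed
  have T_R: "T \<subseteq> R"
  proof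
    fix s assume "s \<in> T"
    then have "0 + s \<in> R" using R by (auto simp only: T_def)
    then show "s \<in> R" by simp
  qed
  have BG: "B \<subseteq> G"
  proof
    fix g assume g: "g \<in> B"
    have surj: "(*) g ` R = R"
      using B g R by (intro endo_inj_surj finR inj_on_dilate) auto
    have "g * s \<in> T" if s: "s \<in> T" for s
    proof -
      have "r + g * s \<in> R" if "r \<in> R" for r
      proof -
        obtain r' where r': "r' \<in> R" "r = g * r'" using \<open>r \<in> R\<close> surj by (metis imageE)
        then have "g * (r' + s) \<in> R" using s g B by (simp add: T_def)
        then show ?thesis by (simp add: r' distrib_left)
      qed
      then show ?thesis using s g B mult_S by (auto simp: T_def)
    qed
    then show "g \<in> G" using g B by (auto simp: G_def)
  qed
  have "subfield_set G"
  proof (rule subring_is_subfield)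
    show "G \<subseteq> S" by (auto simp: G_def)
    show "e \<in> G" using one_S one_mult by (auto simp: G_def T_def)
    show "x - y \<in> G" if "x \<in> G" "y \<in> G" for x y
      using that diff_S T_diff by (auto simp: G_def left_diff_distrib)
    show "x * y \<in> G" if "x \<in> G" "y \<in> G" for x y
      using that mult_S by (auto simp: G_def mult.assoc)
  qed
  moreover have "G \<subseteq> T"
  proof
    fix g assume "g \<in> G"
    then have "g * e \<in> T" "g \<in> S" using \<open>e \<in> T\<close> by (auto simp: G_def)
    then show "g \<in> T" using one_mult[of g] by (simp add: mult.commute)
  qed
  ultimately show thesis using that BG T_R by blast
qed

text \<open>
  The argument described at the beginning, for B1 and B2 as supplied by the pigeonholing lemma.  The
  conclusion |A| \<le> 8 K^3 F M^5 comes from a failure of multiplicative closure, where three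
  exchanges of dilates suffice because the two elements x and y are taken from smaller sets on
  which one product each lies in a0 A without any cost.  A failure of closure under subtraction of e, or a set B1 with
  a single element, gives the first conclusion; the final counting in G gives the first or the second.
  The order t2 \<le> t1 is needed for the subtraction of e.
\<close>

lemma mult_energy_bound_core:
  fixes K F M \<kappa> t1 t2 :: real
  assumes A: "A \<subseteq> S - {0}" "A \<noteq> {}"
    and K: "real (card (A + uminus ` A)) \<le> K * real (card A)" "1 \<le> K"
    and F: "real (card (A + A + uminus ` (A + A))) \<le> F * real (card A)" "1 \<le> F"
    and M: "0 < M" and \<kappa>: "1 \<le> \<kappa>"
    and small: "\<And>G c. subfield_set G \<Longrightarrow> G \<noteq> S \<Longrightarrow> c \<in> S \<Longrightarrow> real (card (A \<inter> (*) c ` G)) \<le> \<kappa> * sqrt (real (card G))"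
    and B: "a0 \<in> A" "B1 \<subseteq> A" "B2 \<subseteq> A" and t: "0 < t1" "0 < t2" "t2 \<le> t1"
    and thr1: "\<And>b. b \<in> B1 \<Longrightarrow> t1 \<le> real (card {x \<in> A. b * x \<in> (*) a0 ` A})"
    and thr2: "\<And>b. b \<in> B2 \<Longrightarrow> t2 \<le> real (card {x \<in> A. b * x \<in> (*) a0 ` A})"
    and deg1: "\<And>b. b \<in> B1 \<Longrightarrow> real (card A) / M \<le> real (card {x \<in> B2. b * x \<in> (*) a0 ` A})"
    and deg2: "\<And>b. b \<in> B2 \<Longrightarrow> real (card A) / M \<le> real (card {x \<in> B1. b * x \<in> (*) a0 ` A})"
    and size: "(real (card A))\<^sup>2 \<le> M * t1 * real (card B1)" "(real (card A))\<^sup>2 \<le> M * t2 * real (card B2)"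
    and low: "real (card A) \<le> 2 * M * t1" "real (card A) \<le> 2 * M * t2"
  shows "real (card A) \<le> 16 * \<kappa>\<^sup>2 * K^4 * F * M^4 \<or> real (card S) \<le> 64 * K^4 * F * M^4 * real (card A) \<or>
    real (card A) \<le> 8 * K^3 * F * M^5"
proof (rule ccontr)
  assume contra: "\<not> ?thesis"
  define n where "n = real (card A)"
  have neg: "16 * \<kappa>\<^sup>2 * K^4 * F * M^4 < n" "64 * K^4 * F * M^4 * n < real (card S)" "8 * K^3 * F * M^5 < n"
    using contra by (auto simp: n_def)
  have AS: "A \<subseteq> S" and A0: "\<And>a. a \<in> A \<Longrightarrow> a \<noteq> 0" and BS: "B1 \<subseteq> S" "B2 \<subseteq> S" using A B by auto
  have in_S: "b \<in> S" "b \<noteq> 0" if "b \<in> A" for b using that A by auto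
  have finA: "finite A" using AS finite_S finite_subset by blast
  have finB: "finite B1" "finite B2" using BS finite_S finite_subset by blast+
  have n1: "1 \<le> n" using A finA by (simp add: n_def Suc_leI card_gt_0_iff)
  define D where "D = (*) a0 ` A"
  define k where "k = real (card (A + uminus ` A))"
  define f where "f = real (card (A + A + uminus ` (A + A)))"
  have kK: "0 \<le> k" "k \<le> K * n" and fF: "0 \<le> f" "f \<le> F * n" using K F by (auto simp: k_def f_def n_def)
  have K0: "0 < K" "0 < F" using K F by auto
  define R where "R = quotient_set B2 B1"
  have RS: "R \<subseteq> S" by (auto simp: R_def quotient_set_def)
  have kX: "real (card (X + uminus ` A)) \<le> k" if "X \<subseteq> A" for X
    unfolding k_def using that finA by (intro of_nat_mono card_mono set_plus_mono2) (auto simp: finite_set_plus)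
  have inj: "card (X + (*) \<zeta> ` Y) = card X * card Y" if "\<zeta> \<in> S" "\<zeta> \<notin> R" "X \<subseteq> B2" "Y \<subseteq> B1" for \<zeta> X Y
    using card_sum_outside_quotient_set[OF BS] that by (simp add: R_def)
  have dil_S: "(*) \<zeta> ` X \<subseteq> S" if "\<zeta> \<in> S" "X \<subseteq> S" for \<zeta> X using that mult_S by auto
  have sum_S: "X + Y \<subseteq> S" if "X \<subseteq> S" "Y \<subseteq> S" for X Y using that add_S by (auto elim!: set_plus_elim)
  \<comment> \<open>two sets with at least n/M elements are too large to embed their product in a sum of three
    dilates and a0 A\<close>
  have no_long: False
    if uvw: "u \<in> A" "v \<in> A" "w \<in> A" and th: "tu \<le> real (card {x \<in> A. u * x \<in> D})"
      "tv \<le> real (card {x \<in> A. v * x \<in> D})" "tw \<le> real (card {x \<in> A. w * x \<in> D})"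
      and lowt: "n \<le> 2 * M * tu" "n \<le> 2 * M * tv" "n \<le> 2 * M * tw"
      and XY: "n / M \<le> real (card X)" "n / M \<le> real (card Y)"
        "card X * card Y \<le> card ((*) u ` A + uminus ` (*) v ` A + uminus ` (*) w ` A + D)"
    for u v w tu tv tw X Y
  proof -
    have pos: "0 < tu" "0 < tv" "0 < tw"
      using lowt n1 M by (smt (verit) zero_less_mult_iff)+
    have lo: "n / (2 * M) \<le> tu" "n / (2 * M) \<le> tv" "n / (2 * M) \<le> tw"
      using lowt M by (simp_all add: divide_le_eq mult_ac)
    have "real (card X * card Y) * (tu * tv * tw) \<le> real (card ((*) u ` A + uminus ` (*) v ` A + uminus ` (*) w ` A + D)) * (tu * tv * tw)"
      using XY(3) pos by (intro mult_right_mono of_nat_mono) auto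
    also have "\<dots> \<le> k * k\<^sup>2 * f"
      using three_dilates[OF A(1) B(1) uvw th(1)[unfolded D_def] th(2)[unfolded D_def] th(3)[unfolded D_def] pos, of A A A]
      by (simp add: D_def k_def f_def)
    also have "\<dots> = k^3 * f" by (simp add: power2_eq_square power3_eq_cube)
    also have "\<dots> \<le> (K * n)^3 * (F * n)" using kK fF K0 by (intro mult_mono power_mono) auto
    finally have "real (card X * card Y) * (tu * tv * tw) \<le> (K * n)^3 * (F * n)" .
    moreover have "(n / M * (n / M)) * (n / (2 * M) * (n / (2 * M)) * (n / (2 * M))) \<le> real (card X * card Y) * (tu * tv * tw)"
      using XY lo pos n1 M unfolding of_nat_mult by (intro mult_mono) auto
    ultimately have "(n / M * (n / M)) * (n / (2 * M) * (n / (2 * M)) * (n / (2 * M))) \<le> (K * n)^3 * (F * n)" by linarith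
    moreover have "(n / M * (n / M)) * (n / (2 * M) * (n / (2 * M)) * (n / (2 * M))) = n * n^4 / (8 * M^5)"
      by (simp add: power_numeral_reduce)
    moreover have "(K * n)^3 * (F * n) = K^3 * F * n^4" by (simp add: power_numeral_reduce)
    ultimately have "n * n^4 / (8 * M^5) \<le> K^3 * F * n^4" by simp
    then have "n * n^4 \<le> (8 * K^3 * F * M^5) * n^4" using M by (simp add: divide_le_eq mult_ac)
    then have "n \<le> 8 * K^3 * F * M^5" by (rule mult_right_le_imp_le) (use n1 in simp)
    then show False using neg by simp
  qed
  \<comment> \<open>multiplied by a0 (c - d), the sum x + \<zeta> y with c x and \<beta> y in a0 A falls into a0 (a A - d A - b A + a0 A)\<close>
  have closed2: "\<zeta> \<in> R" if \<beta>: "\<beta> \<in> B2" and \<xi>: "\<xi> \<in> R" and \<zeta>: "\<zeta> \<in> S" "a0 * \<zeta> = \<beta> * \<xi>" for \<beta> \<xi> \<zeta>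
  proof (rule ccontr)
    assume out: "\<zeta> \<notin> R"
    obtain a b c d where abcd: "a \<in> B2" "b \<in> B2" "c \<in> B1" "d \<in> B1" "c \<noteq> d" "\<xi> * (c - d) = a - b"
      using \<xi> by (auto simp: R_def quotient_set_def)
    have abcdA: "a \<in> A" "b \<in> A" "c \<in> A" "d \<in> A" using abcd B by auto
    define X where "X = {x \<in> B2. c * x \<in> D}"
    define Y where "Y = {y \<in> B1. \<beta> * y \<in> D}"
    let ?U = "(*) a ` A + uminus ` (*) d ` A + uminus ` (*) b ` A + D"
    have XA: "X \<subseteq> A" "Y \<subseteq> A" "X \<subseteq> B2" "Y \<subseteq> B1" using B by (auto simp: X_def Y_def)
    have w: "a0 * (c - d) \<in> S" "a0 * (c - d) \<noteq> 0"
      using abcd(5) in_S[OF B(1)] in_S abcdA mult_S diff_S mult_nonzero by auto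
    have XYS: "X + (*) \<zeta> ` Y \<subseteq> S" using XA AS \<zeta> by (intro sum_S dil_S) auto
    have "(*) (a0 * (c - d)) ` (X + (*) \<zeta> ` Y) \<subseteq> (*) a0 ` ?U"
    proof
      fix s assume "s \<in> (*) (a0 * (c - d)) ` (X + (*) \<zeta> ` Y)"
      then obtain x y where xy: "x \<in> X" "y \<in> Y" and s: "s = a0 * (c - d) * (x + \<zeta> * y)"
        by (auto elim!: set_plus_elim)
      obtain y' where y': "y' \<in> A" "\<beta> * y = a0 * y'" using xy(2) by (auto simp: Y_def D_def)
      have "s = a0 * ((c - d) * x) + (a0 * \<zeta>) * (c - d) * y" by (simp add: s algebra_simps)
      also have "\<dots> = a0 * ((c - d) * x) + (\<xi> * (c - d)) * (\<beta> * y)" by (simp only: \<zeta>(2)) (simp add: algebra_simps)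
      also have "\<dots> = a0 * (a * y' + - (d * x) + - (b * y') + c * x)" by (simp only: abcd(6) y'(2)) (simp add: algebra_simps)
      also have "\<dots> \<in> (*) a0 ` ?U"
        using xy XA y' by (intro imageI set_plus_intro) (auto simp: X_def)
      finally show "s \<in> (*) a0 ` ?U" .
    qed
    then have "card ((*) (a0 * (c - d)) ` (X + (*) \<zeta> ` Y)) \<le> card ((*) a0 ` ?U)"
      using finA by (intro card_mono finite_imageI finite_set_plus) (auto simp: D_def)
    also have "\<dots> \<le> card ?U" using finA by (intro card_image_le finite_set_plus) (auto simp: D_def)
    finally have "card X * card Y \<le> card ?U"
      using card_dilate[OF w XYS] inj[OF \<zeta>(1) out XA(3,4)] by simp
    then show False
      using no_long[OF abcdA(1,4,2), of t2 t1 t2 X Y] thr1 thr2 low deg1[OF abcd(3)] deg2[OF \<beta>] abcd(1-4)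
      by (simp add: D_def X_def Y_def n_def)
  qed
  \<comment> \<open>multiplied by \<beta> (c - d), the sum x + \<zeta> y with \<beta> x and a y in a0 A falls into a0 (c A - d A - b A + a0 A)\<close>
  have closed1: "\<zeta> \<in> R" if \<beta>: "\<beta> \<in> B1" and \<xi>: "\<xi> \<in> R" and \<zeta>: "\<zeta> \<in> S" "\<beta> * \<zeta> = a0 * \<xi>" for \<beta> \<xi> \<zeta>
  proof (rule ccontr)
    assume out: "\<zeta> \<notin> R"
    obtain a b c d where abcd: "a \<in> B2" "b \<in> B2" "c \<in> B1" "d \<in> B1" "c \<noteq> d" "\<xi> * (c - d) = a - b"
      using \<xi> by (auto simp: R_def quotient_set_def)
    have abcdA: "a \<in> A" "b \<in> A" "c \<in> A" "d \<in> A" "\<beta> \<in> A" using abcd B \<beta> by auto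
    define X where "X = {x \<in> B2. \<beta> * x \<in> D}"
    define Y where "Y = {y \<in> B1. a * y \<in> D}"
    let ?U = "(*) c ` A + uminus ` (*) d ` A + uminus ` (*) b ` A + D"
    have XA: "X \<subseteq> A" "Y \<subseteq> A" "X \<subseteq> B2" "Y \<subseteq> B1" using B by (auto simp: X_def Y_def)
    have w: "\<beta> * (c - d) \<in> S" "\<beta> * (c - d) \<noteq> 0"
      using abcd(5) in_S abcdA mult_S diff_S mult_nonzero by auto
    have XYS: "X + (*) \<zeta> ` Y \<subseteq> S" using XA AS \<zeta> by (intro sum_S dil_S) auto
    have "(*) (\<beta> * (c - d)) ` (X + (*) \<zeta> ` Y) \<subseteq> (*) a0 ` ?U"
    proof
      fix s assume "s \<in> (*) (\<beta> * (c - d)) ` (X + (*) \<zeta> ` Y)"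
      then obtain x y where xy: "x \<in> X" "y \<in> Y" and s: "s = \<beta> * (c - d) * (x + \<zeta> * y)"
        by (auto elim!: set_plus_elim)
      obtain x' where x': "x' \<in> A" "\<beta> * x = a0 * x'" using xy(1) by (auto simp: X_def D_def)
      have "s = (c - d) * (\<beta> * x) + (\<beta> * \<zeta>) * (c - d) * y" by (simp add: s algebra_simps)
      also have "\<dots> = (c - d) * (\<beta> * x) + a0 * (\<xi> * (c - d)) * y" by (simp only: \<zeta>(2)) (simp add: algebra_simps)
      also have "\<dots> = a0 * (c * x' + - (d * x') + - (b * y) + a * y)" by (simp only: abcd(6) x'(2)) (simp add: algebra_simps)
      also have "\<dots> \<in> (*) a0 ` ?U"
        using xy XA x' by (intro imageI set_plus_intro) (auto simp: Y_def)
      finally show "s \<in> (*) a0 ` ?U" .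
    qed
    then have "card ((*) (\<beta> * (c - d)) ` (X + (*) \<zeta> ` Y)) \<le> card ((*) a0 ` ?U)"
      using finA by (intro card_mono finite_imageI finite_set_plus) (auto simp: D_def)
    also have "\<dots> \<le> card ?U" using finA by (intro card_image_le finite_set_plus) (auto simp: D_def)
    finally have "card X * card Y \<le> card ?U"
      using card_dilate[OF w XYS] inj[OF \<zeta>(1) out XA(3,4)] by simp
    then show False
      using no_long[OF abcdA(3,4,2), of t1 t1 t2 X Y] thr1 thr2 low deg1[OF \<beta>] deg2[OF abcd(1)] abcd(1-4)
      by (simp add: D_def X_def Y_def n_def)
  qed
  have B2pos: "0 < real (card B2)" "B2 \<noteq> {}"
  proof -
    have "0 < (real (card A))\<^sup>2" using n1 by (simp add: n_def)
    then have "0 < M * t2 * real (card B2)" using size(2) by linarith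
    then show "0 < real (card B2)" "B2 \<noteq> {}" using M t by (auto simp: zero_less_mult_iff)
  qed
  \<comment> \<open>(\<xi> - e) y = \<xi> y - y, and the lemma of Petridis removes the extra summand - y.  The set X it
    supplies may be small, but the factor |X - A| in the first exchange is then small as well, so that |X| cancels.\<close>
  have shift: "\<xi> - e \<in> R" if \<xi>: "\<xi> \<in> R" for \<xi>
  proof (rule ccontr)
    assume out: "\<xi> - e \<notin> R"
    have \<xi>S: "\<xi> \<in> S" "\<xi> - e \<in> S" using \<xi> RS one_S diff_S by auto
    obtain a b c d where abcd: "a \<in> B2" "b \<in> B2" "c \<in> B1" "d \<in> B1" "c \<noteq> d" "\<xi> * (c - d) = a - b"
      using \<xi> by (auto simp: R_def quotient_set_def)
    have abcdA: "a \<in> A" "b \<in> A" "c \<in> A" "d \<in> A" using abcd B by auto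
    obtain X where X: "X \<subseteq> B2" "X \<noteq> {}" "card (X + uminus ` A) * card B2 \<le> card (B2 + uminus ` A) * card X"
      and pet: "\<And>C. finite C \<Longrightarrow> card (X + uminus ` A + C) * card X \<le> card (X + uminus ` A) * card (X + C)"
      using petridis[OF finB(2) B2pos(2), of "uminus ` A"] finA by blast
    define Y where "Y = {y \<in> B1. a * y \<in> D}"
    have XA: "X \<subseteq> A" "Y \<subseteq> A" "Y \<subseteq> B1" using B X by (auto simp: Y_def)
    have finXY: "finite X" "finite Y" using XA finA finite_subset by blast+
    let ?U = "(*) c ` X + uminus ` (*) d ` X + uminus ` (*) b ` Y + D"
    define x where "x = real (card X)"
    define y where "y = real (card Y)"
    define p where "p = real (card (X + uminus ` A))"
    have x0: "0 < x" using X finXY by (simp add: x_def card_gt_0_iff)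
    have "card X * card Y = card (X + (*) (\<xi> - e) ` Y)" using inj[OF \<xi>S(2) out X(1) XA(3)] by simp
    also have "\<dots> \<le> card (X + uminus ` A + (*) \<xi> ` Y)"
    proof (rule card_mono)
      show "finite (X + uminus ` A + (*) \<xi> ` Y)" using finXY finA by (simp add: finite_set_plus)
      show "X + (*) (\<xi> - e) ` Y \<subseteq> X + uminus ` A + (*) \<xi> ` Y"
      proof
        fix s assume "s \<in> X + (*) (\<xi> - e) ` Y"
        then obtain x y where xy: "x \<in> X" "y \<in> Y" "s = x + (\<xi> - e) * y" by (auto elim!: set_plus_elim)
        have "e * y = y" using xy XA AS one_mult by auto
        then have "s = x + - y + \<xi> * y" unfolding xy(3) by (simp add: left_diff_distrib)
        also have "\<dots> \<in> X + uminus ` A + (*) \<xi> ` Y" using xy XA by (intro set_plus_intro) auto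
        finally show "s \<in> X + uminus ` A + (*) \<xi> ` Y" .
      qed
    qed
    finally have "x * y \<le> real (card (X + uminus ` A + (*) \<xi> ` Y))"
      unfolding x_def y_def by (metis of_nat_le_iff of_nat_mult)
    then have "x * y * x \<le> real (card (X + uminus ` A + (*) \<xi> ` Y)) * x" using x0 by (intro mult_right_mono) auto
    also have "\<dots> \<le> p * real (card (X + (*) \<xi> ` Y))"
      using pet[of "(*) \<xi> ` Y"] finXY unfolding x_def p_def by (metis finite_imageI of_nat_le_iff of_nat_mult)
    finally have 1: "x * y * x \<le> p * real (card (X + (*) \<xi> ` Y))" .
    have w: "c - d \<in> S" "c - d \<noteq> 0" using abcd(5) in_S abcdA diff_S by auto
    have XYS: "X + (*) \<xi> ` Y \<subseteq> S" using XA AS \<xi>S by (intro sum_S dil_S) auto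
    have "(*) (c - d) ` (X + (*) \<xi> ` Y) \<subseteq> ?U"
    proof
      fix s assume "s \<in> (*) (c - d) ` (X + (*) \<xi> ` Y)"
      then obtain x y where xy: "x \<in> X" "y \<in> Y" and s: "s = (c - d) * (x + \<xi> * y)"
        by (auto elim!: set_plus_elim)
      have "s = (c - d) * x + (\<xi> * (c - d)) * y" by (simp add: s algebra_simps)
      also have "\<dots> = c * x + - (d * x) + - (b * y) + a * y" by (simp only: abcd(6)) (simp add: algebra_simps)
      also have "\<dots> \<in> ?U" using xy by (intro set_plus_intro) (auto simp: Y_def)
      finally show "s \<in> ?U" .
    qed
    then have "card ((*) (c - d) ` (X + (*) \<xi> ` Y)) \<le> card ?U"
      using finA finXY by (intro card_mono finite_set_plus) (auto simp: D_def)
    then have "card (X + (*) \<xi> ` Y) \<le> card ?U" using card_dilate[OF w XYS] by simp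
    then have "real (card (X + (*) \<xi> ` Y)) * (t1 * t1 * t2) \<le> real (card ?U) * (t1 * t1 * t2)"
      using t by (intro mult_right_mono of_nat_mono) auto
    also have "\<dots> \<le> p * k\<^sup>2 * f"
      using three_dilates[OF A(1) B(1) abcdA(3,4,2) thr1[OF abcd(3)] thr1[OF abcd(4)] thr2[OF abcd(2)] t(1,1,2) XA(1,1,2)]
      by (simp add: D_def k_def f_def p_def)
    finally have 2: "real (card (X + (*) \<xi> ` Y)) * (t1 * t1 * t2) \<le> p * k\<^sup>2 * f" .
    have p: "0 \<le> p" "p * real (card B2) \<le> k * x"
    proof -
      have "p * real (card B2) \<le> real (card (B2 + uminus ` A)) * x"
        using X(3) unfolding p_def x_def by (metis of_nat_le_iff of_nat_mult)
      also have "\<dots> \<le> k * x" using kX[OF B(3)] x0 by (intro mult_right_mono) auto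
      finally show "p * real (card B2) \<le> k * x" .
    qed (simp add: p_def)
    define \<beta> where "\<beta> = real (card B2)"
    have "x * y * x * (t1 * t1 * t2) \<le> p * real (card (X + (*) \<xi> ` Y)) * (t1 * t1 * t2)"
      using 1 t by (intro mult_right_mono) auto
    also have "\<dots> \<le> p * (p * k\<^sup>2 * f)" using 2 p unfolding mult.assoc[of p] by (intro mult_left_mono) auto
    finally have "x * y * x * (t1 * t1 * t2) * \<beta>\<^sup>2 \<le> p * (p * k\<^sup>2 * f) * \<beta>\<^sup>2" by (intro mult_right_mono) auto
    also have "\<dots> = (p * \<beta>)\<^sup>2 * (k\<^sup>2 * f)" by (simp add: power2_eq_square)
    also have "\<dots> \<le> (k * x)\<^sup>2 * (k\<^sup>2 * f)"
      using p fF by (intro mult_right_mono power_mono) (auto simp: \<beta>_def)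
    also have "\<dots> = (k^4 * f) * x\<^sup>2" by (simp add: power_mult_distrib power_numeral_reduce)
    finally have "(y * (t1 * t1 * t2) * \<beta>\<^sup>2) * x\<^sup>2 \<le> (k^4 * f) * x\<^sup>2"
      by (simp add: power2_eq_square mult_ac)
    then have "y * (t1 * t1 * t2) * \<beta>\<^sup>2 \<le> k^4 * f"
      by (rule mult_right_le_imp_le) (use x0 in simp)
    also have "\<dots> \<le> (K * n)^4 * (F * n)" using kK fF K0 by (intro mult_mono power_mono) auto
    finally have 3: "y * (t1 * t1 * t2) * \<beta>\<^sup>2 \<le> (K * n)^4 * (F * n)" .
    have y: "n / M \<le> y" using deg2[OF abcd(1)] by (simp add: y_def Y_def n_def D_def)
    have \<beta>: "n\<^sup>2 / (M * t2) \<le> \<beta>" using size(2) M t by (simp add: \<beta>_def n_def divide_le_eq mult_ac)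
    have tt: "n / (2 * M) * t2 \<le> t1 * t1"
    proof (rule mult_mono)
      show "n / (2 * M) \<le> t1" using low(1) M by (simp add: n_def divide_le_eq mult_ac)
    qed (use t in auto)
    have "(n / M) * ((n / (2 * M) * t2) * t2) * (n\<^sup>2 / (M * t2))\<^sup>2 \<le> y * (t1 * t1 * t2) * \<beta>\<^sup>2"
    proof (rule mult_mono)
      show "(n / M) * ((n / (2 * M) * t2) * t2) \<le> y * (t1 * t1 * t2)"
      proof (rule mult_mono)
        show "n / (2 * M) * t2 * t2 \<le> t1 * t1 * t2" using tt t by (intro mult_right_mono) auto
      qed (use y n1 M t in \<open>auto simp: y_def\<close>)
      show "(n\<^sup>2 / (M * t2))\<^sup>2 \<le> \<beta>\<^sup>2" using \<beta> M t by (intro power_mono) auto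
    qed (use t in \<open>auto simp: y_def\<close>)
    then have "(n / M) * ((n / (2 * M) * t2) * t2) * (n\<^sup>2 / (M * t2))\<^sup>2 \<le> (K * n)^4 * (F * n)" using 3 by linarith
    moreover have "(n / M) * ((n / (2 * M) * t2) * t2) * (n\<^sup>2 / (M * t2))\<^sup>2 = n * n^5 / (2 * M^4)"
      using t M by (simp add: power_numeral_reduce)
    moreover have "(K * n)^4 * (F * n) = K^4 * F * n^5" by (simp add: power_numeral_reduce)
    ultimately have "n * n^5 / (2 * M^4) \<le> K^4 * F * n^5" by simp
    then have "n * n^5 \<le> (2 * K^4 * F * M^4) * n^5" using M by (simp add: divide_le_eq mult_ac)
    then have "n \<le> 2 * K^4 * F * M^4" by (rule mult_right_le_imp_le) (use n1 in simp)
    also have "\<dots> \<le> 16 * \<kappa>\<^sup>2 * K^4 * F * M^4"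
      using one_le_power[OF \<kappa>, of 2] K0 M by (intro mult_right_mono) auto
    finally show False using neg by simp
  qed
  \<comment> \<open>for a single element in B1 the set R would be empty, but then |A| is at most M\<close>
  have B1: "\<exists>c\<in>B1. \<exists>d\<in>B1. c \<noteq> d"
  proof (rule ccontr)
    assume "\<not> ?thesis"
    then have "card B1 \<le> 1" using card_le_Suc0_iff_eq[OF finB(1)] by auto
    then have "M * t1 * real (card B1) \<le> M * t1 * 1" using M t by (intro mult_left_mono) auto
    then have "n * n \<le> M * t1" using size(1) by (simp add: n_def power2_eq_square)
    moreover have "t1 \<le> n"
    proof -
      have "B1 \<noteq> {}" using size(1) n1 by (auto simp: n_def)
      then obtain b where "b \<in> B1" by blast
      then have "t1 \<le> real (card {x \<in> A. b * x \<in> (*) a0 ` A})" by (rule thr1)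
      also have "\<dots> \<le> n" unfolding n_def using finA by (intro of_nat_mono card_mono) auto
      finally show ?thesis .
    qed
    ultimately have "n * n \<le> M * n" using M by (meson mult_left_mono order_less_imp_le order_trans)
    then have nM: "n \<le> M" by (rule mult_right_le_imp_le) (use n1 in simp)
    have "1 \<le> 16 * \<kappa>\<^sup>2 * K^4 * F" 
    proof -
      have "1 * 1 * 1 * 1 \<le> 16 * \<kappa>\<^sup>2 * K^4 * F"
        using \<kappa> K F by (intro mult_mono) auto
      then show ?thesis by simp
    qed
    moreover have "M \<le> M^4" using nM n1 self_le_power[of M 4] by simp
    ultimately have "1 * M \<le> 16 * \<kappa>\<^sup>2 * K^4 * F * M^4" using M K0 by (intro mult_mono) auto
    then show False using nM neg by simp
  qed
  have zero_R: "0 \<in> R"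
    using B1 B2pos(2) zero_S unfolding R_def quotient_set_def by force
  define g where "g = {\<gamma> \<in> S. a0 * \<gamma> \<in> B1 \<union> B2}"
  obtain G where G: "subfield_set G" "g \<subseteq> G" "G \<subseteq> R"
  proof (rule additive_stabilizer_subfield[OF RS zero_R shift, of g])
    show "g \<subseteq> S" by (auto simp: g_def)
    show g0: "\<gamma> \<noteq> 0" if "\<gamma> \<in> g" for \<gamma> using that A0[of 0] B by (auto simp: g_def)
    show "\<gamma> * r \<in> R" if \<gamma>: "\<gamma> \<in> g" and r: "r \<in> R" for \<gamma> r
    proof -
      have \<gamma>S: "\<gamma> \<in> S" "r \<in> S" using \<gamma> r RS by (auto simp: g_def)
      show ?thesis
      proof (cases "a0 * \<gamma> \<in> B2")
        case True
        then show ?thesis using closed2[of "a0 * \<gamma>" r "\<gamma> * r"] r \<gamma>S mult_S by (simp add: mult.assoc)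
      next
        case False
        then have b: "a0 * \<gamma> \<in> B1" using \<gamma> by (simp add: g_def)
        obtain h where h: "h \<in> S" "\<gamma> * h = e" using inverse_S[OF \<gamma>S(1) g0[OF \<gamma>]] by blast
        have "h \<noteq> 0" using h one_nonzero by auto
        have cancel: "\<gamma> * (h * s) = s" if "s \<in> S" for s using h one_mult[OF that] by (simp flip: mult.assoc)
        have "h * s \<in> R" if "s \<in> R" for s
        proof (rule closed1[OF b that])
          show "h * s \<in> S" using h that RS mult_S by auto
          show "a0 * \<gamma> * (h * s) = a0 * s" using cancel[of s] that RS by (auto simp: mult.assoc)
        qed
        then have "(*) h ` R = R"
          using finite_subset[OF RS finite_S] h \<open>h \<noteq> 0\<close> RS by (intro endo_inj_surj inj_on_dilate) auto
        then obtain s where s: "s \<in> R" "r = h * s" using r by (metis imageE)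
        then have "\<gamma> * r = s" using cancel RS by auto
        then show ?thesis using s by simp
      qed
    qed
  qed
  have BG: "B1 \<union> B2 \<subseteq> A \<inter> (*) a0 ` G"
  proof
    fix b assume b: "b \<in> B1 \<union> B2"
    then have "b \<in> S" using BS by auto
    then obtain \<gamma> where "\<gamma> \<in> S" "a0 * \<gamma> = b" using divide_S in_S B(1) by metis
    then have "\<gamma> \<in> G" using b G by (auto simp: g_def)
    then show "b \<in> A \<inter> (*) a0 ` G" using b B \<open>a0 * \<gamma> = b\<close> by auto
  qed
  define N where "N = real (card B2 * card B1)"
  define q where "q = real (card G)"
  have GS: "G \<subseteq> S" using G RS by auto
  have finG: "finite G" using GS finite_S finite_subset by blast
  have q2: "2 \<le> q"
  proof -
    have "{0, e} \<subseteq> G" using G(1) unfolding subfield_set_def by (metis diff_self empty_subsetI insert_subset)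
    then have "card {0, e} \<le> card G" using finG by (intro card_mono)
    then show ?thesis using one_nonzero by (simp add: q_def)
  qed
  have "B1 \<noteq> {}" using B1 by auto
  then have N0: "0 < N" using B2pos finB by (simp add: N_def card_gt_0_iff)
  obtain \<xi> where \<xi>: "\<xi> \<in> G" "\<xi> \<noteq> 0"
    "N * (q - 1) \<le> real (card (B2 + (*) \<xi> ` B1)) * ((q - 1) + N)"
    using exists_dilate_large_sumset[OF G(1) BS(2,1) B2pos(2) \<open>B1 \<noteq> {}\<close>] unfolding N_def q_def by blast
  define m where "m = real (card (B2 + (*) \<xi> ` B1))"
  have "\<xi> \<in> R" using \<xi> G by auto
  then obtain a b c d where abcd: "a \<in> B2" "b \<in> B2" "c \<in> B1" "d \<in> B1" "c \<noteq> d" "\<xi> * (c - d) = a - b"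
    by (auto simp: R_def quotient_set_def)
  have abcdA: "a \<in> A" "b \<in> A" "c \<in> A" "d \<in> A" using abcd B by auto
  have m_upper: "m * (t1 * t1 * t2 * t2) \<le> (K * n)^4 * (F * n)"
  proof -
    have w: "c - d \<in> S" "c - d \<noteq> 0" using abcd(5) in_S abcdA diff_S by auto
    have XYS: "B2 + (*) \<xi> ` B1 \<subseteq> S" using BS \<xi> GS by (intro sum_S dil_S) auto
    let ?U = "(*) c ` A + uminus ` (*) d ` A + uminus ` (*) b ` A"
    have "(*) (c - d) ` (B2 + (*) \<xi> ` B1) \<subseteq> (*) a ` A + ?U"
    proof
      fix s assume "s \<in> (*) (c - d) ` (B2 + (*) \<xi> ` B1)"
      then obtain x y where xy: "x \<in> B2" "y \<in> B1" and s: "s = (c - d) * (x + \<xi> * y)"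
        by (auto elim!: set_plus_elim)
      have "s = (c - d) * x + (\<xi> * (c - d)) * y" by (simp add: s algebra_simps)
      also have "\<dots> = a * y + (c * x + - (d * x) + - (b * y))" by (simp only: abcd(6)) (simp add: algebra_simps)
      also have "\<dots> \<in> (*) a ` A + ?U" using xy B by (intro set_plus_intro) auto
      finally show "s \<in> (*) a ` A + ?U" .
    qed
    then have "card ((*) (c - d) ` (B2 + (*) \<xi> ` B1)) \<le> card ((*) a ` A + ?U)"
      using finA by (intro card_mono finite_set_plus) auto
    then have "m \<le> real (card ((*) a ` A + ?U))" using card_dilate[OF w XYS] by (simp add: m_def)
    then have "m * t2 \<le> real (card ((*) a ` A + ?U)) * t2" using t by (intro mult_right_mono) auto
    also have "\<dots> \<le> k * real (card (D + ?U))"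
      using dilate_triangle[OF A(1) B(1) abcdA(1) thr2[OF abcd(1)] AS, of ?U] finA
      by (simp add: k_def D_def finite_set_plus)
    also have "D + ?U = ?U + D" by (rule add.commute)
    finally have "m * t2 * (t1 * t1 * t2) \<le> k * real (card (?U + D)) * (t1 * t1 * t2)"
      using t by (intro mult_right_mono) auto
    also have "\<dots> \<le> k * (k * k\<^sup>2 * f)"
      unfolding mult.assoc[of k]
      using three_dilates[OF A(1) B(1) abcdA(3,4,2) thr1[OF abcd(3)] thr1[OF abcd(4)] thr2[OF abcd(2)] t(1,1,2), of A A A] kK
      by (intro mult_left_mono) (auto simp: D_def k_def f_def)
    also have "\<dots> = k^4 * f" by (simp add: power_numeral_reduce)
    also have "\<dots> \<le> (K * n)^4 * (F * n)" using kK fF K0 by (intro mult_mono power_mono) auto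
    finally show ?thesis by (simp add: mult_ac)
  qed
  have t_low: "n / (2 * M) \<le> t1" "n / (2 * M) \<le> t2" using low M by (simp_all add: n_def divide_le_eq mult_ac)
  have N_low: "n^4 \<le> M\<^sup>2 * (t1 * t2) * N"
  proof -
    have "n\<^sup>2 * n\<^sup>2 \<le> (M * t1 * real (card B1)) * (M * t2 * real (card B2))"
      using size M t unfolding n_def by (intro mult_mono) auto
    then show ?thesis by (simp add: N_def power2_eq_square power_numeral_reduce mult_ac)
  qed
  have tt: "n\<^sup>2 / (4 * M\<^sup>2) \<le> t1 * t2"
  proof -
    have "n / (2 * M) * (n / (2 * M)) \<le> t1 * t2" using t_low t M n1 by (intro mult_mono) auto
    then show ?thesis by (simp add: power2_eq_square)
  qed
  have tt0: "0 < t1 * t2" using t by simp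
  have final1: False if small_N: "N \<le> 3 * \<kappa>\<^sup>2 * m"
  proof -
    have "n^4 * (n\<^sup>2 / (4 * M\<^sup>2)) \<le> (M\<^sup>2 * (t1 * t2) * N) * (t1 * t2)"
      using N_low tt tt0 N0 M by (intro mult_mono) auto
    also have "\<dots> = M\<^sup>2 * (t1 * t1 * t2 * t2) * N" by (simp add: mult_ac)
    also have "\<dots> \<le> M\<^sup>2 * (t1 * t1 * t2 * t2) * (3 * \<kappa>\<^sup>2 * m)" using small_N t by (intro mult_left_mono) auto
    also have "\<dots> = 3 * \<kappa>\<^sup>2 * M\<^sup>2 * (m * (t1 * t1 * t2 * t2))" by (simp add: mult_ac)
    also have "\<dots> \<le> 3 * \<kappa>\<^sup>2 * M\<^sup>2 * ((K * n)^4 * (F * n))" using m_upper by (intro mult_left_mono) auto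
    finally have "n^4 * (n\<^sup>2 / (4 * M\<^sup>2)) \<le> 3 * \<kappa>\<^sup>2 * M\<^sup>2 * ((K * n)^4 * (F * n))" .
    then have "n^4 * n\<^sup>2 \<le> 4 * M\<^sup>2 * (3 * \<kappa>\<^sup>2 * M\<^sup>2 * ((K * n)^4 * (F * n)))" using M by (simp add: divide_le_eq mult_ac)
    then have "n * n^5 \<le> (12 * \<kappa>\<^sup>2 * K^4 * F * M^4) * n^5" by (simp add: power_mult_distrib power_numeral_reduce mult_ac)
    then have "n \<le> 12 * \<kappa>\<^sup>2 * K^4 * F * M^4" by (rule mult_right_le_imp_le) (use n1 in simp)
    also have "\<dots> \<le> 16 * \<kappa>\<^sup>2 * K^4 * F * M^4" using K0 M by (intro mult_right_mono) auto
    finally show False using neg by simp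
  qed
  show False
  proof (cases "G = S")
    case False
    have le: "real (card B) \<le> \<kappa> * sqrt q" if "B \<subseteq> B1 \<union> B2" for B
    proof -
      have "card B \<le> card (A \<inter> (*) a0 ` G)" using that BG finA by (intro card_mono) auto
      then show ?thesis using small[OF G(1) False, of a0] in_S[OF B(1)] by (simp add: q_def)
    qed
    have "N \<le> (\<kappa> * sqrt q) * (\<kappa> * sqrt q)"
      unfolding N_def of_nat_mult using le \<kappa> q2 by (intro mult_mono) auto
    also have "\<dots> = \<kappa>\<^sup>2 * q" using q2 by (simp add: power2_eq_square)
    also have "\<dots> \<le> \<kappa>\<^sup>2 * (2 * (q - 1))" using q2 by (intro mult_left_mono) auto
    finally have Nq: "N \<le> 2 * \<kappa>\<^sup>2 * (q - 1)" by (simp add: algebra_simps)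
    have \<kappa>1: "1 \<le> \<kappa>\<^sup>2" using \<kappa> by simp
    have "N * (q - 1) \<le> m * ((q - 1) + N)" using \<xi>(3) by (simp add: m_def)
    also have "\<dots> \<le> m * ((q - 1) + 2 * \<kappa>\<^sup>2 * (q - 1))" using Nq by (intro mult_left_mono) (auto simp: m_def)
    also have "\<dots> = m * (1 + 2 * \<kappa>\<^sup>2) * (q - 1)" by (simp add: algebra_simps)
    finally have "N \<le> m * (1 + 2 * \<kappa>\<^sup>2)" by (rule mult_right_le_imp_le) (use q2 in simp)
    also have "\<dots> \<le> m * (3 * \<kappa>\<^sup>2)" using \<kappa>1 by (intro mult_left_mono) (auto simp: m_def)
    finally show False using final1 by (simp add: mult_ac)
  next
    case True
    show False
    proof (cases "N \<le> q - 1")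
      case True
      have "N * (q - 1) \<le> m * ((q - 1) + N)" using \<xi>(3) by (simp add: m_def)
      also have "\<dots> \<le> m * ((q - 1) + (q - 1))" using True by (intro mult_left_mono) (auto simp: m_def)
      also have "\<dots> = (2 * m) * (q - 1)" by simp
      finally have "N \<le> 2 * m" by (rule mult_right_le_imp_le) (use q2 in simp)
      moreover have "2 * m \<le> 3 * \<kappa>\<^sup>2 * m"
      proof -
        have "1 \<le> \<kappa>\<^sup>2" using \<kappa> by simp
        then show ?thesis by (intro mult_right_mono) (auto simp: m_def)
      qed
      ultimately show False using final1 by linarith
    next
      case False
      have "N * (q - 1) \<le> m * ((q - 1) + N)" using \<xi>(3) by (simp add: m_def)
      also have "\<dots> \<le> m * (N + N)" using False by (intro mult_left_mono) (auto simp: m_def)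
      finally have "(q - 1) * N \<le> (2 * m) * N" by (simp add: mult_ac)
      then have "q - 1 \<le> 2 * m" by (rule mult_right_le_imp_le) (use N0 in simp)
      then have qm: "q \<le> 4 * m" using q2 by linarith
      have "q * (n\<^sup>2 / (4 * M\<^sup>2) * (n\<^sup>2 / (4 * M\<^sup>2))) \<le> (4 * m) * ((t1 * t2) * (t1 * t2))"
        using qm tt tt0 q2 by (intro mult_mono) (auto simp: m_def)
      also have "\<dots> = 4 * (m * (t1 * t1 * t2 * t2))" by (simp add: mult_ac)
      also have "\<dots> \<le> 4 * ((K * n)^4 * (F * n))" using m_upper by simp
      finally have "q * (n\<^sup>2 / (4 * M\<^sup>2) * (n\<^sup>2 / (4 * M\<^sup>2))) \<le> 4 * ((K * n)^4 * (F * n))" .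
      then have "q * n^4 / (16 * M^4) \<le> 4 * ((K * n)^4 * (F * n))" by (simp add: power2_eq_square power_numeral_reduce)
      then have "q * n^4 \<le> 16 * M^4 * (4 * ((K * n)^4 * (F * n)))" using M by (simp add: divide_le_eq mult_ac)
      then have "q * n^4 \<le> (64 * K^4 * F * M^4 * n) * n^4" by (simp add: power_mult_distrib mult_ac)
      then have "q \<le> 64 * K^4 * F * M^4 * n" by (rule mult_right_le_imp_le) (use n1 in simp)
      then show False using neg \<open>G = S\<close> by (simp add: q_def)
    qed
  qed
qed

text \<open>
  A set with few differences that does not concentrate on multiples of proper subfields cannot have
  large multiplicative energy.  With M about |A|^3 divided by the energy, K and F the relative sizes of A - A and
  A + A - A - A, this is the sum-product estimate K^4 F M^4 \<ge> min(|A|, |S|/|A|) or K^3 F M^5 \<ge> |A|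
  up to constants.  The factor (l + 1)^2 counts the pairs of dyadic sizes.
\<close>

theorem mult_energy_bound:
  fixes K F M \<kappa> :: real
  assumes A: "A \<subseteq> S - {0}" "A \<noteq> {}" and l: "card A \<le> 2 ^ l"
    and K: "real (card (A + uminus ` A)) \<le> K * real (card A)" "1 \<le> K"
    and F: "real (card (A + A + uminus ` (A + A))) \<le> F * real (card A)" "1 \<le> F"
    and \<kappa>: "1 \<le> \<kappa>"
    and small: "\<And>G c. subfield_set G \<Longrightarrow> G \<noteq> S \<Longrightarrow> c \<in> S \<Longrightarrow> real (card (A \<inter> (*) c ` G)) \<le> \<kappa> * sqrt (real (card G))"
    and M: "4 * (real l + 1)\<^sup>2 * real (card A) ^ 3 \<le> M * real (mult_energy A)" "0 < M"
  shows "real (card A) \<le> 16 * \<kappa>\<^sup>2 * K^4 * F * M^4 \<or> real (card S) \<le> 64 * K^4 * F * M^4 * real (card A) \<or>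
    real (card A) \<le> 8 * K^3 * F * M^5"
proof -
  obtain a0 B1 B2 t1 t2 where B: "a0 \<in> A" "B1 \<subseteq> A" "B2 \<subseteq> A" "0 < t1" "0 < t2"
    "\<And>b. b \<in> B1 \<Longrightarrow> t1 \<le> real (card {x \<in> A. b * x \<in> (*) a0 ` A})"
    "\<And>b. b \<in> B2 \<Longrightarrow> t2 \<le> real (card {x \<in> A. b * x \<in> (*) a0 ` A})"
    "\<And>b. b \<in> B1 \<Longrightarrow> real (card A) / M \<le> real (card {x \<in> B2. b * x \<in> (*) a0 ` A})"
    "\<And>b. b \<in> B2 \<Longrightarrow> real (card A) / M \<le> real (card {x \<in> B1. b * x \<in> (*) a0 ` A})"
    "(real (card A))\<^sup>2 \<le> M * t1 * real (card B1)" "(real (card A))\<^sup>2 \<le> M * t2 * real (card B2)"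
    "real (card A) \<le> 2 * M * t1" "real (card A) \<le> 2 * M * t2"
  proof (rule mult_energy_pigeonhole[OF A l M], goal_cases)
    case (1 a0 B1 B2 t1 t2)
    show ?case by (rule 1(1)) (use 1(2-) in blast)+
  qed
  note core = mult_energy_bound_core[OF A K F M(2) \<kappa> small B(1)]
  show ?thesis
  proof (cases "t2 \<le> t1")
    case True
    show ?thesis
      by (rule core[of B1 B2 t1 t2]) (use B True in blast)+
  next
    case False
    then have "t1 \<le> t2" by simp
    show ?thesis
      by (rule core[of B2 B1 t2 t1]) (use B \<open>t1 \<le> t2\<close> in blast)+
  qed
qed

end

section \<open>Fourier estimates for the trilinear sum\<close>

lemma sum_power4_le:
  fixes f :: "'a \<Rightarrow> real"
  shows "(\<Sum>i\<in>I. f i)^4 \<le> real (card I)^3 * (\<Sum>i\<in>I. (f i)^4)"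
proof -
  have "(\<Sum>i\<in>I. f i)^4 = ((\<Sum>i\<in>I. f i)\<^sup>2)\<^sup>2" by simp
  also have "\<dots> \<le> (real (card I) * (\<Sum>i\<in>I. (f i)\<^sup>2))\<^sup>2"
    by (intro power_mono sum_square_le_card_times_sum_squares) auto
  also have "\<dots> = (real (card I))\<^sup>2 * (\<Sum>i\<in>I. (f i)\<^sup>2)\<^sup>2" by (simp add: power_mult_distrib)
  also have "\<dots> \<le> (real (card I))\<^sup>2 * (real (card I) * (\<Sum>i\<in>I. ((f i)\<^sup>2)\<^sup>2))"
    by (intro mult_left_mono sum_square_le_card_times_sum_squares) auto
  finally show ?thesis by (simp add: power2_eq_square[of "real (card I)"] power3_eq_cube mult.assoc)
qed

lemma additive_energy_collisions:
  assumes "finite A"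
  shows "card {(p, q). p \<in> A \<times> A \<and> q \<in> A \<times> A \<and> fst p + snd p = fst q + snd q} = additive_energy A"
proof -
  let ?P = "\<lambda>s. {(a, b). a \<in> A \<and> b \<in> A \<and> a + b = s}"
  have fin: "finite (?P s)" for s
    using assms by (rule_tac finite_subset[of _ "A \<times> A"]) auto
  have "{(p, q). p \<in> A \<times> A \<and> q \<in> A \<times> A \<and> fst p + snd p = fst q + snd q} = (\<Union>s\<in>A + A. ?P s \<times> ?P s)"
  proof (intro equalityI subsetI)
    fix r assume "r \<in> {(p, q). p \<in> A \<times> A \<and> q \<in> A \<times> A \<and> fst p + snd p = fst q + snd q}"
    then obtain a b c d where "r = ((a, b), (c, d))" "a \<in> A" "b \<in> A" "c \<in> A" "d \<in> A" "a + b = c + d"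
      by auto
    then show "r \<in> (\<Union>s\<in>A + A. ?P s \<times> ?P s)"
      by (intro UN_I[of "a + b"]) (simp_all add: set_plus_intro)
  next
    fix r assume "r \<in> (\<Union>s\<in>A + A. ?P s \<times> ?P s)"
    then obtain s where "r \<in> ?P s \<times> ?P s" by blast
    then show "r \<in> {(p, q). p \<in> A \<times> A \<and> q \<in> A \<times> A \<and> fst p + snd p = fst q + snd q}"
      by clarsimp
  qed
  also have "card \<dots> = (\<Sum>s\<in>A + A. card (?P s \<times> ?P s))"
    using assms fin by (intro card_UN_disjoint) (auto simp: finite_set_plus)
  finally show ?thesis by (simp add: additive_energy_def sum_reps_def card_cartesian_product power2_eq_square)
qed

context finite_field_set
begin

text \<open>
  Count the solutions of x z = x' z' according to (z, z') and apply Cauchy-Schwarz.  Two solutions with the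
  same (z, z') satisfy x1 x2' = x1' x2, and such a quadruple together with z determines z'.
\<close>

lemma bilinear_collisions_le_mult_energy:
  assumes V: "V \<subseteq> S - {0}" and Z: "Z \<subseteq> S - {0}"
  shows "(card {((x, z), (x', z')). x \<in> V \<and> z \<in> Z \<and> x' \<in> V \<and> z' \<in> Z \<and> x * z = x' * z'})\<^sup>2
    \<le> card Z ^ 3 * mult_energy V"
proof -
  have fin: "finite V" "finite Z" using V Z finite_S by (meson Diff_subset finite_subset order_trans)+
  have VS: "x \<in> S" "x \<noteq> 0" if "x \<in> V" for x using that V by auto
  have ZS: "z \<in> S" "z \<noteq> 0" if "z \<in> Z" for z using that Z by auto
  define N where "N = (\<lambda>(z, z'). {(x, x'). x \<in> V \<and> x' \<in> V \<and> x * z = x' * z'})"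
  have finN: "finite (N p)" for p
    using fin by (rule_tac finite_subset[of _ "V \<times> V"]) (auto simp: N_def)
  let ?C = "{((x, z), (x', z')). x \<in> V \<and> z \<in> Z \<and> x' \<in> V \<and> z' \<in> Z \<and> x * z = x' * z'}"
  let ?E = "{(a, c, x, z). a \<in> V \<and> c \<in> V \<and> x \<in> V \<and> z \<in> V \<and> c * x = a * z}"
  have "?C \<subseteq> (\<lambda>((z, z'), (x, x')). ((x, z), (x', z'))) ` Sigma (Z \<times> Z) N"
  proof clarify
    fix x z x' z' assume "x \<in> V" "z \<in> Z" "x' \<in> V" "z' \<in> Z" "x * z = x' * z'"
    then show "((x, z), (x', z')) \<in> (\<lambda>((z, z'), (x, x')). ((x, z), (x', z'))) ` Sigma (Z \<times> Z) N"
      by (intro image_eqI[of _ _ "((z, z'), (x, x'))"]) (auto simp: N_def)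
  qed
  then have "card ?C \<le> card (Sigma (Z \<times> Z) N)"
    using fin finN by (intro surj_card_le) auto
  also have "\<dots> = (\<Sum>p\<in>Z \<times> Z. card (N p))" using fin finN by (intro card_SigmaI) auto
  finally have "real (card ?C) \<le> real (\<Sum>p\<in>Z \<times> Z. card (N p))" by (simp only: of_nat_le_iff)
  then have C: "real (card ?C) \<le> (\<Sum>p\<in>Z \<times> Z. real (card (N p)))" by simp
  have "(\<Sum>p\<in>Z \<times> Z. (card (N p))\<^sup>2) = card (Sigma (Z \<times> Z) (\<lambda>p. N p \<times> N p))"
    using fin finN by (subst card_SigmaI) (auto simp: card_cartesian_product power2_eq_square)
  also have "\<dots> \<le> card (Z \<times> ?E)"
  proof (rule card_inj_on_le)
    let ?h = "\<lambda>((z, z'), ((x, x'), (y, y'))). (z, (x', x, y', y))"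
    show "inj_on ?h (Sigma (Z \<times> Z) (\<lambda>p. N p \<times> N p))"
    proof (rule inj_onI)
      fix r r' assume r: "r \<in> Sigma (Z \<times> Z) (\<lambda>p. N p \<times> N p)" "r' \<in> Sigma (Z \<times> Z) (\<lambda>p. N p \<times> N p)" "?h r = ?h r'"
      obtain z z' x x' y y' where r_eq: "r = ((z, z'), ((x, x'), (y, y')))" by (metis surj_pair)
      obtain w w' u u' v v' where r'_eq: "r' = ((w, w'), ((u, u'), (v, v')))" by (metis surj_pair)
      have eq: "w = z" "u = x" "u' = x'" "v = y" "v' = y'" using r(3) by (simp_all add: r_eq r'_eq)
      have *: "z \<in> Z" "z' \<in> Z" "w' \<in> Z" "x \<in> V" "x' \<in> V" "x * z = x' * z'" "x * z = x' * w'"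
        using r(1,2) by (simp_all add: r_eq r'_eq N_def eq)
      then have "x' * z' = x' * w'" by simp
      then have "z' = w'" using mult_cancel[of x' z' w'] * VS ZS by blast
      then show "r = r'" by (simp add: r_eq r'_eq eq)
    qed
    show "?h ` Sigma (Z \<times> Z) (\<lambda>p. N p \<times> N p) \<subseteq> Z \<times> ?E"
    proof (clarsimp simp: N_def)
      fix z z' x x' y y'
      assume *: "z \<in> Z" "z' \<in> Z" "x \<in> V" "x' \<in> V" "y \<in> V" "y' \<in> V" and eq: "x * z = x' * z'" "y * z = y' * z'"
      have "(z * z') * (x * y') = (x * z) * (y' * z')" by (simp add: mult_ac)
      also have "\<dots> = (x' * z') * (y * z)" by (simp only: eq)
      also have "\<dots> = (z * z') * (x' * y)" by (simp add: mult_ac)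
      finally have eq': "(z * z') * (x * y') = (z * z') * (x' * y)" .
      show "x * y' = x' * y"
      proof (rule mult_cancel[OF _ _ _ _ eq'])
        show "z * z' \<in> S" "x * y' \<in> S" "x' * y \<in> S" using * VS(1) ZS(1) by (simp_all add: mult_S)
        show "z * z' \<noteq> 0" using * ZS by (simp add: mult_nonzero)
      qed
    qed
    have "finite ?E"
      using fin by (rule_tac finite_subset[of _ "V \<times> V \<times> V \<times> V"]) auto
    then show "finite (Z \<times> ?E)" using fin by simp
  qed
  also have "\<dots> = card Z * mult_energy V" by (simp add: card_cartesian_product mult_energy_def)
  finally have "real (\<Sum>p\<in>Z \<times> Z. (card (N p))\<^sup>2) \<le> real (card Z * mult_energy V)" by (simp only: of_nat_le_iff)
  then have N2: "(\<Sum>p\<in>Z \<times> Z. (real (card (N p)))\<^sup>2) \<le> real (card Z * mult_energy V)" by simp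
  have "(real (card ?C))\<^sup>2 \<le> (\<Sum>p\<in>Z \<times> Z. real (card (N p)))\<^sup>2" using C by (intro power_mono) auto
  also have "\<dots> \<le> real (card (Z \<times> Z)) * (\<Sum>p\<in>Z \<times> Z. (real (card (N p)))\<^sup>2)"
    by (rule sum_square_le_card_times_sum_squares)
  also have "\<dots> \<le> real (card (Z \<times> Z)) * real (card Z * mult_energy V)"
    using N2 by (intro mult_left_mono) auto
  finally have "real ((card ?C)\<^sup>2) \<le> real (card Z ^ 3 * mult_energy V)"
    by (simp add: card_cartesian_product power3_eq_cube mult.assoc)
  then show ?thesis by (simp only: of_nat_le_iff)
qed

end

text \<open>
  An additive character is given through the orthogonality relation it is used for; this encodes that it is nontrivial.
\<close>

locale finite_field_character = finite_field_set S e for S :: "'a::comm_ring_1 set" and e +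
  fixes \<chi> :: "'a \<Rightarrow> complex"
  assumes chi_add: "x \<in> S \<Longrightarrow> y \<in> S \<Longrightarrow> \<chi> (x + y) = \<chi> x * \<chi> y"
    and chi_norm: "x \<in> S \<Longrightarrow> cmod (\<chi> x) = 1"
    and chi_sum: "w \<in> S \<Longrightarrow> w \<noteq> 0 \<Longrightarrow> (\<Sum>y\<in>S. \<chi> (w * y)) = 0"
begin

lemma chi_zero: "\<chi> 0 = 1"
proof -
  have "\<chi> 0 * \<chi> 0 = \<chi> 0" using chi_add[OF zero_S zero_S] by simp
  moreover have "\<chi> 0 \<noteq> 0" using chi_norm[OF zero_S] by auto
  ultimately show ?thesis by simp
qed

lemma chi_diff:
  assumes "x \<in> S" "y \<in> S"
  shows "\<chi> x * cnj (\<chi> y) = \<chi> (x - y)"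
proof -
  have "\<chi> y * cnj (\<chi> y) = 1" using chi_norm[OF assms(2)] by (simp add: complex_norm_square[symmetric])
  moreover have "\<chi> x = \<chi> (x - y) * \<chi> y" using chi_add[of "x - y" y] assms diff_S by simp
  ultimately show ?thesis by (simp add: mult.assoc)
qed

text \<open>
  Expanding the square, orthogonality leaves exactly the pairs with equal frequencies.
\<close>

lemma mean_square_le_collisions:
  assumes fin: "finite P" and \<phi>: "\<And>p. p \<in> P \<Longrightarrow> \<phi> p \<in> S" and w: "\<And>p. p \<in> P \<Longrightarrow> cmod (w p) \<le> 1"
  shows "(\<Sum>y\<in>S. (cmod (\<Sum>p\<in>P. w p * \<chi> (\<phi> p * y)))\<^sup>2)
    \<le> real (card S) * real (card {(p, p'). p \<in> P \<and> p' \<in> P \<and> \<phi> p = \<phi> p'})"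
proof -
  let ?C = "{(p, p'). p \<in> P \<and> p' \<in> P \<and> \<phi> p = \<phi> p'}"
  have orth: "(\<Sum>y\<in>S. \<chi> (w * y)) = (if w = 0 then of_nat (card S) else 0)" if "w \<in> S" for w
    using chi_sum[OF that] by (simp add: chi_zero)
  have "complex_of_real (\<Sum>y\<in>S. (cmod (\<Sum>p\<in>P. w p * \<chi> (\<phi> p * y)))\<^sup>2)
      = (\<Sum>y\<in>S. (\<Sum>p\<in>P. w p * \<chi> (\<phi> p * y)) * cnj (\<Sum>p\<in>P. w p * \<chi> (\<phi> p * y)))"
    unfolding of_real_sum by (intro sum.cong refl) (rule complex_norm_square)
  also have "\<dots> = (\<Sum>y\<in>S. \<Sum>p\<in>P. \<Sum>p'\<in>P. w p * cnj (w p') * \<chi> ((\<phi> p - \<phi> p') * y))"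
  proof (intro sum.cong refl)
    fix y assume y: "y \<in> S"
    have "(\<Sum>p\<in>P. w p * \<chi> (\<phi> p * y)) * cnj (\<Sum>p\<in>P. w p * \<chi> (\<phi> p * y))
        = (\<Sum>p\<in>P. \<Sum>p'\<in>P. (w p * \<chi> (\<phi> p * y)) * (cnj (w p') * cnj (\<chi> (\<phi> p' * y))))"
      by (simp add: sum_product)
    also have "\<dots> = (\<Sum>p\<in>P. \<Sum>p'\<in>P. w p * cnj (w p') * \<chi> ((\<phi> p - \<phi> p') * y))"
    proof (intro sum.cong refl)
      fix p p' assume "p \<in> P" "p' \<in> P"
      then have "\<chi> (\<phi> p * y) * cnj (\<chi> (\<phi> p' * y)) = \<chi> ((\<phi> p - \<phi> p') * y)"
        using chi_diff[of "\<phi> p * y" "\<phi> p' * y"] \<phi> y mult_S by (simp add: left_diff_distrib)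
      then show "(w p * \<chi> (\<phi> p * y)) * (cnj (w p') * cnj (\<chi> (\<phi> p' * y))) = w p * cnj (w p') * \<chi> ((\<phi> p - \<phi> p') * y)"
        by (simp add: mult_ac)
    qed
    finally show "(\<Sum>p\<in>P. w p * \<chi> (\<phi> p * y)) * cnj (\<Sum>p\<in>P. w p * \<chi> (\<phi> p * y))
        = (\<Sum>p\<in>P. \<Sum>p'\<in>P. w p * cnj (w p') * \<chi> ((\<phi> p - \<phi> p') * y))" .
  qed
  also have "\<dots> = (\<Sum>p\<in>P. \<Sum>p'\<in>P. \<Sum>y\<in>S. w p * cnj (w p') * \<chi> ((\<phi> p - \<phi> p') * y))"
    by (subst sum.swap) (intro sum.cong refl sum.swap)
  also have "\<dots> = (\<Sum>p\<in>P. \<Sum>p'\<in>P. w p * cnj (w p') * (if \<phi> p = \<phi> p' then of_nat (card S) else 0))"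
    using \<phi> diff_S by (intro sum.cong refl) (simp add: sum_distrib_left[symmetric] orth)
  also have "\<dots> = (\<Sum>(p, p')\<in>P \<times> P. w p * cnj (w p') * (if \<phi> p = \<phi> p' then of_nat (card S) else 0))"
    by (simp add: sum.cartesian_product)
  also have "\<dots> = (\<Sum>(p, p')\<in>?C. w p * cnj (w p') * of_nat (card S))"
    using fin by (intro sum.mono_neutral_cong_right) (auto split: if_splits)
  finally have eq: "complex_of_real (\<Sum>y\<in>S. (cmod (\<Sum>p\<in>P. w p * \<chi> (\<phi> p * y)))\<^sup>2)
      = (\<Sum>(p, p')\<in>?C. w p * cnj (w p') * of_nat (card S))" .
  have "(\<Sum>y\<in>S. (cmod (\<Sum>p\<in>P. w p * \<chi> (\<phi> p * y)))\<^sup>2)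
      = cmod (complex_of_real (\<Sum>y\<in>S. (cmod (\<Sum>p\<in>P. w p * \<chi> (\<phi> p * y)))\<^sup>2))"
    by (simp only: norm_of_real) (simp add: sum_nonneg)
  also have "\<dots> \<le> (\<Sum>(p, p')\<in>?C. cmod (w p * cnj (w p') * of_nat (card S)))"
    unfolding eq split_def by (rule norm_sum)
  also have "\<dots> \<le> (\<Sum>r\<in>?C. real (card S))"
  proof (rule sum_mono, clarify)
    fix p p' assume "p \<in> P" "p' \<in> P"
    then have "cmod (w p) * cmod (w p') \<le> 1" using w by (simp add: mult_le_one)
    then have "cmod (w p) * cmod (w p') * real (card S) \<le> 1 * real (card S)" by (intro mult_right_mono) auto
    then show "cmod (w p * cnj (w p') * of_nat (card S)) \<le> real (card S)" by (simp add: norm_mult)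
  qed
  also have "\<dots> = real (card S) * real (card ?C)" by simp
  finally show ?thesis .
qed

definition trisum :: "'a set \<Rightarrow> 'a set \<Rightarrow> 'a set \<Rightarrow> ('a \<Rightarrow> complex) \<Rightarrow> ('a \<Rightarrow> complex) \<Rightarrow> ('a \<Rightarrow> complex) \<Rightarrow> complex" where
  "trisum X Y Z \<alpha> \<beta> \<gamma> = (\<Sum>x\<in>X. \<Sum>y\<in>Y. \<Sum>z\<in>Z. \<alpha> x * \<beta> y * \<gamma> z * \<chi> (x * y * z))"

text \<open>
  For fixed z the fourth power mean over y in Y is extended to the whole field, where it counts additive
  quadruples of X: the square of the inner sum over x is a sum over pairs with frequencies x + x'.
\<close>

lemma trisum_le_additive_energy:
  assumes X: "X \<subseteq> S" and Y: "Y \<subseteq> S" and Z: "Z \<subseteq> S - {0}"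
    and \<alpha>: "\<And>x. x \<in> X \<Longrightarrow> cmod (\<alpha> x) \<le> 1" and \<beta>: "\<And>y. y \<in> Y \<Longrightarrow> cmod (\<beta> y) \<le> 1"
    and \<gamma>: "\<And>z. z \<in> Z \<Longrightarrow> cmod (\<gamma> z) \<le> 1"
  shows "cmod (trisum X Y Z \<alpha> \<beta> \<gamma>) ^ 4
    \<le> real (card S) * real (card Y)^3 * real (card Z)^4 * real (additive_energy X)"
proof -
  have fin: "finite X" "finite Y" "finite Z" using X Y Z finite_S finite_subset by (auto intro: finite_subset)
  define f where "f y = (\<Sum>x\<in>X. \<alpha> x * \<chi> (x * y))" for y
  have total: "(\<Sum>y\<in>S. cmod (f y) ^ 4) \<le> real (card S) * real (additive_energy X)"
  proof -
    let ?w = "\<lambda>p. \<alpha> (fst p) * \<alpha> (snd p)" and ?\<phi> = "\<lambda>p. fst p + snd p :: 'a"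
    have "f y * f y = (\<Sum>p\<in>X \<times> X. ?w p * \<chi> (?\<phi> p * y))" if "y \<in> S" for y
    proof -
      have "f y * f y = (\<Sum>x\<in>X. \<Sum>x'\<in>X. (\<alpha> x * \<chi> (x * y)) * (\<alpha> x' * \<chi> (x' * y)))"
        by (simp add: f_def sum_product)
      also have "\<dots> = (\<Sum>x\<in>X. \<Sum>x'\<in>X. \<alpha> x * \<alpha> x' * \<chi> ((x + x') * y))"
      proof (intro sum.cong refl)
        fix x x' assume "x \<in> X" "x' \<in> X"
        then have "\<chi> ((x + x') * y) = \<chi> (x * y) * \<chi> (x' * y)"
          using X that mult_S chi_add[of "x * y" "x' * y"] by (auto simp: distrib_right)
        then show "(\<alpha> x * \<chi> (x * y)) * (\<alpha> x' * \<chi> (x' * y)) = \<alpha> x * \<alpha> x' * \<chi> ((x + x') * y)"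
          by (simp add: mult_ac)
      qed
      finally show ?thesis by (simp add: sum.cartesian_product split_def)
    qed
    then have "(\<Sum>y\<in>S. cmod (f y) ^ 4) = (\<Sum>y\<in>S. (cmod (\<Sum>p\<in>X \<times> X. ?w p * \<chi> (?\<phi> p * y)))\<^sup>2)"
    proof (intro sum.cong refl)
      fix y assume y: "y \<in> S"
        and eq: "\<And>y. y \<in> S \<Longrightarrow> f y * f y = (\<Sum>p\<in>X \<times> X. ?w p * \<chi> (?\<phi> p * y))"
      show "cmod (f y) ^ 4 = (cmod (\<Sum>p\<in>X \<times> X. ?w p * \<chi> (?\<phi> p * y)))\<^sup>2"
        unfolding eq[OF y, symmetric] norm_mult by (simp add: power_numeral_reduce)
    qed
    also have "\<dots> \<le> real (card S) * real (card {(p, p'). p \<in> X \<times> X \<and> p' \<in> X \<times> X \<and> ?\<phi> p = ?\<phi> p'})"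
      using fin X \<alpha> add_S
      by (intro mean_square_le_collisions) (auto simp: norm_mult mult_le_one subset_iff)
    finally show ?thesis using additive_energy_collisions[OF fin(1)] by simp
  qed
  define g where "g z = (\<Sum>y\<in>Y. cmod (f (y * z)))" for z
  have "trisum X Y Z \<alpha> \<beta> \<gamma> = (\<Sum>z\<in>Z. \<Sum>y\<in>Y. \<gamma> z * \<beta> y * f (y * z))"
  proof -
    have "trisum X Y Z \<alpha> \<beta> \<gamma> = (\<Sum>x\<in>X. \<Sum>z\<in>Z. \<Sum>y\<in>Y. \<alpha> x * \<beta> y * \<gamma> z * \<chi> (x * y * z))"
      unfolding trisum_def by (intro sum.cong refl sum.swap)
    also have "\<dots> = (\<Sum>z\<in>Z. \<Sum>x\<in>X. \<Sum>y\<in>Y. \<alpha> x * \<beta> y * \<gamma> z * \<chi> (x * y * z))"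
      by (rule sum.swap)
    also have "\<dots> = (\<Sum>z\<in>Z. \<Sum>y\<in>Y. \<Sum>x\<in>X. \<alpha> x * \<beta> y * \<gamma> z * \<chi> (x * y * z))"
      by (intro sum.cong refl sum.swap)
    also have "\<dots> = (\<Sum>z\<in>Z. \<Sum>y\<in>Y. \<gamma> z * \<beta> y * f (y * z))"
      by (intro sum.cong refl) (simp add: f_def sum_distrib_left mult_ac)
    finally show ?thesis .
  qed
  then have "cmod (trisum X Y Z \<alpha> \<beta> \<gamma>) \<le> (\<Sum>z\<in>Z. \<Sum>y\<in>Y. cmod (\<gamma> z * \<beta> y * f (y * z)))"
    by (simp only:) (intro order_trans[OF norm_sum] sum_mono norm_sum)
  also have "\<dots> \<le> (\<Sum>z\<in>Z. g z)"
    unfolding g_def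
  proof (intro sum_mono)
    fix z y assume "z \<in> Z" "y \<in> Y"
    then have "cmod (\<gamma> z) * cmod (\<beta> y) \<le> 1" using \<beta> \<gamma> by (simp add: mult_le_one)
    then have "cmod (\<gamma> z) * cmod (\<beta> y) * cmod (f (y * z)) \<le> 1 * cmod (f (y * z))"
      by (intro mult_right_mono) auto
    then show "cmod (\<gamma> z * \<beta> y * f (y * z)) \<le> cmod (f (y * z))" by (simp add: norm_mult)
  qed
  finally have "cmod (trisum X Y Z \<alpha> \<beta> \<gamma>) ^ 4 \<le> (\<Sum>z\<in>Z. g z) ^ 4" by (intro power_mono) auto
  also have "\<dots> \<le> real (card Z)^3 * (\<Sum>z\<in>Z. (g z)^4)" by (rule sum_power4_le)
  also have "\<dots> \<le> real (card Z)^3 * (\<Sum>z\<in>Z. real (card Y)^3 * (real (card S) * real (additive_energy X)))"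
  proof (intro mult_left_mono sum_mono)
    fix z assume z: "z \<in> Z"
    have "(g z)^4 \<le> real (card Y)^3 * (\<Sum>y\<in>Y. cmod (f (y * z))^4)"
      unfolding g_def by (rule sum_power4_le)
    also have "(\<Sum>y\<in>Y. cmod (f (y * z))^4) = (\<Sum>w\<in>(*) z ` Y. cmod (f w)^4)"
      using z Z Y inj_on_dilate[of z Y] by (subst sum.reindex) (auto simp: mult.commute)
    also have "\<dots> \<le> (\<Sum>w\<in>S. cmod (f w)^4)"
      using z Z Y mult_S by (intro sum_mono2 finite_S) auto
    also have "\<dots> \<le> real (card S) * real (additive_energy X)" by (rule total)
    finally show "(g z)^4 \<le> real (card Y)^3 * (real (card S) * real (additive_energy X))"
      by (simp add: mult_left_mono)
  qed auto
  finally show ?thesis by (simp add: power_numeral_reduce mult_ac)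
qed

text \<open>
  The sum over y is extended to the whole field; the frequencies are the products x z.
\<close>

lemma trisum_le_mult_energy:
  assumes V: "V \<subseteq> S - {0}" and Y: "Y \<subseteq> S" and Z: "Z \<subseteq> S - {0}"
    and \<alpha>: "\<And>x. x \<in> V \<Longrightarrow> cmod (\<alpha> x) \<le> 1" and \<beta>: "\<And>y. y \<in> Y \<Longrightarrow> cmod (\<beta> y) \<le> 1"
    and \<gamma>: "\<And>z. z \<in> Z \<Longrightarrow> cmod (\<gamma> z) \<le> 1"
  shows "cmod (trisum V Y Z \<alpha> \<beta> \<gamma>) ^ 4
    \<le> (real (card S))\<^sup>2 * (real (card Y))\<^sup>2 * real (card Z)^3 * real (mult_energy V)"
proof -
  have fin: "finite V" "finite Y" "finite Z" using V Y Z finite_S finite_subset by (auto intro: finite_subset)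
  define C where "C = card {((x, z), (x', z')). x \<in> V \<and> z \<in> Z \<and> x' \<in> V \<and> z' \<in> Z \<and> x * z = x' * z'}"
  let ?w = "\<lambda>p. \<alpha> (fst p) * \<gamma> (snd p)" and ?\<phi> = "\<lambda>p. fst p * snd p :: 'a"
  define f where "f y = (\<Sum>p\<in>V \<times> Z. ?w p * \<chi> (?\<phi> p * y))" for y
  have "trisum V Y Z \<alpha> \<beta> \<gamma> = (\<Sum>y\<in>Y. \<beta> y * f y)"
  proof -
    have "trisum V Y Z \<alpha> \<beta> \<gamma> = (\<Sum>y\<in>Y. \<Sum>x\<in>V. \<Sum>z\<in>Z. \<alpha> x * \<beta> y * \<gamma> z * \<chi> (x * y * z))"
      unfolding trisum_def by (rule sum.swap)
    also have "\<dots> = (\<Sum>y\<in>Y. \<Sum>p\<in>V \<times> Z. \<beta> y * (?w p * \<chi> (?\<phi> p * y)))"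
      by (simp add: sum.cartesian_product split_def mult_ac)
    finally show ?thesis by (simp add: f_def sum_distrib_left)
  qed
  then have "cmod (trisum V Y Z \<alpha> \<beta> \<gamma>) \<le> (\<Sum>y\<in>Y. cmod (\<beta> y * f y))" by (simp add: norm_sum)
  also have "\<dots> \<le> (\<Sum>y\<in>Y. cmod (f y))"
    using \<beta> by (intro sum_mono) (simp add: norm_mult mult_left_le_one_le)
  finally have "(cmod (trisum V Y Z \<alpha> \<beta> \<gamma>))\<^sup>2 \<le> (\<Sum>y\<in>Y. cmod (f y))\<^sup>2" by (intro power_mono) auto
  also have "\<dots> \<le> real (card Y) * (\<Sum>y\<in>Y. (cmod (f y))\<^sup>2)" by (rule sum_square_le_card_times_sum_squares)
  also have "\<dots> \<le> real (card Y) * (\<Sum>y\<in>S. (cmod (f y))\<^sup>2)"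
    using Y by (intro mult_left_mono sum_mono2 finite_S) auto
  also have "\<dots> \<le> real (card Y) * (real (card S) * real (card {(p, p'). p \<in> V \<times> Z \<and> p' \<in> V \<times> Z \<and> ?\<phi> p = ?\<phi> p'}))"
    unfolding f_def using fin V Z \<alpha> \<gamma> mult_S
    by (intro mult_left_mono mean_square_le_collisions) (auto simp: norm_mult mult_le_one subset_iff)
  also have "{(p, p'). p \<in> V \<times> Z \<and> p' \<in> V \<times> Z \<and> ?\<phi> p = ?\<phi> p'}
      = {((x, z), (x', z')). x \<in> V \<and> z \<in> Z \<and> x' \<in> V \<and> z' \<in> Z \<and> x * z = x' * z'}" by auto
  finally have "(cmod (trisum V Y Z \<alpha> \<beta> \<gamma>))\<^sup>2 \<le> real (card Y) * (real (card S) * real C)" by (simp add: C_def)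
  then have "((cmod (trisum V Y Z \<alpha> \<beta> \<gamma>))\<^sup>2)\<^sup>2 \<le> (real (card Y) * (real (card S) * real C))\<^sup>2"
    by (intro power_mono) auto
  also have "\<dots> = (real (card S))\<^sup>2 * (real (card Y))\<^sup>2 * real (C\<^sup>2)" by (simp add: power_mult_distrib)
  also have "\<dots> \<le> (real (card S))\<^sup>2 * (real (card Y))\<^sup>2 * real (card Z ^ 3 * mult_energy V)"
    using bilinear_collisions_le_mult_energy[OF V Z] unfolding C_def
    by (intro mult_left_mono of_nat_mono) auto
  finally show ?thesis by (simp add: mult.assoc)
qed

end

section \<open>Decomposition of X\<close>

context finite_field_set
begin

text \<open>
  If V from the Balog-Szemeredi-Gowers theorem had larger energy than claimed, one of the three alternatives of
  mult_energy_bound would hold with M about n \<Delta> u/|V|.  Since |V| is at least about \<delta> n, each of them gives an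
  inequality in which \<tau> and \<delta> occur only as \<tau>^28/\<delta>^25, \<tau>^28/\<delta>^24 or \<tau>^24/\<delta>^24, and \<tau> is at most about \<Delta> \<delta>
  up to a logarithm.  This contradicts one of the three conditions on \<Delta>.  The
  number 2^208 dominates the accumulated constant 6^6 16 2^141 24^4 2^28, and l + 1 enters with the power 8 from M
  and 28 from the bound for \<tau>.
\<close>

lemma structured_subset_small_mult_energy:
  fixes n \<Delta> u \<kappa> \<Lambda> :: real
  assumes X: "X \<subseteq> S - {0}" and n: "real (card X) \<le> n" "0 < n" "n \<le> 2 ^ l"
    and \<Delta>: "0 < \<Delta>" "n^3 \<le> \<Delta> * real (additive_energy X)" and u: "0 < u" and \<kappa>: "1 \<le> \<kappa>"
    and small: "\<And>G c. subfield_set G \<Longrightarrow> G \<noteq> S \<Longrightarrow> c \<in> S \<Longrightarrow> real (card (X \<inter> (*) c ` G)) \<le> \<kappa> * sqrt (real (card G))"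
    and \<Lambda>: "\<Lambda> = 2^208 * \<kappa>\<^sup>2 * (real l + 1)^36"
    and cond: "\<Lambda> * \<Delta>^32 * u^4 < n" "\<Lambda> * \<Delta>^32 * u^4 * n < real (card S)" "\<Lambda> * \<Delta>^29 * u^5 < n"
  obtains V where "V \<subseteq> X" "V \<noteq> {}" "real (mult_energy V) * (n * \<Delta> * u) \<le> real (card V)^4"
proof -
  have finX: "finite X" using X finite_S by (meson Diff_subset finite_subset order_trans)
  obtain V \<delta> \<tau> where V: "V \<subseteq> X" and \<delta>: "0 < \<delta>" "\<delta> \<le> 1" and \<tau>: "1 \<le> \<tau>" "\<tau> \<le> 2 * (real l + 1) * \<Delta> * \<delta>"
    and v_low: "\<delta> * n / 6 \<le> real (card V)"
    and diff: "real (card (V + uminus ` V)) \<le> 2^19 * \<tau>^4 / \<delta> * n"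
    and four: "real (card (V + V + uminus ` (V + V))) \<le> 2^65 * \<tau>^12 / \<delta>^11 * n"
    by (rule balog_szemeredi_gowers[OF finX n \<Delta>(2,1)])
  define v where "v = real (card V)"
  define lam where "lam = real l + 1"
  have lam: "1 \<le> lam" by (simp add: lam_def)
  have "0 < \<delta> * n / 6" using \<delta> n by simp
  then have v0: "0 < v" using v_low unfolding v_def by linarith
  have Vne: "V \<noteq> {}" using v0 by (auto simp: v_def)
  have vn: "v \<le> n" using V finX n card_mono[of X V] by (simp add: v_def)
  have nv: "n \<le> 6 * v / \<delta>" using v_low \<delta> by (simp add: v_def field_simps)
  define K where "K = 6 * 2^19 * \<tau>^4 / \<delta>\<^sup>2"
  define F where "F = 6 * 2^65 * \<tau>^12 / \<delta>^12"
  have \<delta>p: "0 < \<delta>^k" "\<delta>^k \<le> 1" for k using \<delta> by (auto simp: power_le_one)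
  have \<tau>p: "1 \<le> \<tau>^k" for k using \<tau> by simp
  have K: "real (card (V + uminus ` V)) \<le> K * v" "1 \<le> K"
  proof -
    have "2^19 * \<tau>^4 / \<delta> * n \<le> 2^19 * \<tau>^4 / \<delta> * (6 * v / \<delta>)"
      using nv \<tau> \<delta> by (intro mult_left_mono) auto
    also have "\<dots> = K * v" by (simp add: K_def power2_eq_square)
    finally show "real (card (V + uminus ` V)) \<le> K * v" using diff by linarith
    have "\<delta>\<^sup>2 \<le> 6 * 2^19 * \<tau>^4" using \<delta>p(2)[of 2] \<tau>p[of 4] by simp
    then show "1 \<le> K" using \<delta>p(1)[of 2] by (simp add: K_def)
  qed
  have F: "real (card (V + V + uminus ` (V + V))) \<le> F * v" "1 \<le> F"
  proof -
    have "2^65 * \<tau>^12 / \<delta>^11 * n \<le> 2^65 * \<tau>^12 / \<delta>^11 * (6 * v / \<delta>)"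
      using nv \<tau> \<delta> by (intro mult_left_mono) auto
    also have "\<dots> = F * v" using power_Suc2[of \<delta> 11] by (simp add: F_def)
    finally show "real (card (V + V + uminus ` (V + V))) \<le> F * v" using four by linarith
    have "\<delta>^12 \<le> 6 * 2^65 * \<tau>^12" using \<delta>p(2)[of 12] \<tau>p[of 12] by simp
    then show "1 \<le> F" using \<delta>p(1)[of 12] by (simp add: F_def)
  qed
  show thesis
  proof (cases "real (mult_energy V) * (n * \<Delta> * u) \<le> v^4")
    case True
    then show thesis using that[of V] V Vne by (simp add: v_def)
  next
    case False
    define M where "M = 4 * lam\<^sup>2 * (n * \<Delta> * u / v)"
    have M0: "0 < M" using lam n \<Delta> u v0 by (simp add: M_def)
    define m where "m = 24 * lam\<^sup>2 * \<Delta> * u"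
    have m0: "0 < m" using lam \<Delta> u by (simp add: m_def)
    have Mm: "M \<le> m / \<delta>"
    proof -
      have "n / v \<le> 6 / \<delta>" using nv v0 \<delta> by (simp add: field_simps)
      then have "4 * lam\<^sup>2 * \<Delta> * u * (n / v) \<le> 4 * lam\<^sup>2 * \<Delta> * u * (6 / \<delta>)"
        using \<Delta> u by (intro mult_left_mono) auto
      then show ?thesis by (simp add: M_def m_def mult_ac)
    qed
    have energy: "4 * (real l + 1)\<^sup>2 * real (card V)^3 \<le> M * real (mult_energy V)"
    proof -
      have "v^3 * v \<le> real (mult_energy V) * (n * \<Delta> * u)" using False by (simp add: power_numeral_reduce mult_ac)
      then have "v^3 \<le> real (mult_energy V) * (n * \<Delta> * u) / v" using v0 by (simp add: le_divide_eq)
      then have "4 * lam\<^sup>2 * v^3 \<le> 4 * lam\<^sup>2 * (real (mult_energy V) * (n * \<Delta> * u) / v)"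
        by (intro mult_left_mono) auto
      then show ?thesis by (simp add: M_def v_def lam_def mult_ac)
    qed
    have l: "card V \<le> 2 ^ l"
    proof -
      have "real (card V) \<le> 2 ^ l" using vn n(3) unfolding v_def by linarith
      then show ?thesis by (metis of_nat_le_iff of_nat_numeral of_nat_power)
    qed
    have smallV: "real (card (V \<inter> (*) c ` G)) \<le> \<kappa> * sqrt (real (card G))"
      if "subfield_set G" "G \<noteq> S" "c \<in> S" for G c
    proof -
      have "card (V \<inter> (*) c ` G) \<le> card (X \<inter> (*) c ` G)" using V finX by (intro card_mono) auto
      then show ?thesis using small[OF that] by linarith
    qed
    define s where "s = 2 * lam * \<Delta>"
    have s0: "0 < s" using lam \<Delta> by (simp add: s_def)
    have \<tau>s: "\<tau> \<le> s * \<delta>" using \<tau>(2) by (simp add: s_def lam_def)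
    have \<tau>_pow: "\<tau>^k / \<delta>^j \<le> s^k" if "j \<le> k" for j k
    proof -
      have "\<tau>^k \<le> (s * \<delta>)^k" using \<tau> \<tau>s by (intro power_mono) auto
      also have "\<dots> = s^k * \<delta>^k" by (rule power_mult_distrib)
      also have "\<dots> \<le> s^k * \<delta>^j" using that \<delta> s0 by (intro mult_left_mono power_decreasing) auto
      finally show ?thesis using \<delta>p(1)[of j] by (simp add: divide_le_eq)
    qed
    have Mpow: "M^k \<le> m^k / \<delta>^k" for k
      using power_mono[OF Mm, of k] M0 by (simp add: power_divide)
    have K4: "K^4 = 6^4 * 2^76 * \<tau>^16 / \<delta>^8" "K^3 = 6^3 * 2^57 * \<tau>^12 / \<delta>^6"
      by (simp_all add: K_def power_divide power_mult_distrib flip: power_mult)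
    have pow4: "K^4 * F * M^4 \<le> 6^5 * 2^141 * m^4 * (\<tau>^28 / \<delta>^24)"
    proof -
      have "K^4 * F * M^4 \<le> K^4 * F * (m^4 / \<delta>^4)"
        using Mpow[of 4] K F by (intro mult_left_mono) auto
      also have "\<dots> = (6^4 * 2^76 * 6 * 2^65) * m^4 * ((\<tau>^16 * \<tau>^12) / (\<delta>^8 * \<delta>^12 * \<delta>^4))"
        unfolding K4 F_def by simp
      also have "\<tau>^16 * \<tau>^12 = \<tau>^28" by (simp flip: power_add)
      also have "\<delta>^8 * \<delta>^12 * \<delta>^4 = \<delta>^24" by (simp flip: power_add)
      finally show ?thesis by simp
    qed
    have pow5: "K^3 * F * M^5 \<le> 6^4 * 2^122 * m^5 * (\<tau>^24 / \<delta>^23)"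
    proof -
      have "K^3 * F * M^5 \<le> K^3 * F * (m^5 / \<delta>^5)"
        using Mpow[of 5] K F by (intro mult_left_mono) auto
      also have "\<dots> = (6^3 * 2^57 * 6 * 2^65) * m^5 * ((\<tau>^12 * \<tau>^12) / (\<delta>^6 * \<delta>^12 * \<delta>^5))"
        unfolding K4 F_def by simp
      also have "\<tau>^12 * \<tau>^12 = \<tau>^24" by (simp flip: power_add)
      also have "\<delta>^6 * \<delta>^12 * \<delta>^5 = \<delta>^23" by (simp flip: power_add)
      finally show ?thesis by simp
    qed
    have m4: "m^4 = 24^4 * lam^8 * \<Delta>^4 * u^4" "m^5 = 24^5 * lam^10 * \<Delta>^5 * u^5"
      by (simp_all add: m_def power_mult_distrib flip: power_mult)
    have lam36: "lam^34 \<le> lam^36" using lam by (intro power_increasing) auto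
    have \<kappa>2: "1 \<le> \<kappa>\<^sup>2" using \<kappa> by simp
    have main: "K^4 * F * M^4 / \<delta> \<le> 2^201 * lam^36 * \<Delta>^32 * u^4"
    proof -
      have "K^4 * F * M^4 / \<delta> \<le> 6^5 * 2^141 * m^4 * (\<tau>^28 / \<delta>^24) / \<delta>"
        using pow4 \<delta> by (intro divide_right_mono) auto
      also have "\<dots> = 6^5 * 2^141 * m^4 * (\<tau>^28 / \<delta>^25)" using power_Suc2[of \<delta> 24] by simp
      also have "\<dots> \<le> 6^5 * 2^141 * m^4 * s^28" using \<tau>_pow[of 25 28] m0 by (intro mult_left_mono) auto
      also have "\<dots> = (6^5 * 2^141 * 24^4 * 2^28) * (lam^8 * lam^28) * (\<Delta>^4 * \<Delta>^28) * u^4"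
        by (simp only: m4 s_def power_mult_distrib mult_ac)
      also have "lam^8 * lam^28 = lam^36" by (simp flip: power_add)
      also have "\<Delta>^4 * \<Delta>^28 = \<Delta>^32" by (simp flip: power_add)
      also have "(6^5 * 2^141 * 24^4 * 2^28) * lam^36 * \<Delta>^32 * u^4 \<le> 2^201 * lam^36 * \<Delta>^32 * u^4"
        using lam \<Delta> u by (intro mult_right_mono) auto
      finally show ?thesis .
    qed
    have main0: "0 \<le> K^4 * F * M^4" using K F M0 by simp
    have main1: "K^4 * F * M^4 \<le> 2^201 * lam^36 * \<Delta>^32 * u^4"
    proof -
      have "K^4 * F * M^4 * 1 \<le> K^4 * F * M^4 * (1 / \<delta>)"
        using main0 \<delta> by (intro mult_left_mono) auto
      then show ?thesis using main by simp
    qed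
    have from1: False if "v \<le> 16 * \<kappa>\<^sup>2 * K^4 * F * M^4"
    proof -
      have "n \<le> 6 * v / \<delta>" by (rule nv)
      also have "\<dots> \<le> 6 * (16 * \<kappa>\<^sup>2 * K^4 * F * M^4) / \<delta>"
        by (intro divide_right_mono mult_left_mono that) (use \<delta> in auto)
      also have "\<dots> = 96 * \<kappa>\<^sup>2 * (K^4 * F * M^4 / \<delta>)" by simp
      also have "\<dots> \<le> 96 * \<kappa>\<^sup>2 * (2^201 * lam^36 * \<Delta>^32 * u^4)" using main by (intro mult_left_mono) auto
      also have "\<dots> = (96 * 2^201) * (\<kappa>\<^sup>2 * lam^36 * \<Delta>^32 * u^4)" by simp
      also have "\<dots> \<le> 2^208 * (\<kappa>\<^sup>2 * lam^36 * \<Delta>^32 * u^4)" using lam \<Delta> u by (intro mult_right_mono) auto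
      also have "\<dots> = \<Lambda> * \<Delta>^32 * u^4" by (simp add: \<Lambda> lam_def)
      finally show ?thesis using cond(1) by linarith
    qed
    have from2: False if "real (card S) \<le> 64 * K^4 * F * M^4 * v"
    proof -
      have "real (card S) \<le> 64 * K^4 * F * M^4 * v" by (rule that)
      also have "\<dots> = 64 * (K^4 * F * M^4) * v" by simp
      also have "\<dots> \<le> 64 * (2^201 * lam^36 * \<Delta>^32 * u^4) * n"
        by (rule mult_mono[OF mult_left_mono[OF main1] vn]) (use v0 lam \<Delta> u in auto)
      also have "\<dots> = (64 * 2^201) * (1 * (lam^36 * \<Delta>^32 * u^4 * n))" by simp
      also have "\<dots> \<le> 2^208 * (\<kappa>\<^sup>2 * (lam^36 * \<Delta>^32 * u^4 * n))"
        using lam \<Delta> u n \<kappa>2 by (intro mult_mono) auto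
      also have "\<dots> = \<Lambda> * \<Delta>^32 * u^4 * n" by (simp add: \<Lambda> lam_def)
      finally show ?thesis using cond(2) by linarith
    qed
    have from3: False if "v \<le> 8 * K^3 * F * M^5"
    proof -
      have v8: "v \<le> 8 * (6^4 * 2^122 * m^5 * (\<tau>^24 / \<delta>^23))"
        using that mult_left_mono[OF pow5, of 8] unfolding mult.assoc by linarith
      have "n \<le> 6 * v / \<delta>" by (rule nv)
      also have "\<dots> \<le> 6 * (8 * (6^4 * 2^122 * m^5 * (\<tau>^24 / \<delta>^23))) / \<delta>"
        by (intro divide_right_mono mult_left_mono v8) (use \<delta> in auto)
      also have "\<dots> = 48 * 6^4 * 2^122 * m^5 * (\<tau>^24 / \<delta>^24)" using power_Suc2[of \<delta> 23] by simp
      also have "\<dots> \<le> 48 * 6^4 * 2^122 * m^5 * s^24" using \<tau>_pow[of 24 24] m0 by (intro mult_left_mono) auto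
      also have "\<dots> = (48 * 6^4 * 2^122 * 24^5 * 2^24) * (lam^10 * lam^24) * (\<Delta>^5 * \<Delta>^24) * u^5"
        by (simp only: m4 s_def power_mult_distrib mult_ac)
      also have "lam^10 * lam^24 = lam^34" by (simp flip: power_add)
      also have "\<Delta>^5 * \<Delta>^24 = \<Delta>^29" by (simp flip: power_add)
      also have "(48 * 6^4 * 2^122 * 24^5 * 2^24) * lam^34 * \<Delta>^29 * u^5 \<le> (2^208 * \<kappa>\<^sup>2) * lam^36 * \<Delta>^29 * u^5"
      proof (rule mult_right_mono[OF mult_right_mono[OF mult_mono[OF _ lam36]]])
        have "(2::real)^208 * 1 \<le> 2^208 * \<kappa>\<^sup>2" using \<kappa>2 by (intro mult_left_mono) auto
        then show "(48 * 6^4 * 2^122 * 24^5 * 2^24::real) \<le> 2^208 * \<kappa>\<^sup>2" by simp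
      qed (use lam \<Delta> u in auto)
      also have "\<dots> = \<Lambda> * \<Delta>^29 * u^5" by (simp add: \<Lambda> lam_def)
      finally show ?thesis using cond(3) by linarith
    qed
    have "V \<subseteq> S - {0}" using V X by auto
    from mult_energy_bound[OF this Vne l K(1)[unfolded v_def] K(2) F(1)[unfolded v_def] F(2) \<kappa> smallV energy M0]
    show thesis using from1 from2 from3 by (auto simp: v_def)
  qed
qed

end

context finite_field_character
begin

lemma trisum_union:
  assumes "finite A" "finite B" "A \<inter> B = {}"
  shows "trisum (A \<union> B) Y Z \<alpha> \<beta> \<gamma> = trisum A Y Z \<alpha> \<beta> \<gamma> + trisum B Y Z \<alpha> \<beta> \<gamma>"
  unfolding trisum_def using assms by (rule sum.union_disjoint)

text \<open>
  H is chosen so that both energy estimates give the same bound: the structured pieces V contribute at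
  most |V| H each, the unstructured rest at most n H.
\<close>

lemma trisum_decomposition_bound:
  fixes n \<Delta> u \<kappa> \<Lambda> H :: real
  assumes X: "X \<subseteq> S - {0}" and n: "real (card X) \<le> n" "0 < n" "n \<le> 2 ^ l"
    and Y: "Y \<subseteq> S" and Z: "Z \<subseteq> S - {0}" "Z \<noteq> {}" "card Z \<le> card Y"
    and \<alpha>: "\<And>x. x \<in> X \<Longrightarrow> cmod (\<alpha> x) \<le> 1" and \<beta>: "\<And>y. y \<in> Y \<Longrightarrow> cmod (\<beta> y) \<le> 1"
    and \<gamma>: "\<And>z. z \<in> Z \<Longrightarrow> cmod (\<gamma> z) \<le> 1"
    and \<Delta>: "0 < \<Delta>" and u: "u = real (card S) / (real (card Z))\<^sup>2" and \<kappa>: "1 \<le> \<kappa>"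
    and small: "\<And>G c. subfield_set G \<Longrightarrow> G \<noteq> S \<Longrightarrow> c \<in> S \<Longrightarrow> real (card (X \<inter> (*) c ` G)) \<le> \<kappa> * sqrt (real (card G))"
    and \<Lambda>: "\<Lambda> = 2^208 * \<kappa>\<^sup>2 * (real l + 1)^36"
    and cond: "\<Lambda> * \<Delta>^32 * u^4 < n" "\<Lambda> * \<Delta>^32 * u^4 * n < real (card S)" "\<Lambda> * \<Delta>^29 * u^5 < n"
    and H: "0 \<le> H" "H^4 = real (card Y)^3 * real (card S) * real (card Z)^4 / (n * \<Delta>)"
  shows "cmod (trisum X Y Z \<alpha> \<beta> \<gamma>) \<le> 2 * n * H"
proof -
  define q where "q = real (card S)"
  define y where "y = real (card Y)"
  define z where "z = real (card Z)"
  have finZ: "finite Z" using Z finite_S by (meson Diff_subset finite_subset order_trans)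
  have z0: "0 < z" "z \<le> y" using Z finZ by (auto simp: z_def y_def card_gt_0_iff)
  have q0: "0 < q" using zero_S finite_S by (auto simp: q_def card_gt_0_iff)
  have u0: "0 < u" using q0 z0 by (simp add: u q_def z_def)
  have step: "cmod (trisum W Y Z \<alpha> \<beta> \<gamma>) \<le> (real (card W) + n) * H" if "W \<subseteq> X" for W
    using that
  proof (induction "card W" arbitrary: W rule: less_induct)
    case less
    have finX: "finite X" using X finite_S by (meson Diff_subset finite_subset order_trans)
    have W: "W \<subseteq> S - {0}" "finite W" using less.prems X finX finite_subset by auto
    have Wn: "real (card W) \<le> n" using card_mono[OF finX less.prems] n by linarith
    have \<alpha>W: "\<And>x. x \<in> W \<Longrightarrow> cmod (\<alpha> x) \<le> 1" using \<alpha> less.prems by auto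
    show ?case
    proof (cases "n^3 \<le> \<Delta> * real (additive_energy W)")
      case False
      have "cmod (trisum W Y Z \<alpha> \<beta> \<gamma>) ^ 4 \<le> q * y^3 * z^4 * real (additive_energy W)"
        unfolding q_def y_def z_def using W Y Z \<alpha>W \<beta> \<gamma> by (intro trisum_le_additive_energy) auto
      also have "\<dots> \<le> q * y^3 * z^4 * (n^3 / \<Delta>)"
        using False \<Delta> q0 z0 by (intro mult_left_mono) (auto simp: le_divide_eq mult_ac)
      also have "\<dots> = (n * H)^4"
        using n unfolding power_mult_distrib H(2) q_def y_def z_def by (simp add: power_numeral_reduce)
      finally have "cmod (trisum W Y Z \<alpha> \<beta> \<gamma>) \<le> n * H"
        using n H by (subst (asm) power_mono_iff) auto
      also have "\<dots> \<le> (real (card W) + n) * H" using H by (intro mult_right_mono) auto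
      finally show ?thesis .
    next
      case True
      have smallW: "real (card (W \<inter> (*) c ` G)) \<le> \<kappa> * sqrt (real (card G))"
        if "subfield_set G" "G \<noteq> S" "c \<in> S" for G c
      proof -
        have "card (W \<inter> (*) c ` G) \<le> card (X \<inter> (*) c ` G)" using less.prems finX by (intro card_mono) auto
        then show ?thesis using small[OF that] by linarith
      qed
      obtain V where V: "V \<subseteq> W" "V \<noteq> {}" "real (mult_energy V) * (n * \<Delta> * u) \<le> real (card V)^4"
        by (rule structured_subset_small_mult_energy[OF W(1) Wn n(2,3) \<Delta> True u0 \<kappa> smallW \<Lambda> cond])
      define v where "v = real (card V)"
      have finV: "finite V" using V W finite_subset by blast
      have "cmod (trisum V Y Z \<alpha> \<beta> \<gamma>) ^ 4 \<le> q\<^sup>2 * y\<^sup>2 * z^3 * real (mult_energy V)"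
        unfolding q_def y_def z_def using V W Y Z \<alpha>W \<beta> \<gamma> by (intro trisum_le_mult_energy) auto
      also have "\<dots> \<le> q\<^sup>2 * y\<^sup>2 * z^3 * (v^4 / (n * \<Delta> * u))"
        using V(3) n \<Delta> u0 q0 z0 by (intro mult_left_mono) (auto simp: le_divide_eq v_def)
      also have "\<dots> = q * (y\<^sup>2 * z) * (z^4 * v^4 / (n * \<Delta>))"
        using q0 z0 by (simp add: u q_def[symmetric] z_def[symmetric] power_numeral_reduce)
      also have "\<dots> \<le> q * (y\<^sup>2 * y) * (z^4 * v^4 / (n * \<Delta>))"
        using q0 z0 n \<Delta> by (intro mult_right_mono mult_left_mono) auto
      also have "\<dots> = (v * H)^4"
        unfolding power_mult_distrib H(2) q_def y_def z_def by (simp add: power_numeral_reduce)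
      finally have "cmod (trisum V Y Z \<alpha> \<beta> \<gamma>) \<le> v * H"
        using H by (subst (asm) power_mono_iff) (auto simp: v_def)
      moreover have "cmod (trisum (W - V) Y Z \<alpha> \<beta> \<gamma>) \<le> (real (card (W - V)) + n) * H"
        using V W less.prems by (intro less.hyps psubset_card_mono) auto
      moreover have "trisum W Y Z \<alpha> \<beta> \<gamma> = trisum V Y Z \<alpha> \<beta> \<gamma> + trisum (W - V) Y Z \<alpha> \<beta> \<gamma>"
        using trisum_union[of V "W - V"] V W finV by (simp add: Un_absorb1)
      moreover have "real (card W) = v + real (card (W - V))"
        using card_Diff_subset[OF finV V(1)] card_mono[OF W(2) V(1)] by (simp add: v_def)
      ultimately show ?thesis
        using norm_triangle_ineq[of "trisum V Y Z \<alpha> \<beta> \<gamma>" "trisum (W - V) Y Z \<alpha> \<beta> \<gamma>"]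
        by (simp add: algebra_simps)
    qed
  qed
  have "cmod (trisum X Y Z \<alpha> \<beta> \<gamma>) \<le> (real (card X) + n) * H" by (rule step) simp
  also have "\<dots> \<le> (n + n) * H" using n H by (intro mult_right_mono) auto
  finally show ?thesis by simp
qed

end

section \<open>The exponents\<close>

text \<open>
  The fourth root of q y^3 z^4 n^3/D for the three values of D at which one of the conditions on D becomes an equality.
\<close>

lemma exponent_balance:
  fixes n q y z L :: real
  assumes pos: "0 < n" "0 < q" "0 < y" "0 < z" "0 < L"
  defines "u \<equiv> q / z\<^sup>2"
  shows "(y^3 * q * z^4 * n^3 * L / (n / u^4) powr (1/32)) powr (1/4)
      = L powr (1/4) * (q powr (9/32) * n powr (95/128) * y powr (3/4) * z powr (15/16))"
    and "(y^3 * q * z^4 * n^3 * L / (n / u^5) powr (1/29)) powr (1/4)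
      = L powr (1/4) * (q powr (17/58) * n powr (43/58) * y powr (87/116) * z powr (53/58))"
    and "(y^3 * q * z^4 * n^3 * L / (q / (n * u^4)) powr (1/32)) powr (1/4)
      = L powr (1/4) * (q powr (35/128) * n powr (97/128) * y powr (3/4) * z powr (15/16))"
  using pos unfolding u_def
  by (simp_all add: powr_def ln_mult ln_div ln_realpow exp_add[symmetric] field_simps)

context finite_field_character
begin

text \<open>
  The choice D = min(D1, D2, D3)/(2 \<Lambda>) meets the three conditions of the decomposition lemma.  The element 0 of X
  is split off, because the slopes in the energy argument are quotients of elements of X; it contributes
  at most |Y| |Z|.
\<close>

theorem trisum_bound:
  fixes \<kappa> :: real
  assumes X: "X \<subseteq> S" and Y: "Y \<subseteq> S" and Z: "Z \<subseteq> S - {0}"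
    and cards: "card Y \<le> card X" "card Z \<le> card Y" and l: "card S \<le> 2 ^ l" and \<kappa>: "1 \<le> \<kappa>"
    and small: "\<And>G c. subfield_set G \<Longrightarrow> G \<noteq> S \<Longrightarrow> c \<in> S \<Longrightarrow> real (card (X \<inter> (*) c ` G)) \<le> \<kappa> * sqrt (real (card G))"
    and \<alpha>: "\<And>x. x \<in> X \<Longrightarrow> cmod (\<alpha> x) \<le> 1" and \<beta>: "\<And>y. y \<in> Y \<Longrightarrow> cmod (\<beta> y) \<le> 1"
    and \<gamma>: "\<And>z. z \<in> Z \<Longrightarrow> cmod (\<gamma> z) \<le> 1"
  defines "q \<equiv> real (card S)" and "n \<equiv> real (card X)" and "y \<equiv> real (card Y)" and "z \<equiv> real (card Z)"
  shows "cmod (trisum X Y Z \<alpha> \<beta> \<gamma>) \<le> 3 * (2^209 * \<kappa>\<^sup>2) powr (1/4) * (real l + 1)^9 *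
     (q powr (9/32) * n powr (95/128) * y powr (3/4) * z powr (15/16)
    + q powr (17/58) * n powr (43/58) * y powr (87/116) * z powr (53/58)
    + q powr (35/128) * n powr (97/128) * y powr (3/4) * z powr (15/16))"
proof (cases "Z = {}")
  case True
  then show ?thesis by (simp add: trisum_def)
next
  case False
  have fin: "finite X" "finite Y" "finite Z"
    using X Y Z finite_S by (auto intro: finite_subset)
  have z1: "1 \<le> z" using False fin by (simp add: z_def Suc_leI card_gt_0_iff)
  have zy: "z \<le> y" and yn: "y \<le> n" using cards by (auto simp: z_def y_def n_def)
  have nq: "n \<le> q" unfolding n_def q_def using X finite_S by (intro of_nat_mono card_mono)
  have pos: "0 < n" "0 < q" "0 < y" "0 < z" using z1 zy yn nq by auto
  define R1 where "R1 = q powr (9/32) * n powr (95/128) * y powr (3/4) * z powr (15/16)"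
  define R2 where "R2 = q powr (17/58) * n powr (43/58) * y powr (87/116) * z powr (53/58)"
  define R3 where "R3 = q powr (35/128) * n powr (97/128) * y powr (3/4) * z powr (15/16)"
  have R0: "0 \<le> R1" "0 \<le> R2" "0 \<le> R3" by (auto simp: R1_def R2_def R3_def)
  define \<Lambda> where "\<Lambda> = 2^208 * \<kappa>\<^sup>2 * (real l + 1)^36"
  have \<Lambda>1: "1 \<le> \<Lambda>"
  proof -
    have "1 * 1 * 1 \<le> 2^208 * \<kappa>\<^sup>2 * (real l + 1)^36"
      using \<kappa> by (intro mult_mono) auto
    then show ?thesis by (simp add: \<Lambda>_def)
  qed
  define u where "u = q / z\<^sup>2"
  have u0: "0 < u" using pos by (simp add: u_def)
  define D1 where "D1 = (n / u^4) powr (1/32)"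
  define D2 where "D2 = (n / u^5) powr (1/29)"
  define D3 where "D3 = (q / (n * u^4)) powr (1/32)"
  have D0: "0 < D1" "0 < D2" "0 < D3" using pos u0 by (auto simp: D1_def D2_def D3_def)
  have D_pow: "D1^32 = n / u^4" "D2^29 = n / u^5" "D3^32 = q / (n * u^4)"
    using pos u0 by (simp_all add: D1_def D2_def D3_def powr_power)
  define D where "D = min D1 (min D2 D3)"
  define \<Delta> where "\<Delta> = D / (2 * \<Lambda>)"
  have D: "0 < D" "D \<le> D1" "D \<le> D2" "D \<le> D3" using D0 by (auto simp: D_def)
  have \<Delta>0: "0 < \<Delta>" using D \<Lambda>1 by (simp add: \<Delta>_def)
  have \<Delta>_pow: "\<Lambda> * \<Delta>^k < E^k" if "D \<le> E" "1 \<le> k" for E k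
  proof -
    have "2 * \<Lambda> \<le> (2 * \<Lambda>)^k" using \<Lambda>1 that by (intro self_le_power) auto
    then have "\<Lambda> * (D^k / (2 * \<Lambda>)^k) \<le> \<Lambda> * (D^k / (2 * \<Lambda>))"
      using D \<Lambda>1 by (intro mult_left_mono divide_left_mono) auto
    also have "\<dots> = D^k / 2" using \<Lambda>1 by simp
    also have "\<dots> < D^k" using D by simp
    also have "\<dots> \<le> E^k" using D that by (intro power_mono) auto
    finally show ?thesis by (simp add: \<Delta>_def power_divide)
  qed
  have cond: "\<Lambda> * \<Delta>^32 * u^4 < n" "\<Lambda> * \<Delta>^32 * u^4 * n < q" "\<Lambda> * \<Delta>^29 * u^5 < n"
    using \<Delta>_pow[OF D(2), of 32] \<Delta>_pow[OF D(4), of 32] \<Delta>_pow[OF D(3), of 29] pos u0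
    unfolding D_pow by (simp_all add: less_divide_eq mult_ac)
  define H where "H = (y^3 * q * z^4 / (n * \<Delta>)) powr (1/4)"
  have H: "0 \<le> H" "H^4 = y^3 * q * z^4 / (n * \<Delta>)"
    using pos \<Delta>0 by (simp_all add: H_def powr_power)
  have l': "n \<le> 2 ^ l"
  proof -
    have "real (card S) \<le> real (2 ^ l)" using l by (simp only: of_nat_le_iff)
    then show ?thesis using nq unfolding q_def of_nat_power of_nat_numeral by linarith
  qed
  have "cmod (trisum (X - {0}) Y Z \<alpha> \<beta> \<gamma>) \<le> 2 * n * H"
  proof (rule trisum_decomposition_bound[where \<Lambda> = \<Lambda> and \<kappa> = \<kappa> and l = l and \<Delta> = \<Delta> and u = u])
    show "X - {0} \<subseteq> S - {0}" using X by auto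
    show "real (card (X - {0})) \<le> n" unfolding n_def using fin by (intro of_nat_mono card_mono) auto
    show "real (card ((X - {0}) \<inter> (*) c ` G)) \<le> \<kappa> * sqrt (real (card G))"
      if "subfield_set G" "G \<noteq> S" "c \<in> S" for G c
    proof -
      have "card ((X - {0}) \<inter> (*) c ` G) \<le> card (X \<inter> (*) c ` G)" using fin by (intro card_mono) auto
      then show ?thesis using small[OF that] by linarith
    qed
  qed (use pos l' Y Z False cards \<alpha> \<beta> \<gamma> \<Delta>0 \<kappa> cond H in \<open>auto simp: u_def q_def y_def z_def n_def \<Lambda>_def\<close>)
  also have "2 * n * H \<le> 2 * ((2 * \<Lambda>) powr (1/4) * (R1 + R2 + R3))"
  proof -
    have "n * H = (n^4) powr (1/4) * H"
      using powr_powr[of n 4 "1/4"] powr_realpow[of n 4] pos by simp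
    also have "\<dots> = (n^4 * (y^3 * q * z^4 / (n * \<Delta>))) powr (1/4)"
      unfolding H_def by (rule powr_mult[symmetric])
    also have "n^4 * (y^3 * q * z^4 / (n * \<Delta>)) = y^3 * q * z^4 * n^3 * (2 * \<Lambda>) / D"
      using pos D \<Lambda>1 by (simp add: \<Delta>_def field_simps power_numeral_reduce)
    finally have nH: "n * H = (y^3 * q * z^4 * n^3 * (2 * \<Lambda>) / D) powr (1/4)" .
    have "0 < 2 * \<Lambda>" using \<Lambda>1 by simp
    note bal = exponent_balance[OF pos this, folded u_def, folded D1_def D2_def D3_def R1_def R2_def R3_def]
    have "D = D1 \<or> D = D2 \<or> D = D3" by (auto simp: D_def min_def)
    then have "n * H = (2 * \<Lambda>) powr (1/4) * R1 \<or> n * H = (2 * \<Lambda>) powr (1/4) * R2 \<or> n * H = (2 * \<Lambda>) powr (1/4) * R3"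
      unfolding nH using bal by auto
    moreover have "(2 * \<Lambda>) powr (1/4) * R1 \<le> (2 * \<Lambda>) powr (1/4) * (R1 + R2 + R3)"
      "(2 * \<Lambda>) powr (1/4) * R2 \<le> (2 * \<Lambda>) powr (1/4) * (R1 + R2 + R3)"
      "(2 * \<Lambda>) powr (1/4) * R3 \<le> (2 * \<Lambda>) powr (1/4) * (R1 + R2 + R3)"
      using R0 by (auto intro!: mult_left_mono)
    ultimately show ?thesis by auto
  qed
  finally have main: "cmod (trisum (X - {0}) Y Z \<alpha> \<beta> \<gamma>) \<le> 2 * ((2 * \<Lambda>) powr (1/4) * (R1 + R2 + R3))" .
  have "cmod (trisum (X \<inter> {0}) Y Z \<alpha> \<beta> \<gamma>) \<le> y * z"
  proof -
    have "cmod (trisum (X \<inter> {0}) Y Z \<alpha> \<beta> \<gamma>) \<le> (\<Sum>x\<in>X \<inter> {0}. \<Sum>y\<in>Y. \<Sum>z\<in>Z. 1)"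
      unfolding trisum_def
    proof (intro order_trans[OF norm_sum] sum_mono)
      fix x y z assume *: "x \<in> X \<inter> {0}" "y \<in> Y" "z \<in> Z"
      then have "cmod (\<alpha> x) * cmod (\<beta> y) * cmod (\<gamma> z) \<le> 1"
        using \<alpha> \<beta> \<gamma> by (auto intro!: mult_le_one)
      then show "cmod (\<alpha> x * \<beta> y * \<gamma> z * \<chi> (x * y * z)) \<le> 1"
        using * by (simp add: norm_mult chi_zero)
    qed
    also have "\<dots> = real (card (X \<inter> {0})) * (y * z)" by (simp add: y_def z_def)
    also have "\<dots> \<le> 1 * (y * z)"
    proof (rule mult_right_mono)
      have "card (X \<inter> {0}) \<le> card {0::'a}" by (intro card_mono) auto
      then show "real (card (X \<inter> {0})) \<le> 1" by simp
    qed (use pos in auto)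
    finally show ?thesis by simp
  qed
  also have "y * z \<le> R3"
  proof -
    have ln: "0 \<le> ln z" "ln z \<le> ln y" "ln y \<le> ln n" "ln n \<le> ln q"
      using z1 zy yn nq pos by auto
    have "y * z = exp (ln y + ln z)" using pos by (simp add: exp_add)
    also have "\<dots> \<le> exp (35/128 * ln q + 97/128 * ln n + 3/4 * ln y + 15/16 * ln z)"
      using ln by simp
    also have "\<dots> = R3" using pos by (simp add: R3_def powr_def exp_add)
    finally show ?thesis .
  qed
  also have "R3 \<le> (2 * \<Lambda>) powr (1/4) * (R1 + R2 + R3)"
  proof -
    have "1 \<le> (2 * \<Lambda>) powr (1/4)" using \<Lambda>1 by (intro ge_one_powr_ge_zero) auto
    then have "1 * R3 \<le> (2 * \<Lambda>) powr (1/4) * (R1 + R2 + R3)" using R0 by (intro mult_mono) auto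
    then show ?thesis by simp
  qed
  finally have "cmod (trisum (X \<inter> {0}) Y Z \<alpha> \<beta> \<gamma>) \<le> (2 * \<Lambda>) powr (1/4) * (R1 + R2 + R3)" .
  moreover have "trisum X Y Z \<alpha> \<beta> \<gamma> = trisum (X - {0}) Y Z \<alpha> \<beta> \<gamma> + trisum (X \<inter> {0}) Y Z \<alpha> \<beta> \<gamma>"
  proof -
    have "(X - {0}) \<union> (X \<inter> {0}) = X" by auto
    then show ?thesis using trisum_union[of "X - {0}" "X \<inter> {0}"] fin by auto
  qed
  ultimately have "cmod (trisum X Y Z \<alpha> \<beta> \<gamma>) \<le> 3 * ((2 * \<Lambda>) powr (1/4) * (R1 + R2 + R3))"
    using main norm_triangle_ineq[of "trisum (X - {0}) Y Z \<alpha> \<beta> \<gamma>" "trisum (X \<inter> {0}) Y Z \<alpha> \<beta> \<gamma>"] by simp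
  also have "(2 * \<Lambda>) powr (1/4) = (2^209 * \<kappa>\<^sup>2) powr (1/4) * (real l + 1)^9"
  proof -
    have "2 * \<Lambda> = (2^209 * \<kappa>\<^sup>2) * (real l + 1)^36" by (simp add: \<Lambda>_def)
    moreover have "((real l + 1)^36) powr (1/4) = (real l + 1)^9"
    proof -
      have "(((real l + 1)^9)^4) powr (1/4) = (real l + 1)^9"
        using powr_powr[of "(real l + 1)^9" 4 "1/4"] powr_realpow[of "(real l + 1)^9" 4] by simp
      then show ?thesis by (simp flip: power_mult)
    qed
    ultimately show ?thesis by (simp add: powr_mult)
  qed
  finally show ?thesis by (simp add: R1_def R2_def R3_def mult.assoc)
qed

end

section \<open>The trace character\<close>

context finite_field_set
begin

lemma power_S: "x \<in> S \<Longrightarrow> 0 < k \<Longrightarrow> x ^ k \<in> S"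
proof (induction k)
  case (Suc k)
  then show ?case using mult_S by (cases "k = 0") auto
qed simp

lemma sum_S: "(\<And>i. i \<in> I \<Longrightarrow> f i \<in> S) \<Longrightarrow> sum f I \<in> S"
  by (induction I rule: infinite_finite_induct) (auto simp: zero_S add_S)

lemma of_nat_S: "of_nat k * e \<in> S"
  by (induction k) (auto simp: zero_S one_S add_S distrib_right)

lemma one_power: "0 < k \<Longrightarrow> e ^ k = e"
proof (induction k)
  case (Suc k)
  then show ?case using one_mult[OF one_S] by (cases "k = 0") auto
qed simp

lemma card_S_gt_1: "1 < card S"
proof -
  have "card {0, e} \<le> card S" using finite_S zero_S one_S by (intro card_mono) auto
  then show ?thesis using one_nonzero by simp
qed

lemma translate_S:
  assumes "x \<in> S"
  shows "(\<lambda>s. s + x) ` S = S" "inj_on (\<lambda>s. s + x) S"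
proof -
  show "inj_on (\<lambda>s. s + x) S" by (auto intro: inj_onI)
  then show "(\<lambda>s. s + x) ` S = S" using assms add_S by (intro endo_inj_surj finite_S) auto
qed

text \<open>
  Translation by x permutes the field, so the sum of all its elements does not change when x is added to each.
\<close>

lemma of_nat_card_mult:
  assumes "x \<in> S"
  shows "of_nat (card S) * x = 0"
proof -
  have "(\<Sum>s\<in>S. s) = (\<Sum>s\<in>(\<lambda>s. s + x) ` S. s)" by (simp add: translate_S[OF assms])
  also have "\<dots> = (\<Sum>s\<in>S. s + x)" using translate_S(2)[OF assms] by (simp add: sum.reindex)
  also have "\<dots> = (\<Sum>s\<in>S. s) + of_nat (card S) * x" by (simp add: sum.distrib)
  finally show ?thesis by simp
qed

text \<open>
  Multiplication by x permutes the nonzero elements.  The factor e in front of the product keeps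
  it inside the field, also for the empty product.
\<close>

lemma power_card:
  assumes x: "x \<in> S"
  shows "x ^ card S = x"
proof (cases "x = 0")
  case True
  then show ?thesis using card_S_gt_1 by (simp add: zero_power)
next
  case False
  have units: "e * \<Prod>T \<in> S \<and> e * \<Prod>T \<noteq> 0" if "T \<subseteq> S - {0}" for T
  proof -
    have "finite T" using that finite_S by (meson Diff_subset finite_subset order_trans)
    then show ?thesis using that
    proof (induction T)
      case (insert t T)
      then have "e * \<Prod>T \<in> S" "e * \<Prod>T \<noteq> 0" "t \<in> S" "t \<noteq> 0" by auto
      then have "t * (e * \<Prod>T) \<in> S" "t * (e * \<Prod>T) \<noteq> 0" using mult_S mult_nonzero by auto
      then show ?case using insert.hyps by (simp add: mult_ac)
    qed (use one_S one_nonzero in auto)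
  qed
  define P where "P = e * \<Prod>(S - {0})"
  have P: "P \<in> S" "P \<noteq> 0" using units[of "S - {0}"] by (auto simp: P_def)
  have inj: "inj_on ((*) x) (S - {0})" using x False by (intro inj_on_dilate) auto
  then have "(*) x ` (S - {0}) = S - {0}"
    using x False mult_S mult_nonzero finite_S by (intro endo_inj_surj) auto
  then have "P = e * \<Prod>((*) x ` (S - {0}))" by (simp add: P_def)
  also have "\<dots> = e * (\<Prod>s\<in>S - {0}. x * s)" using inj by (simp add: prod.reindex)
  also have "\<dots> = P * x ^ (card S - 1)"
    using zero_S finite_S by (simp add: P_def prod.distrib card_Diff_singleton mult_ac)
  finally have eq: "P * x ^ (card S - 1) = P * e" using one_mult[OF P(1)] by (simp add: mult.commute)
  have "x ^ (card S - 1) \<in> S" using x card_S_gt_1 by (intro power_S) auto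
  from mult_cancel[OF P this one_S eq] have "x ^ (card S - 1) = e" .
  then have "x ^ (card S - 1) * x = x" using one_mult[OF x] by simp
  moreover have "x ^ (card S - 1) * x = x ^ card S"
    using card_S_gt_1 by (intro power_minus_mult) simp
  ultimately show ?thesis by simp
qed

lemma poly_in_S:
  assumes "\<And>i. coeff q i \<in> S" "t \<in> S"
  shows "poly q t \<in> S"
  using assms(1)
proof (induction q)
  case (pCons a q)
  have "a \<in> S" using pCons(3)[of 0] by simp
  moreover have "coeff q i \<in> S" for i using pCons(3)[of "Suc i"] by simp
  ultimately show ?case using pCons.IH assms(2) add_S mult_S by simp
qed (simp add: zero_S)

lemma synthetic_div_in_S:
  assumes "\<And>i. coeff q i \<in> S" "t \<in> S"
  shows "coeff (synthetic_div q t) i \<in> S"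
  using assms(1)
proof (induction q arbitrary: i)
  case (pCons a q)
  have q: "coeff q i \<in> S" for i using pCons(3)[of "Suc i"] by simp
  show ?case
    using pCons.IH[OF q] poly_in_S[OF q assms(2)] by (cases i) auto
qed (simp add: zero_S)

text \<open>
  The ring has zero divisors, so the usual bound for the number of roots is available only for roots in the field and
  coefficients in the field.  Dividing out a linear factor preserves this condition.
\<close>

lemma card_roots_le_degree:
  assumes "\<And>i. coeff q i \<in> S" "q \<noteq> 0"
  shows "card {t \<in> S. poly q t = 0} \<le> degree q"
  using assms
proof (induction "degree q" arbitrary: q)
  case 0
  then obtain c where "q = [:c:]" "c \<noteq> 0" by (metis degree_0_id of_nat_0 degree_eq_zeroE pCons_0_0)
  then show ?case by simp
next
  case (Suc d)
  show ?case
  proof (cases "\<exists>r\<in>S. poly q r = 0")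
    case False
    then have no_roots: "{t \<in> S. poly q t = 0} = {}" by auto
    show ?thesis unfolding no_roots by simp
  next
    case True
    then obtain r where r: "r \<in> S" "poly q r = 0" by auto
    define s where "s = synthetic_div q r"
    have q_eq: "q = [:-r, 1:] * s" using synthetic_div_correct'[of r q] r by (simp add: s_def)
    have s: "\<And>i. coeff s i \<in> S" using synthetic_div_in_S[OF Suc(3) r(1)] by (simp add: s_def)
    have "s \<noteq> 0" using q_eq Suc(4) by auto
    have deg: "d = degree s" using Suc(2) by (simp add: s_def degree_synthetic_div)
    have "{t \<in> S. poly q t = 0} \<subseteq> insert r {t \<in> S. poly s t = 0}"
    proof
      fix t assume "t \<in> {t \<in> S. poly q t = 0}"
      then have t: "t \<in> S" "poly q t = 0" by auto
      have "(t - r) * poly s t = 0" using t(2) by (subst (asm) q_eq) (simp add: algebra_simps)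
      then show "t \<in> insert r {t \<in> S. poly s t = 0}"
        using t r mult_nonzero[of "t - r" "poly s t"] poly_in_S[OF s t(1)] diff_S by auto
    qed
    then have "card {t \<in> S. poly q t = 0} \<le> card (insert r {t \<in> S. poly s t = 0})"
      using finite_S by (intro card_mono) auto
    also have "\<dots> \<le> Suc (card {t \<in> S. poly s t = 0})" using finite_S by (simp add: card_insert_if)
    also have "\<dots> \<le> Suc d" using Suc(1)[OF deg s \<open>s \<noteq> 0\<close>] deg by simp
    finally show ?thesis using Suc(2) by simp
  qed
qed

end

locale finite_field_trace = finite_field_set S e for S :: "'a::comm_ring_1 set" and e +
  fixes p m :: nat
  assumes prime_p: "Factorial_Ring.prime p" and card_S: "card S = p ^ m"
begin

lemma m_pos: "0 < m"
  using card_S_gt_1 card_S by (cases m) auto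

lemma p_gt_1: "1 < p"
  using prime_p prime_gt_1_nat by blast

lemma characteristic: 
  assumes "x \<in> S"
  shows "of_nat p * x = 0"
proof -
  have "of_nat p * e = 0"
  proof (rule ccontr)
    assume nz: "of_nat p * e \<noteq> 0"
    have "(of_nat p * e) ^ Suc k \<in> S \<and> (of_nat p * e) ^ Suc k \<noteq> 0" for k
    proof (induction k)
      case (Suc k)
      then show ?case using nz of_nat_S[of p] mult_S mult_nonzero by (metis power_Suc)
    qed (use nz of_nat_S in simp)
    then have "(of_nat p * e) ^ m \<noteq> 0" using m_pos by (metis Suc_pred)
    moreover have "(of_nat p * e) ^ m = of_nat (card S) * e"
      using m_pos by (simp add: power_mult_distrib one_power card_S)
    ultimately show False using of_nat_card_mult[OF one_S] by simp
  qed
  then show ?thesis using one_mult[OF assms] by (metis mult.assoc mult_zero_left)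
qed

lemma frobenius_add:
  assumes "x \<in> S" "y \<in> S"
  shows "(x + y) ^ p = x ^ p + y ^ p"
proof -
  have zero: "of_nat (p choose k) * x ^ k * y ^ (p - k) = 0" if "k \<in> {..p} - {0, p}" for k
  proof -
    have k: "0 < k" "k < p" using that by auto
    have "p dvd p choose k" using k prime_p by (intro dvd_choose_prime) auto
    then obtain c where "p choose k = c * p" by (metis dvd_div_mult_self)
    then have "of_nat (p choose k) * x ^ k = of_nat c * (of_nat p * x ^ k)" by (simp add: mult.assoc)
    also have "\<dots> = 0" using characteristic power_S[OF assms(1) k(1)] by simp
    finally show ?thesis by simp
  qed
  have "(x + y) ^ p = (\<Sum>k\<le>p. of_nat (p choose k) * x ^ k * y ^ (p - k))" by (rule binomial_ring)
  also have "\<dots> = (\<Sum>k\<in>{0, p}. of_nat (p choose k) * x ^ k * y ^ (p - k))"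
    using zero by (intro sum.mono_neutral_right) auto
  also have "\<dots> = x ^ p + y ^ p" using p_gt_1 by (simp add: add.commute)
  finally show ?thesis .
qed

lemma frobenius_power_add:
  assumes "x \<in> S" "y \<in> S"
  shows "(x + y) ^ (p ^ i) = x ^ (p ^ i) + y ^ (p ^ i)"
proof (induction i)
  case (Suc i)
  have "(x + y) ^ (p ^ Suc i) = ((x + y) ^ (p ^ i)) ^ p"
    by (simp add: mult.commute flip: power_mult)
  also have "\<dots> = (x ^ (p ^ i)) ^ p + (y ^ (p ^ i)) ^ p"
    unfolding Suc using assms p_gt_1 by (intro frobenius_add power_S) auto
  finally show ?case by (simp add: mult.commute flip: power_mult)
qed simp

lemma frobenius_sum:
  assumes "finite I" "\<And>i. i \<in> I \<Longrightarrow> f i \<in> S"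
  shows "(sum f I) ^ p = (\<Sum>i\<in>I. f i ^ p)"
  using assms
proof (induction I)
  case empty
  then show ?case using p_gt_1 by (simp add: zero_power)
next
  case (insert i I)
  then show ?case using frobenius_add[of "f i" "sum f I"] sum_S[of I f] by auto
qed

definition trace :: "'a \<Rightarrow> 'a" where
  "trace x = (\<Sum>i<m. x ^ (p ^ i))"

lemma trace_S: "x \<in> S \<Longrightarrow> trace x \<in> S"
  unfolding trace_def using p_gt_1 by (intro sum_S power_S) auto

lemma trace_add: "x \<in> S \<Longrightarrow> y \<in> S \<Longrightarrow> trace (x + y) = trace x + trace y"
  by (simp add: trace_def frobenius_power_add sum.distrib)

lemma trace_frobenius:
  assumes "x \<in> S"
  shows "trace x ^ p = trace x"
proof -
  have "trace x ^ p = (\<Sum>i<m. (x ^ (p ^ i)) ^ p)"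
    unfolding trace_def using assms p_gt_1 by (intro frobenius_sum power_S) auto
  also have "\<dots> = (\<Sum>i<m. x ^ (p ^ Suc i))"
    by (simp add: mult.commute flip: power_mult)
  also have "\<dots> + x ^ (p ^ 0) = (\<Sum>i<Suc m. x ^ (p ^ i))"
    by (subst sum.lessThan_Suc_shift) (simp add: add.commute)
  then have "(\<Sum>i<m. x ^ (p ^ Suc i)) = trace x"
    using power_card[OF assms] by (simp add: trace_def card_S)
  finally show ?thesis .
qed

lemma of_nat_multiple_nonzero:
  assumes "0 < j" "j < p"
  shows "of_nat j * e \<noteq> 0"
proof
  assume 0: "of_nat j * e = 0"
  have "coprime j p"
    using assms prime_p by (metis coprime_commute nat_dvd_not_less prime_imp_coprime)
  then obtain a b where ab: "j * a = p * b + 1"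
    using assms bezout_nat[of j p] by (metis coprime_imp_gcd_eq_1 less_numeral_extra(3))
  have "e = of_nat (p * b + 1) * e"
    using characteristic[OF one_S] by (simp add: distrib_right mult.assoc mult.left_commute)
  also have "\<dots> = of_nat a * (of_nat j * e)" unfolding ab[symmetric] of_nat_mult by (simp add: mult_ac)
  finally show False using 0 one_nonzero by simp
qed

lemma of_nat_multiple_inj:
  assumes "j < p" "k < p" "of_nat j * e = of_nat k * e"
  shows "j = k"
proof -
  have *: False if jk: "j < k" "k < p" "of_nat j * e = of_nat k * e" for j k
  proof -
    obtain d where d: "k = j + d" "0 < d" using less_imp_add_positive[OF jk(1)] by auto
    then have "of_nat d * e = 0" using jk(3) by (simp add: distrib_right)
    then show False using jk(2) d of_nat_multiple_nonzero[of d] by simp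
  qed
  show ?thesis using *[of j k] *[of k j] assms by (metis linorder_neqE_nat)
qed

text \<open>
  The p multiples of e are roots of t^p - t, and there are no others.
\<close>

lemma prime_subfield:
  assumes t: "t \<in> S" "t ^ p = t"
  shows "\<exists>k<p. of_nat k * e = t"
proof -
  define q where "q = monom e p - monom e 1"
  have coeffs: "coeff q i \<in> S" for i
    using one_S zero_S uminus_S by (auto simp: q_def coeff_monom)
  have "coeff q p \<noteq> 0" using p_gt_1 one_nonzero by (simp add: q_def coeff_monom)
  then have "q \<noteq> 0" by auto
  have "degree q \<le> p"
    unfolding q_def using p_gt_1 by (intro degree_diff_le order_trans[OF degree_monom_le]) auto
  have roots: "poly q s = s ^ p - s" if "s \<in> S" for s
    using that p_gt_1 one_mult power_S[OF that, of p] by (simp add: q_def poly_monom)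
  have mult_root: "(of_nat k * e) ^ p = of_nat k * e" for k
  proof (induction k)
    case 0
    then show ?case using p_gt_1 by (simp add: zero_power)
  next
    case (Suc k)
    have "(of_nat (Suc k) * e) ^ p = (e + of_nat k * e) ^ p" by (simp add: distrib_right)
    also have "\<dots> = e ^ p + (of_nat k * e) ^ p" using one_S of_nat_S by (intro frobenius_add)
    finally show ?case using Suc p_gt_1 by (simp add: one_power distrib_right)
  qed
  let ?R = "{s \<in> S. poly q s = 0}"
  let ?P = "(\<lambda>k. of_nat k * e) ` {..<p}"
  have finR: "finite ?R" using finite_S by simp
  have PR: "?P \<subseteq> ?R" using of_nat_S roots mult_root by auto
  have "card ?P = p"
    using of_nat_multiple_inj by (subst card_image) (auto intro: inj_onI)
  then have "?P = ?R"
    using card_roots_le_degree[OF coeffs \<open>q \<noteq> 0\<close>] \<open>degree q \<le> p\<close> card_mono[OF finR PR]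
    by (intro card_subset_eq[OF finR PR]) linarith
  moreover have "t \<in> ?R" using t roots by auto
  ultimately have "t \<in> ?P" by (simp only:)
  then show ?thesis by auto
qed

text \<open>
  The trace is given by a nonzero polynomial of degree p^(m-1), smaller than the order of the field.
\<close>

lemma trace_nontrivial: "\<exists>x\<in>S. trace x \<noteq> 0"
proof (rule ccontr)
  assume neg: "\<not> ?thesis"
  define q where "q = (\<Sum>i<m. monom e (p ^ i))"
  have coeffs: "coeff q i \<in> S" for i
    unfolding q_def coeff_sum using one_S zero_S by (intro sum_S) (simp add: coeff_monom)
  have "coeff q 1 = (\<Sum>i<m. if i = 0 then e else 0)"
    unfolding q_def coeff_sum using p_gt_1 by (intro sum.cong) (auto simp: coeff_monom)
  also have "\<dots> = e" using m_pos by simp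
  finally have "q \<noteq> 0" using one_nonzero by auto
  have "degree q \<le> p ^ (m - 1)"
    unfolding q_def
  proof (rule degree_sum_le)
    fix i assume "i \<in> {..<m}"
    then have "p ^ i \<le> p ^ (m - 1)" using p_gt_1 by (intro power_increasing) auto
    then show "degree (monom e (p ^ i)) \<le> p ^ (m - 1)" using degree_monom_le le_trans by blast
  qed simp
  also have "\<dots> < p ^ m" using p_gt_1 m_pos by (intro power_strict_increasing) auto
  finally have "card {t \<in> S. poly q t = 0} < card S"
    using card_roots_le_degree[OF coeffs \<open>q \<noteq> 0\<close>] card_S by simp
  moreover have "poly q t = trace t" if "t \<in> S" for t
    using that one_mult power_S p_gt_1 by (simp add: q_def poly_sum poly_monom trace_def)
  then have "{t \<in> S. poly q t = 0} = S" using neg by auto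
  ultimately show False by simp
qed

definition residue :: "'a \<Rightarrow> nat" where
  "residue t = (THE k. k < p \<and> of_nat k * e = t)"

lemma residue_unique: "k < p \<Longrightarrow> of_nat k * e = t \<Longrightarrow> residue t = k"
  unfolding residue_def using of_nat_multiple_inj by (intro the_equality) auto

lemma residue_trace:
  assumes "x \<in> S"
  shows "residue (trace x) < p" "of_nat (residue (trace x)) * e = trace x"
  using prime_subfield[OF trace_S[OF assms] trace_frobenius[OF assms]] residue_unique by auto

definition character :: "'a \<Rightarrow> complex" where
  "character x = e_mod p (residue (trace x))"

lemma e_mod_add: "e_mod p (j + k) = e_mod p j * e_mod p k"
  by (simp add: e_mod_def exp_add[symmetric] add_divide_distrib distrib_left)

lemma e_mod_multiple: "e_mod p (p * k) = 1"
proof -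
  have "2 * of_real pi * \<i> * of_nat (p * k) / of_nat p = of_nat k * (2 * of_real pi * \<i>)"
    using p_gt_1 by simp
  then have "e_mod p (p * k) = exp (2 * of_real pi * \<i>) ^ k"
    unfolding e_mod_def by (simp only: exp_of_nat_mult)
  also have "exp (2 * of_real pi * \<i>) = 1" by (rule exp_two_pi_i)
  finally show ?thesis by simp
qed

lemma e_mod_mod: "e_mod p (k mod p) = e_mod p k"
proof -
  have "e_mod p k = e_mod p (p * (k div p) + k mod p)" by simp
  then show ?thesis by (simp only: e_mod_add e_mod_multiple) simp
qed

lemma e_mod_eq_1:
  assumes "e_mod p k = 1" "k < p"
  shows "k = 0"
proof -
  define \<theta> where "\<theta> = 2 * pi * real k / real p"
  have "e_mod p k = exp (\<i> * of_real \<theta>)" by (simp add: e_mod_def \<theta>_def mult_ac)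
  then have "cos \<theta> = 1" using assms(1) by (simp add: complex_eq_iff exp_eq_polar cis.simps Re_exp)
  then obtain j :: int where "\<theta> = of_int j * 2 * pi" using cos_one_2pi_int by blast
  then have "real k = of_int j * real p" using p_gt_1 by (simp add: \<theta>_def field_simps)
  then have "int k = j * int p" by (metis of_int_eq_iff of_int_mult of_int_of_nat_eq)
  then show ?thesis using assms(2) by (metis dvd_triv_right int_dvd_int_iff nat_dvd_not_less gr0I)
qed

text \<open>
  Orthogonality holds because \<chi> (w y0) differs from 1 for some y0: translating y by y0 multiplies the sum by this number.
\<close>

sublocale finite_field_character S e character
proof
  show add: "character (x + y) = character x * character y" if "x \<in> S" "y \<in> S" for x y
  proof -
    let ?k = "residue (trace x) + residue (trace y)"
    have "of_nat ?k * e = trace (x + y)"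
      using that residue_trace by (simp add: distrib_right trace_add)
    moreover have "of_nat ?k * e = of_nat (?k mod p) * e"
    proof -
      have "of_nat ?k * e = of_nat (p * (?k div p) + ?k mod p) * e" by simp
      also have "\<dots> = of_nat (?k div p) * (of_nat p * e) + of_nat (?k mod p) * e"
        unfolding of_nat_add of_nat_mult by (simp add: algebra_simps)
      finally show ?thesis using characteristic[OF one_S] by simp
    qed
    ultimately have "residue (trace (x + y)) = ?k mod p"
      using p_gt_1 by (intro residue_unique) auto
    then show ?thesis by (simp add: character_def e_mod_mod e_mod_add)
  qed
  show "cmod (character x) = 1" if "x \<in> S" for x
    by (simp add: character_def e_mod_def)
  show "(\<Sum>y\<in>S. character (w * y)) = 0" if w: "w \<in> S" "w \<noteq> 0" for w
  proof -
    obtain x where x: "x \<in> S" "trace x \<noteq> 0" using trace_nontrivial by blast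
    have "residue (trace x) \<noteq> 0"
      using residue_trace(2)[OF x(1)] x(2) by (metis mult_zero_left of_nat_0)
    then have "character x \<noteq> 1" 
      using e_mod_eq_1[of "residue (trace x)"] residue_trace(1)[OF x(1)] unfolding character_def by metis
    obtain y0 where y0: "y0 \<in> S" "w * y0 = x" using divide_S[OF w x(1)] by blast
    have "(\<Sum>y\<in>S. character (w * y)) = (\<Sum>y\<in>(\<lambda>s. s + y0) ` S. character (w * y))"
      by (simp add: translate_S[OF y0(1)])
    also have "\<dots> = (\<Sum>y\<in>S. character (w * y + x))"
      using translate_S(2)[OF y0(1)] y0 by (simp add: sum.reindex distrib_left)
    also have "\<dots> = (\<Sum>y\<in>S. character (w * y)) * character x"
      using w x mult_S by (simp add: add sum_distrib_right)
    finally show ?thesis using \<open>character x \<noteq> 1\<close> by simp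
  qed
qed

end

section \<open>One ring containing all finite fields\<close>

lemma field_is_cring: "field R \<Longrightarrow> cring R"
  by (rule domain.axioms(1)[OF field.axioms(1)])

lemma field_is_ring: "field R \<Longrightarrow> ring R"
  by (rule cring.axioms(1)[OF field_is_cring])

lemma field_is_monoid: "field R \<Longrightarrow> monoid R"
  by (rule ring.axioms(2)[OF field_is_ring])

text \<open>
  The elements are families with one coordinate for each ring record over the natural numbers.  At a
  record that is not a field the coordinate is an integer modulo 2; such records exist, so 0 and 1 are
  different.
\<close>

typedef field_product = "{f :: nat ring \<Rightarrow> nat. \<forall>R. if field R then f R \<in> carrier R else f R < 2}"
proof
  show "(\<lambda>R. if field R then \<zero>\<^bsub>R\<^esub> else 0) \<in> {f :: nat ring \<Rightarrow> nat. \<forall>R. if field R then f R \<in> carrier R else f R < 2}"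
    by (auto intro: ring.ring_simprules(2)[OF field_is_ring])
qed

setup_lifting type_definition_field_product

instantiation field_product :: comm_ring_1
begin

lift_definition zero_field_product :: field_product is "\<lambda>R. if field R then \<zero>\<^bsub>R\<^esub> else 0"
  by (auto intro: ring.ring_simprules(2)[OF field_is_ring])

lift_definition one_field_product :: field_product is "\<lambda>R. if field R then \<one>\<^bsub>R\<^esub> else 1"
  by (auto intro: monoid.one_closed[OF field_is_monoid])

lift_definition plus_field_product :: "field_product \<Rightarrow> field_product \<Rightarrow> field_product"
  is "\<lambda>f g R. if field R then f R \<oplus>\<^bsub>R\<^esub> g R else (f R + g R) mod 2"
  by (auto intro: ring.ring_simprules(1)[OF field_is_ring])

lift_definition times_field_product :: "field_product \<Rightarrow> field_product \<Rightarrow> field_product"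
  is "\<lambda>f g R. if field R then f R \<otimes>\<^bsub>R\<^esub> g R else f R * g R mod 2"
  by (auto intro: monoid.m_closed[OF field_is_monoid])

lift_definition uminus_field_product :: "field_product \<Rightarrow> field_product"
  is "\<lambda>f R. if field R then \<ominus>\<^bsub>R\<^esub> f R else f R"
  by (auto intro: abelian_group.a_inv_closed[OF ring.axioms(1)[OF field_is_ring]] split: if_splits)

lift_definition minus_field_product :: "field_product \<Rightarrow> field_product \<Rightarrow> field_product"
  is "\<lambda>f g R. if field R then f R \<ominus>\<^bsub>R\<^esub> g R else (f R + g R) mod 2"
  by (auto intro: abelian_group.minus_closed[OF ring.axioms(1)[OF field_is_ring]] split: if_splits)

instance
proof
  let ?ok = "\<lambda>f :: nat ring \<Rightarrow> nat. \<forall>R. if field R then f R \<in> carrier R else f R < 2"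
  have inR: "f R \<in> carrier R" if "?ok f" "field R" for f R using that by metis
  have lt2: "f R < 2" if "?ok f" "\<not> field R" for f R using that by metis
  fix a b c :: field_product
  show "a + b + c = a + (b + c)"
  proof (transfer, rule ext, goal_cases)
    case (1 a b c R)
    show ?case
    proof (cases "field R")
      case True
      then interpret field R .
      show ?thesis using True inR[OF 1(1) True] inR[OF 1(2) True] inR[OF 1(3) True] by (simp add: a_assoc)
    qed (simp add: mod_simps add.assoc)
  qed
  show "a + b = b + a"
  proof (transfer, rule ext, goal_cases)
    case (1 a b R)
    show ?case
    proof (cases "field R")
      case True
      then interpret field R .
      show ?thesis using True inR[OF 1(1) True] inR[OF 1(2) True] by (simp add: a_comm)
    qed (simp add: add.commute)
  qed
  show "0 + a = a"
  proof (transfer, rule ext, goal_cases)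
    case (1 a R)
    show ?case
    proof (cases "field R")
      case True
      then interpret field R .
      show ?thesis using True inR[OF 1(1) True] by simp
    next
      case False
      then show ?thesis using lt2[OF 1(1) False] by simp
    qed
  qed
  show "- a + a = 0"
  proof (transfer, rule ext, goal_cases)
    case (1 a R)
    show ?case
    proof (cases "field R")
      case True
      then interpret field R .
      show ?thesis using True inR[OF 1(1) True] by (simp add: l_neg)
    next
      case False
      then show ?thesis by presburger
    qed
  qed
  show "a - b = a + - b"
    by transfer (auto simp: a_minus_def)
  show "a * b * c = a * (b * c)"
  proof (transfer, rule ext, goal_cases)
    case (1 a b c R)
    show ?case
    proof (cases "field R")
      case True
      then interpret field R .
      show ?thesis using True inR[OF 1(1) True] inR[OF 1(2) True] inR[OF 1(3) True] by (simp add: m_assoc)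
    qed (simp add: mod_simps mult.assoc)
  qed
  show "a * b = b * a"
  proof (transfer, rule ext, goal_cases)
    case (1 a b R)
    show ?case
    proof (cases "field R")
      case True
      then interpret field R .
      show ?thesis using True inR[OF 1(1) True] inR[OF 1(2) True] by (simp add: m_comm)
    qed (simp add: mult.commute)
  qed
  show "1 * a = a"
  proof (transfer, rule ext, goal_cases)
    case (1 a R)
    show ?case
    proof (cases "field R")
      case True
      then interpret field R .
      show ?thesis using True inR[OF 1(1) True] by simp
    next
      case False
      then show ?thesis using lt2[OF 1(1) False] by simp
    qed
  qed
  show "(a + b) * c = a * c + b * c"
  proof (transfer, rule ext, goal_cases)
    case (1 a b c R)
    show ?case
    proof (cases "field R")
      case True
      then interpret field R .
      show ?thesis using True inR[OF 1(1) True] inR[OF 1(2) True] inR[OF 1(3) True] by (simp add: l_distr)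
    qed (simp add: mod_simps distrib_right)
  qed
  show "(0 :: field_product) \<noteq> 1"
  proof (transfer, rule notI)
    let ?R = "\<lparr>carrier = {}, mult = (*), one = 0, zero = 0, add = (+)\<rparr> :: nat ring"
    assume "(\<lambda>R :: nat ring. if field R then \<zero>\<^bsub>R\<^esub> else 0) = (\<lambda>R. if field R then \<one>\<^bsub>R\<^esub> else 1)"
    from fun_cong[OF this, of ?R] have "field ?R" by (auto split: if_splits)
    from monoid.one_closed[OF field_is_monoid[OF this]] show False by simp
  qed
qed

end

text \<open>
  The embedding puts x at the coordinate R and zero elsewhere.
\<close>

lift_definition coordinate_embedding :: "nat ring \<Rightarrow> nat \<Rightarrow> field_product"
  is "\<lambda>R x R'. if field R' then if R' = R \<and> x \<in> carrier R then x else \<zero>\<^bsub>R'\<^esub> else 0"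
  by (auto intro: ring.ring_simprules(2)[OF field_is_ring])

lemma coordinate_embedding_add:
  assumes "field R" "x \<in> carrier R" "y \<in> carrier R"
  shows "coordinate_embedding R (x \<oplus>\<^bsub>R\<^esub> y) = coordinate_embedding R x + coordinate_embedding R y"
  using assms
proof (transfer, intro ext, goal_cases)
  case (1 R x y R')
  then interpret field R by simp
  have "\<zero>\<^bsub>Q\<^esub> \<oplus>\<^bsub>Q\<^esub> \<zero>\<^bsub>Q\<^esub> = \<zero>\<^bsub>Q\<^esub>" if "field Q" for Q :: "nat ring"
  proof -
    interpret Q: field Q by (rule that)
    show ?thesis by simp
  qed
  then show ?case using 1 by auto
qed

lemma coordinate_embedding_mult:
  assumes "field R" "x \<in> carrier R" "y \<in> carrier R"
  shows "coordinate_embedding R (x \<otimes>\<^bsub>R\<^esub> y) = coordinate_embedding R x * coordinate_embedding R y"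
  using assms
proof (transfer, intro ext, goal_cases)
  case (1 R x y R')
  then interpret field R by simp
  have "\<zero>\<^bsub>Q\<^esub> \<otimes>\<^bsub>Q\<^esub> \<zero>\<^bsub>Q\<^esub> = \<zero>\<^bsub>Q\<^esub>" if "field Q" for Q :: "nat ring"
  proof -
    interpret Q: field Q by (rule that)
    show ?thesis by simp
  qed
  then show ?case using 1 by auto
qed

lemma coordinate_embedding_zero: "coordinate_embedding R \<zero>\<^bsub>R\<^esub> = 0"
  by transfer auto

lemma inj_on_coordinate_embedding:
  assumes "field R"
  shows "inj_on (coordinate_embedding R) (carrier R)"
proof (rule inj_onI)
  fix x y assume "x \<in> carrier R" "y \<in> carrier R" "coordinate_embedding R x = coordinate_embedding R y"
  then show "x = y" using assms by transfer (metis (full_types))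
qed

section \<open>The trilinear sum over a field given by a record\<close>

locale embedded_finite_field = field R for R :: "nat ring" (structure) +
  fixes p m :: nat
  assumes fin: "finite (carrier R)" and prime_p: "Factorial_Ring.prime p" and card_R: "card (carrier R) = p ^ m"
begin

abbreviation \<iota> :: "nat \<Rightarrow> field_product" where
  "\<iota> \<equiv> coordinate_embedding R"

lemma field_R: "field R" ..

lemmas iota_add = coordinate_embedding_add[OF field_R]
lemmas iota_mult = coordinate_embedding_mult[OF field_R]
lemmas iota_zero = coordinate_embedding_zero[of R]
lemmas iota_inj = inj_on_coordinate_embedding[OF field_R]

lemma iota_eq_iff: "x \<in> carrier R \<Longrightarrow> y \<in> carrier R \<Longrightarrow> \<iota> x = \<iota> y \<longleftrightarrow> x = y"
  using inj_onD[OF iota_inj] by blast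

lemma iota_uminus: "x \<in> carrier R \<Longrightarrow> \<iota> (\<ominus> x) = - \<iota> x"
  using iota_add[of "\<ominus> x" x] by (simp add: l_neg iota_zero eq_neg_iff_add_eq_0)

sublocale E: finite_field_trace "\<iota> ` carrier R" "\<iota> \<one>" p m
proof
  show "finite (\<iota> ` carrier R)" using fin by simp
  show "0 \<in> \<iota> ` carrier R" using iota_zero by (metis imageI zero_closed)
  show "\<iota> \<one> \<in> \<iota> ` carrier R" by simp
  show "x + y \<in> \<iota> ` carrier R" if "x \<in> \<iota> ` carrier R" "y \<in> \<iota> ` carrier R" for x y
    using that by (auto simp: iota_add[symmetric])
  show "x * y \<in> \<iota> ` carrier R" if "x \<in> \<iota> ` carrier R" "y \<in> \<iota> ` carrier R" for x y
    using that by (auto simp: iota_mult[symmetric])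
  show "- x \<in> \<iota> ` carrier R" if "x \<in> \<iota> ` carrier R" for x
    using that by (auto simp: iota_uminus[symmetric])
  show "\<iota> \<one> * x = x" if "x \<in> \<iota> ` carrier R" for x
    using that by (auto simp: iota_mult[symmetric])
  show "\<iota> \<one> \<noteq> 0" using iota_eq_iff[of \<one> \<zero>] by (simp add: iota_zero)
  show "\<exists>y\<in>\<iota> ` carrier R. x * y = \<iota> \<one>" if x: "x \<in> \<iota> ` carrier R" "x \<noteq> 0" for x
  proof -
    obtain a where a: "a \<in> carrier R" "x = \<iota> a" using x by auto
    then have "a \<in> Units R" using x(2) iota_zero field_Units by auto
    then show ?thesis
      using a iota_mult[of a "inv a"] by (intro bexI[of _ "\<iota> (inv a)"]) auto
  qed
  show "Factorial_Ring.prime p" by (rule prime_p)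
  show "card (\<iota> ` carrier R) = p ^ m" using iota_inj by (simp add: card_image card_R)
qed

lemma iota_pow: "x \<in> carrier R \<Longrightarrow> 0 < k \<Longrightarrow> \<iota> (x [^] (k :: nat)) = \<iota> x ^ k"
proof (induction k)
  case (Suc k)
  then show ?case by (cases "k = 0") (auto simp: iota_mult mult.commute)
qed simp

lemma iota_finsum:
  "finite I \<Longrightarrow> (\<And>i. i \<in> I \<Longrightarrow> f i \<in> carrier R) \<Longrightarrow> \<iota> (\<Oplus>i\<in>I. f i) = (\<Sum>i\<in>I. \<iota> (f i))"
  by (induction I rule: finite_induct) (auto simp: iota_zero iota_add Pi_def)

lemma iota_trace: "x \<in> carrier R \<Longrightarrow> \<iota> (field_trace R p m x) = E.trace (\<iota> x)"
  using E.p_gt_1 by (simp add: field_trace_def E.trace_def iota_finsum iota_pow)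

lemma iota_of_nat: "\<iota> ([k] \<cdot> \<one>) = of_nat k * \<iota> \<one>"
  by (induction k) (auto simp: iota_zero iota_add distrib_right add.commute)

lemma character_iota:
  assumes "x \<in> carrier R"
  shows "add_character R p m x = E.character (\<iota> x)"
proof -
  have t: "field_trace R p m x \<in> carrier R"
    unfolding field_trace_def using assms by (intro finsum_closed) auto
  have "prime_field_residue R p (field_trace R p m x) = E.residue (\<iota> (field_trace R p m x))"
    unfolding prime_field_residue_def E.residue_def
    using iota_eq_iff[OF _ t] by (simp flip: iota_of_nat)
  then show ?thesis
    using assms by (simp add: add_character_def E.character_def iota_trace)
qed

lemma trilinear_sum_iota:
  assumes "Xs \<subseteq> carrier R" "Ys \<subseteq> carrier R" "Zs \<subseteq> carrier R"
  defines "r \<equiv> the_inv_into (carrier R) \<iota>"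
  shows "trilinear_sum R p m Xs Ys Zs \<alpha> \<beta> \<gamma> = E.trisum (\<iota> ` Xs) (\<iota> ` Ys) (\<iota> ` Zs) (\<alpha> \<circ> r) (\<beta> \<circ> r) (\<gamma> \<circ> r)"
proof -
  have r: "r (\<iota> x) = x" if "x \<in> carrier R" for x
    unfolding r_def using iota_inj that by (rule the_inv_into_f_f)
  have inj: "inj_on \<iota> Xs" "inj_on \<iota> Ys" "inj_on \<iota> Zs" using iota_inj assms inj_on_subset by blast+
  show ?thesis
    unfolding trilinear_sum_def E.trisum_def sum.reindex[OF inj(1)] sum.reindex[OF inj(2)] sum.reindex[OF inj(3)]
    using assms(1-3) r by (intro sum.cong) (auto simp: character_iota iota_mult subset_iff)
qed

text \<open>
  Subfields of the embedded field are images of subfields of R, so the hypothesis on X can be transferred.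
\<close>

lemma subfield_set_pullback:
  assumes G: "E.subfield_set G"
  defines "G' \<equiv> {x \<in> carrier R. \<iota> x \<in> G}"
  shows "subfield G' R" "\<iota> ` G' = G" "card G' = card G"
proof -
  have GS: "G \<subseteq> \<iota> ` carrier R" and one: "\<iota> \<one> \<in> G"
    and diff: "\<And>x y. x \<in> G \<Longrightarrow> y \<in> G \<Longrightarrow> x - y \<in> G" and mult: "\<And>x y. x \<in> G \<Longrightarrow> y \<in> G \<Longrightarrow> x * y \<in> G"
    and inv: "\<And>x. x \<in> G \<Longrightarrow> x \<noteq> 0 \<Longrightarrow> \<exists>y\<in>G. x * y = \<iota> \<one>"
    using G unfolding E.subfield_set_def by auto
  have zero: "0 \<in> G" using diff[OF one one] by simp
  have neg: "- x \<in> G" if "x \<in> G" for x using diff[OF zero that] by simp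
  have add: "x + y \<in> G" if "x \<in> G" "y \<in> G" for x y using diff[OF that(1) neg[OF that(2)]] by simp
  have "subring G' R"
    by (rule subringI) (auto simp: G'_def one neg mult add iota_uminus iota_mult iota_add)
  then show "subfield G' R"
  proof (rule subfieldI')
    fix k assume k: "k \<in> G' - {\<zero>}"
    then have k': "k \<in> carrier R" "\<iota> k \<in> G" "k \<noteq> \<zero>" by (auto simp: G'_def)
    then have "\<iota> k \<noteq> 0" using iota_eq_iff[of k \<zero>] by (simp add: iota_zero)
    then obtain y where y: "y \<in> G" "\<iota> k * y = \<iota> \<one>" using inv k' by blast
    then obtain h where h: "h \<in> carrier R" "y = \<iota> h" using GS by blast
    have "k \<otimes> h = \<one>" using y h k' iota_eq_iff[of "k \<otimes> h" \<one>] by (simp add: iota_mult)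
    then have "inv k = h" using k' h by (intro comm_inv_char) auto
    then show "inv k \<in> G'" using y h by (simp add: G'_def)
  qed
  show img: "\<iota> ` G' = G" using GS by (auto simp: G'_def)
  have "inj_on \<iota> G'" using iota_inj by (rule inj_on_subset) (auto simp: G'_def)
  then show "card G' = card G" using img card_image by metis
qed

lemma small_pushforward:
  assumes small: "small_on_subfield_multiples R K Xs" and X: "Xs \<subseteq> carrier R"
    and G: "E.subfield_set G" "G \<noteq> \<iota> ` carrier R" and c: "c \<in> \<iota> ` carrier R"
  shows "real (card (\<iota> ` Xs \<inter> (*) c ` G)) \<le> K * sqrt (real (card G))"
proof -
  define G' where "G' = {x \<in> carrier R. \<iota> x \<in> G}"
  note G' = subfield_set_pullback[OF G(1), folded G'_def]
  obtain a where a: "a \<in> carrier R" "c = \<iota> a" using c by auto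
  have "G' \<noteq> carrier R" using G' G(2) by auto
  then have bound: "real (card (Xs \<inter> (a <# G'))) \<le> K * real (card G') powr (1/2)"
    using small G'(1) a unfolding small_on_subfield_multiples_def by blast
  have "\<iota> ` Xs \<inter> (*) c ` G \<subseteq> \<iota> ` (Xs \<inter> (a <# G'))"
  proof
    fix s assume "s \<in> \<iota> ` Xs \<inter> (*) c ` G"
    then obtain x g where x: "x \<in> Xs" "s = \<iota> x" and g: "g \<in> G'" "s = c * \<iota> g"
      using G'(2) by blast
    have gR: "g \<in> carrier R" using g by (simp add: G'_def)
    then have "\<iota> x = \<iota> (a \<otimes> g)" using x g a by (simp add: iota_mult)
    then have "x = a \<otimes> g" using iota_eq_iff[of x "a \<otimes> g"] X x a gR by auto
    then show "s \<in> \<iota> ` (Xs \<inter> (a <# G'))" using x g by (auto simp: l_coset_def)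
  qed
  then have "card (\<iota> ` Xs \<inter> (*) c ` G) \<le> card (Xs \<inter> (a <# G'))"
    using finite_subset[OF X fin] by (intro surj_card_le) auto
  then show ?thesis using bound G'(3) by (simp add: powr_half_sqrt)
qed

end

(* K is the implied constant of the hypothesis. C and the o(1) functions e1, e2, e3 are chosen
   before the field, so they are uniform over all finite fields. For this the fields must share
   one carrier type; nat loses nothing, as every finite field is isomorphic to one whose
   carrier is a set of naturals. The condition that Zs avoids 0 is needed: for m = 1,
   Xs = Ys = carrier R, Zs = {0} and all weights 1, the sum equals q^2, exceeding the bound
   for large q. *)
theorem theorem4:
  fixes K :: real
  assumes "K > 0"
  shows "\<exists>C>0. \<exists>e1 e2 e3 :: nat \<Rightarrow> real.
    e1 \<longlonglongrightarrow> 0 \<and> e2 \<longlonglongrightarrow> 0 \<and> e3 \<longlonglongrightarrow> 0 \<and>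
    (\<forall>(p::nat) (m::nat) (q::nat) (R :: nat ring) Xs Ys Zs \<alpha> \<beta> \<gamma>.
       Factorial_Ring.prime p \<longrightarrow> q = p ^ m \<longrightarrow>
       field R \<longrightarrow> finite (carrier R) \<longrightarrow> card (carrier R) = q \<longrightarrow>
       Xs \<subseteq> carrier R \<longrightarrow> Ys \<subseteq> carrier R \<longrightarrow> Zs \<subseteq> carrier R - {\<zero>\<^bsub>R\<^esub>} \<longrightarrow>
       card Xs \<ge> card Ys \<longrightarrow> card Ys \<ge> card Zs \<longrightarrow>
       small_on_subfield_multiples R K Xs \<longrightarrow>
       (\<forall>x\<in>Xs. cmod (\<alpha> x) \<le> 1) \<longrightarrow> (\<forall>y\<in>Ys. cmod (\<beta> y) \<le> 1) \<longrightarrow> (\<forall>z\<in>Zs. cmod (\<gamma> z) \<le> 1) \<longrightarrow>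
       cmod (trilinear_sum R p m Xs Ys Zs \<alpha> \<beta> \<gamma>) \<le>
         C * (real q powr (9/32 + e1 q) * real (card Xs) powr (95/128)
                * real (card Ys) powr (3/4) * real (card Zs) powr (15/16)
            + real q powr (17/58 + e2 q) * real (card Xs) powr (43/58)
                * real (card Ys) powr (87/116) * real (card Zs) powr (53/58)
            + real q powr (35/128 + e3 q) * real (card Xs) powr (97/128)
                * real (card Ys) powr (3/4) * real (card Zs) powr (15/16)))"
proof -
  define \<kappa> where "\<kappa> = max 1 K"
  define C where "C = 3 * (2^209 * \<kappa>\<^sup>2) powr (1/4)"
  \<comment> \<open>q powr \<epsilon> q = (log 2 q + 2)^9 absorbs the factor (l + 1)^9 of the previous bound\<close>
  define \<epsilon> where "\<epsilon> = (\<lambda>q :: nat. 9 * ln (log 2 (real q) + 2) / ln (real q))"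
  have \<kappa>: "1 \<le> \<kappa>" "K \<le> \<kappa>" by (auto simp: \<kappa>_def)
  then have C: "0 < C" by (simp add: C_def)
  have \<epsilon>: "\<epsilon> \<longlonglongrightarrow> 0" unfolding \<epsilon>_def by real_asymp
  have bound: "cmod (trilinear_sum R p m Xs Ys Zs \<alpha> \<beta> \<gamma>) \<le>
         C * (real q powr (9/32 + \<epsilon> q) * real (card Xs) powr (95/128)
                * real (card Ys) powr (3/4) * real (card Zs) powr (15/16)
            + real q powr (17/58 + \<epsilon> q) * real (card Xs) powr (43/58)
                * real (card Ys) powr (87/116) * real (card Zs) powr (53/58)
            + real q powr (35/128 + \<epsilon> q) * real (card Xs) powr (97/128)
                * real (card Ys) powr (3/4) * real (card Zs) powr (15/16))"
    if p: "Factorial_Ring.prime p" and q: "q = p ^ m" and R: "field R" "finite (carrier R)" "card (carrier R) = q"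
      and sub: "Xs \<subseteq> carrier R" "Ys \<subseteq> carrier R" "Zs \<subseteq> carrier R - {\<zero>\<^bsub>R\<^esub>}"
      and cards: "card Ys \<le> card Xs" "card Zs \<le> card Ys"
      and small: "small_on_subfield_multiples R K Xs"
      and \<alpha>: "\<forall>x\<in>Xs. cmod (\<alpha> x) \<le> 1" and \<beta>: "\<forall>y\<in>Ys. cmod (\<beta> y) \<le> 1" and \<gamma>: "\<forall>z\<in>Zs. cmod (\<gamma> z) \<le> 1"
    for p m q :: nat and R :: "nat ring" and Xs Ys Zs \<alpha> \<beta> \<gamma>
  proof -
    interpret F: embedded_finite_field R p m
      using R p q by (intro embedded_finite_field.intro embedded_finite_field_axioms.intro) auto
    let ?i = "coordinate_embedding R"
    define r where "r = the_inv_into (carrier R) ?i"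
    have ZsR: "Zs \<subseteq> carrier R" using sub by auto
    have r: "r (?i x) = x" if "x \<in> carrier R" for x
      unfolding r_def using F.iota_inj that by (rule the_inv_into_f_f)
    have card_i: "card (?i ` A) = card A" if "A \<subseteq> carrier R" for A
      using inj_on_subset[OF F.iota_inj that] by (rule card_image)
    have cq: "card (?i ` carrier R) = q" using card_i R by simp
    have q2: "2 \<le> q" using F.E.card_S_gt_1 cq by simp
    define l where "l = nat \<lceil>log 2 (real q)\<rceil>"
    have log0: "0 \<le> log 2 (real q)" using q2 by simp
    have l: "q \<le> 2 ^ l" "real l + 1 \<le> log 2 (real q) + 2"
    proof -
      have "real q = 2 powr (log 2 (real q))" using q2 by simp
      also have "\<dots> \<le> 2 powr (real l)" using log0 by (intro powr_mono) (auto simp: l_def)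
      also have "\<dots> = real (2 ^ l)" by (simp add: powr_realpow)
      finally show "q \<le> 2 ^ l" by (simp only: of_nat_le_iff)
      show "real l + 1 \<le> log 2 (real q) + 2" using log0 by (simp add: l_def) linarith
    qed
    have q\<epsilon>: "(real l + 1)^9 \<le> real q powr \<epsilon> q"
    proof -
      have "0 < ln (real q)" using q2 by simp
      then have "real q powr \<epsilon> q = exp (9 * ln (log 2 (real q) + 2))"
        using q2 by (simp add: powr_def \<epsilon>_def)
      also have "\<dots> = (log 2 (real q) + 2) powr 9" using log0 by (simp add: powr_def)
      also have "\<dots> = (log 2 (real q) + 2)^9" using log0 by (simp add: powr_numeral)
      finally show ?thesis using l(2) by (simp add: power_mono)
    qed
    define B1 where "B1 = real q powr (9/32) * real (card Xs) powr (95/128) * real (card Ys) powr (3/4) * real (card Zs) powr (15/16)"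
    define B2 where "B2 = real q powr (17/58) * real (card Xs) powr (43/58) * real (card Ys) powr (87/116) * real (card Zs) powr (53/58)"
    define B3 where "B3 = real q powr (35/128) * real (card Xs) powr (97/128) * real (card Ys) powr (3/4) * real (card Zs) powr (15/16)"
    have "cmod (F.E.trisum (?i ` Xs) (?i ` Ys) (?i ` Zs) (\<alpha> \<circ> r) (\<beta> \<circ> r) (\<gamma> \<circ> r)) \<le> C * (real l + 1)^9 * (B1 + B2 + B3)"
      unfolding C_def B1_def B2_def B3_def
      unfolding card_i[OF sub(1), symmetric] card_i[OF sub(2), symmetric] card_i[OF ZsR, symmetric] cq[symmetric]
    proof (rule F.E.trisum_bound)
      show "?i ` Xs \<subseteq> ?i ` carrier R" "?i ` Ys \<subseteq> ?i ` carrier R" using sub by auto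
      show "?i ` Zs \<subseteq> ?i ` carrier R - {0}"
      proof
        fix w assume "w \<in> ?i ` Zs"
        then obtain z where z: "z \<in> Zs" "w = ?i z" by auto
        then have "z \<in> carrier R" "z \<noteq> \<zero>\<^bsub>R\<^esub>" using sub(3) by auto
        then show "w \<in> ?i ` carrier R - {0}"
          using z F.iota_eq_iff[of z "\<zero>\<^bsub>R\<^esub>"] F.iota_zero by auto
      qed
      show "card (?i ` Ys) \<le> card (?i ` Xs)" "card (?i ` Zs) \<le> card (?i ` Ys)"
        using cards card_i sub(1,2) ZsR by simp_all
      show "card (?i ` carrier R) \<le> 2 ^ l" using l(1) cq by simp
      show "1 \<le> \<kappa>" by (rule \<kappa>(1))
      show "real (card (?i ` Xs \<inter> (*) c ` G)) \<le> \<kappa> * sqrt (real (card G))"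
        if "F.E.subfield_set G" "G \<noteq> ?i ` carrier R" "c \<in> ?i ` carrier R" for G c
      proof -
        have "K * sqrt (real (card G)) \<le> \<kappa> * sqrt (real (card G))"
          using \<kappa> by (intro mult_right_mono) auto
        then show ?thesis using F.small_pushforward[OF small sub(1) that] by linarith
      qed
      show "cmod ((\<alpha> \<circ> r) x) \<le> 1" if "x \<in> ?i ` Xs" for x using that \<alpha> r sub(1) by auto
      show "cmod ((\<beta> \<circ> r) x) \<le> 1" if "x \<in> ?i ` Ys" for x using that \<beta> r sub(2) by auto
      show "cmod ((\<gamma> \<circ> r) x) \<le> 1" if "x \<in> ?i ` Zs" for x using that \<gamma> r ZsR by auto
    qed
    then have "cmod (trilinear_sum R p m Xs Ys Zs \<alpha> \<beta> \<gamma>) \<le> C * (real l + 1)^9 * (B1 + B2 + B3)"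
      using F.trilinear_sum_iota[OF sub(1,2) ZsR] by (simp add: r_def)
    also have "\<dots> \<le> C * real q powr \<epsilon> q * (B1 + B2 + B3)"
      using q\<epsilon> C by (intro mult_right_mono mult_left_mono) (auto simp: B1_def B2_def B3_def)
    finally show ?thesis
      by (simp add: B1_def B2_def B3_def powr_add algebra_simps)
  qed
  show ?thesis
    using bound C \<epsilon> by (intro exI[of _ C] conjI exI[of _ \<epsilon>]) auto
qed

end
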